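(* Let $m,n,k,\ell$ be positive odd integers. If $(m,n)\neq(k,\ell)$, then the oriented Legendrian unknots $U(m,n)$ and $U(k,\ell)$ are not Legendrian isotopic (as oriented Legendrian knots).
   Context: $\mathbb{R}^3$ carries the contact structure $\xi^{std}=\ker(dz-y\,dx)$. A Legendrian knot is a smooth embedding $\gamma:\mathbb{S}^1\to\mathbb{R}^3$ everywhere tangent to $\xi^{std}$, oriented by its parametrisation. Two oriented Legendrian knots are Legendrian isotopic if they are connected by a smooth one-parameter family of Legendrian embeddings, compatibly with orientations. The front projection is $(x,y,z)\mapsto(x,z)$; generically it is an immersion with no vertical tangency apart from finitely many cusps and double points (crossings), and it determines the Legendrian knot (since $y=dz/dx$). A cusp of an oriented front is an up cusp (resp. down cusp) if, following the orientation through it, one moves in the positive (resp. negative) $z$-direction. $U(m,n)$ denotes the oriented Legendrian unknot given by a front diagram that is a simple closed curve without crossings (a zigzag flying-saucer front) with exactly $m$ up cusps and $n$ down cusps such that, traversing the knot along its orientation from a suitable strand, one first meets the $m$ up cusps consecutively and then the $n$ down cusps consecutively. (For such a front, $m$ and $n$ are necessarily odd.) *)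

theory Defs
  imports "HOL-Analysis.Analysis"
begin

(* Meant for open S only: there (at x) and (at x within S) agree. *)
fun Ck_on :: "nat \<Rightarrow> 'a::euclidean_space set \<Rightarrow> ('a \<Rightarrow> 'b::real_normed_vector) \<Rightarrow> bool" where
  "Ck_on 0 S f \<longleftrightarrow> continuous_on S f"
| "Ck_on (Suc k) S f \<longleftrightarrow> (\<forall>x\<in>S. f differentiable (at x)) \<and>
     (\<forall>v. Ck_on k S (\<lambda>x. frechet_derivative f (at x) v))"

definition smooth_on_open :: "'a::euclidean_space set \<Rightarrow> ('a \<Rightarrow> 'b::real_normed_vector) \<Rightarrow> bool" where
  "smooth_on_open S f \<longleftrightarrow> open S \<and> (\<forall>k. Ck_on k S f)"

(* The coordinates (x, y, z) of R^3 are the components 1, 2, 3; the contact plane at p is the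
   kernel of dz - y dx. *)
definition xi_std :: "real ^ 3 \<Rightarrow> (real ^ 3) set" where
  "xi_std p = {v. v $ 3 - p $ 2 * v $ 1 = 0}"

(* The circle is R / Z: a map on it is a 1-periodic map on R. The equivalence below states
   periodicity and injectivity on the circle at once; as the circle is compact, an injective
   immersion is an embedding. *)
definition legendrian_knot :: "(real \<Rightarrow> real ^ 3) \<Rightarrow> bool" where
  "legendrian_knot \<gamma> \<longleftrightarrow>
     smooth_on_open UNIV \<gamma> \<and>
     (\<forall>s t. \<gamma> s = \<gamma> t \<longleftrightarrow> s - t \<in> \<int>) \<and>
     (\<forall>t. vector_derivative \<gamma> (at t) \<noteq> 0) \<and>
     (\<forall>t. vector_derivative \<gamma> (at t) \<in> xi_std (\<gamma> t))"

(* Lifts to R of the orientation-preserving diffeomorphisms of R / Z. *)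
definition oriented_reparam :: "(real \<Rightarrow> real) \<Rightarrow> bool" where
  "oriented_reparam \<phi> \<longleftrightarrow>
     smooth_on_open UNIV \<phi> \<and> (\<forall>t. \<phi> (t + 1) = \<phi> t + 1) \<and> (\<forall>t. deriv \<phi> t > 0)"

(* Smoothness on the manifold with boundary [0,1] x R means smoothness of an extension to an
   open neighbourhood. The end of the isotopy has to be the oriented knot given by delta, so
   an orientation-preserving change of parameter is allowed; allowing one at the start too
   would give the same relation. *)
definition legendrian_isotopic :: "(real \<Rightarrow> real ^ 3) \<Rightarrow> (real \<Rightarrow> real ^ 3) \<Rightarrow> bool" where
  "legendrian_isotopic \<gamma> \<delta> \<longleftrightarrow>
     (\<exists>\<Gamma> :: real \<Rightarrow> real \<Rightarrow> real ^ 3.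
        (\<exists>W. {0..1} \<times> UNIV \<subseteq> W \<and> smooth_on_open W (\<lambda>(s, t). \<Gamma> s t)) \<and>
        (\<forall>s\<in>{0..1}. legendrian_knot (\<Gamma> s)) \<and>
        \<Gamma> 0 = \<gamma> \<and>
        (\<exists>\<phi>. oriented_reparam \<phi> \<and> \<Gamma> 1 = \<delta> \<circ> \<phi>))"

definition front :: "(real \<Rightarrow> real ^ 3) \<Rightarrow> real \<Rightarrow> real \<times> real" where
  "front \<gamma> t = (\<gamma> t $ 1, \<gamma> t $ 3)"

(* Ordinary (semicubical) cusp of a plane curve c: the velocity vanishes and the second and
   third derivatives of c are linearly independent. *)
definition cusp :: "(real \<Rightarrow> real \<times> real) \<Rightarrow> real \<Rightarrow> bool" where
  "cusp c t \<longleftrightarrow>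
     (let x = (\<lambda>u. fst (c u)); z = (\<lambda>u. snd (c u)) in
        deriv x t = 0 \<and> deriv z t = 0 \<and>
        (deriv ^^ 2) x t * (deriv ^^ 3) z t - (deriv ^^ 2) z t * (deriv ^^ 3) x t \<noteq> 0)"

(* Away from cusps the x-velocity is nonzero: the curve is immersed and not vertical. *)
definition front_without_crossings :: "(real \<Rightarrow> real ^ 3) \<Rightarrow> bool" where
  "front_without_crossings \<gamma> \<longleftrightarrow>
     (\<forall>t. cusp (front \<gamma>) t \<or> deriv (\<lambda>u. fst (front \<gamma> u)) t \<noteq> 0) \<and>
     finite {t \<in> {0..<1}. cusp (front \<gamma>) t} \<and>
     (\<forall>s t. front \<gamma> s = front \<gamma> t \<longleftrightarrow> s - t \<in> \<int>)"

(* The two branches at a cusp have a common, possibly sloping, tangent line, so z itself need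
   not be monotone through the cusp. Moving in the positive z-direction means passing from the
   lower branch to the upper one, i.e. comparing z at points with the same x. *)
definition up_cusp :: "(real \<Rightarrow> real \<times> real) \<Rightarrow> real \<Rightarrow> bool" where
  "up_cusp c t \<longleftrightarrow> cusp c t \<and>
     (\<exists>\<epsilon>>0. \<forall>a\<in>{t - \<epsilon><..<t}. \<forall>b\<in>{t<..<t + \<epsilon>}.
        fst (c a) = fst (c b) \<longrightarrow> snd (c a) < snd (c b))"

definition down_cusp :: "(real \<Rightarrow> real \<times> real) \<Rightarrow> real \<Rightarrow> bool" where
  "down_cusp c t \<longleftrightarrow> cusp c t \<and>
     (\<exists>\<epsilon>>0. \<forall>a\<in>{t - \<epsilon><..<t}. \<forall>b\<in>{t<..<t + \<epsilon>}.
        fst (c a) = fst (c b) \<longrightarrow> snd (c a) > snd (c b))"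

(* "gamma is a U(m,n)". The parameter t0 lies on the strand from which the knot is traversed
   once. *)
definition legendrian_U :: "nat \<Rightarrow> nat \<Rightarrow> (real \<Rightarrow> real ^ 3) \<Rightarrow> bool" where
  "legendrian_U m n \<gamma> \<longleftrightarrow>
     legendrian_knot \<gamma> \<and> front_without_crossings \<gamma> \<and>
     (\<exists>t0. \<not> cusp (front \<gamma>) t0 \<and>
        (let Up = {t \<in> {t0..<t0 + 1}. up_cusp (front \<gamma>) t};
             Down = {t \<in> {t0..<t0 + 1}. down_cusp (front \<gamma>) t}
         in card Up = m \<and> card Down = n \<and> (\<forall>a\<in>Up. \<forall>b\<in>Down. a < b)))"

end

theory Submission
  imports Defs
begin

text \<open>The numbers of up and down cusps are recovered from two isotopy invariants, the
  Thurston--Bennequin number and the rotation number, both realised as integrals.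

  Let \<open>X\<close> and \<open>Y\<close> be the increments of \<open>x\<close> and \<open>y\<close> along the chord from parameter \<open>a\<close> to \<open>a + d\<close>,
  and let \<open>W\<close> be the increment of \<open>z\<close> minus \<open>X\<close> times the mean of the two values of \<open>y\<close>, i.e. the area
  between arc and chord in the \<open>xy\<close>-plane. As the knot is embedded, \<open>(X, Y, W) \<noteq> 0\<close> for \<open>0 < d < 1\<close>. Pull
  back to this annulus a closed 2-form on \<open>\<real>\<^sup>3 - {0}\<close> supported in the cones where \<open>\<bar>x\<bar>, \<bar>y\<bar> < \<bar>w\<bar>\<close>.
  For \<open>d\<close> near 0 or 1 the chord has length of order \<open>d\<close> (or \<open>1 - d\<close>) and \<open>W\<close> is quadratically small, so
  the form vanishes there, and by Stokes its integral does not change under Legendrian isotopy.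
  For a front without crossings \<open>(X, W)\<close> never vanishes. Away from the \<open>y\<close>-axis the form is exact, so the integral
  becomes a boundary integral over short chords, to which every cusp contributes the same amount;
  its value is minus the number of cusps.

  The same computation for the family \<open>(x', 2 d - 1, \<kappa> y')\<close> with a small \<open>\<kappa> > 0\<close> yields the number of
  up cusps minus the number of down cusps.\<close>

section \<open>A closed form supported in two cones\<close>

text \<open>The raw chord will not do: on a short chord the increment of z is about y times that of
  x, so no cone around the z-axis is avoided. Passing to \<open>W\<close> changes nothing about
  vanishing, since \<open>W\<close> is the increment of z as soon as \<open>X\<close> = 0. Taking
  the mean of the two values of y makes all three coordinates change sign with the direction of the
  chord, so a chord with d near 1 is a reversed short chord and needs no estimates of its own.

  Each cone carries mass 1, so the first integral is twice the Thurston-Bennequin number (minus half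
  the number of cusps if there are no crossings) and the second is, up to sign, twice the rotation
  number. The second family is the suspension of the loop of velocities, and \<kappa> presses the
  loop towards the x-axis until the form sees only the cusps.

  The form is a product of differentials of one-variable steps. This makes its primitive explicit:
  at a cusp one step is frozen at 1/2 or -1/2 while the other rises or falls by 1, so a cusp
  contributes 1/2 in absolute value at each of the two edges.\<close>

definition step :: "real \<Rightarrow> real" where
  "step u = 9/32 * (\<bar>u + 1\<bar>^3 - 3 * \<bar>u + 1/3\<bar>^3 + 3 * \<bar>u - 1/3\<bar>^3 - \<bar>u - 1\<bar>^3)"

text \<open>\<open>step\<close> is the third difference, with spacing 2/3, of the cube of the
  absolute value. That of a cubic polynomial is constant, hence \<open>step\<close> is constant
  beyond -1 and beyond 1; the factor 9/32 makes the total rise 1. Its derivative \<open>bump\<close>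
  is the quadratic B-spline, which is just smooth enough for \<open>kern\<close> to be
  differentiated once.\<close>

definition bump :: "real \<Rightarrow> real" where
  "bump u = 27/32 * ((u + 1) * \<bar>u + 1\<bar> - 3 * ((u + 1/3) * \<bar>u + 1/3\<bar>)
     + 3 * ((u - 1/3) * \<bar>u - 1/3\<bar>) - (u - 1) * \<bar>u - 1\<bar>)"

definition bump' :: "real \<Rightarrow> real" where
  "bump' u = 27/16 * (\<bar>u + 1\<bar> - 3 * \<bar>u + 1/3\<bar> + 3 * \<bar>u - 1/3\<bar> - \<bar>u - 1\<bar>)"

lemma DERIV_mult_abs: "((\<lambda>v::real. v * \<bar>v\<bar>) has_real_derivative 2 * \<bar>v\<bar>) (at v)"
proof (cases "v = 0")
  case True
  have "((\<lambda>h::real. \<bar>h\<bar>) \<longlongrightarrow> 0) (at 0)"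
    by (rule tendsto_eq_intros | simp)+
  then have "((\<lambda>h::real. ((0 + h) * \<bar>0 + h\<bar> - 0 * \<bar>0\<bar>) / h) \<longlongrightarrow> 0) (at 0)"
    by (rule Lim_transform_eventually) (auto simp: eventually_at intro!: exI[of _ 1])
  then show ?thesis using True by (simp add: DERIV_def)
next
  case False
  have *: "((\<lambda>v::real. v * (sgn v0 * v)) has_real_derivative 2 * (sgn v0 * v)) (at v)" for v0
    by (auto intro!: derivative_eq_intros)
  have "eventually (\<lambda>u. sgn u = sgn v) (nhds v)"
    using False eventually_nhds_in_open[of "{0<..}" v] eventually_nhds_in_open[of "{..<0}" v]
    by (cases "v > 0") (auto elim: eventually_mono)
  then have "eventually (\<lambda>u. u * \<bar>u\<bar> = u * (sgn v * u)) (nhds v)"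
    by eventually_elim (metis abs_sgn mult.commute)
  then show ?thesis
    using *[of v] by (subst DERIV_cong_ev[OF refl _ refl]) (auto simp: abs_sgn mult.commute)
qed

lemma DERIV_abs_cube: "((\<lambda>v::real. \<bar>v\<bar>^3) has_real_derivative 3 * (v * \<bar>v\<bar>)) (at v)"
proof -
  have eq: "(\<lambda>v::real. \<bar>v\<bar>^3) = (\<lambda>v. v * (v * \<bar>v\<bar>))"
    by (auto simp: fun_eq_iff abs_if power3_eq_cube)
  show ?thesis
    unfolding eq using DERIV_mult[OF DERIV_ident DERIV_mult_abs, of v] by (simp add: algebra_simps)
qed

lemma DERIV_shift_compose:
  fixes f :: "real \<Rightarrow> real"
  assumes "\<And>v. (f has_real_derivative f' v) (at v)"
  shows "((\<lambda>u. f (u + c)) has_real_derivative f' (u + c)) (at u)"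
proof -
  have "((\<lambda>u. u + c) has_real_derivative 1) (at u)"
    by (auto intro!: derivative_eq_intros)
  from DERIV_chain2[OF assms this] show ?thesis by simp
qed

lemma DERIV_step: "(step has_real_derivative bump u) (at u)"
  \<comment> \<open>Every shift has to read \<open>u + c\<close> for
    \<open>DERIV_shift_compose\<close> to match.\<close>
  unfolding step_def[abs_def] bump_def diff_conv_add_uminus[of _ "1/3"] diff_conv_add_uminus[of _ "1"]
  by (rule derivative_eq_intros DERIV_shift_compose[OF DERIV_abs_cube] refl)+ (simp add: algebra_simps)

lemma DERIV_bump: "(bump has_real_derivative bump' u) (at u)"
  unfolding bump_def[abs_def] bump'_def diff_conv_add_uminus[of _ "1/3"] diff_conv_add_uminus[of _ "1"]
  by (rule derivative_eq_intros DERIV_shift_compose[OF DERIV_mult_abs] refl)+ (simp add: algebra_simps)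

lemma step_eq_half: "u \<ge> 1 \<Longrightarrow> step u = 1/2" and step_eq_minus_half: "u \<le> -1 \<Longrightarrow> step u = -1/2"
  by (simp_all add: step_def, simp_all add: abs_if power3_eq_cube, (simp_all add: field_simps)?)

lemma bump_eq_0: "\<bar>u\<bar> \<ge> 1 \<Longrightarrow> bump u = 0" and bump'_eq_0: "\<bar>u\<bar> \<ge> 1 \<Longrightarrow> bump' u = 0"
proof -
  assume "\<bar>u\<bar> \<ge> 1"
  then consider "u \<ge> 1" | "u \<le> -1" by linarith
  then have "bump u = 0 \<and> bump' u = 0"
    by cases (simp_all add: bump_def bump'_def abs_of_nonneg abs_of_nonpos field_simps)
  then show "bump u = 0" "bump' u = 0" by auto
qed

lemma continuous_step: "continuous_on A step" and continuous_bump: "continuous_on A bump"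
  using DERIV_step DERIV_bump by (meson DERIV_continuous_on has_field_derivative_at_within)+

lemma continuous_bump': "continuous_on A bump'"
  unfolding bump'_def[abs_def] by (intro continuous_intros)

text \<open>Where \<open>w \<noteq> 0\<close>, the contraction of \<open>kern x y w \<sqdot> (x, y, w)\<close> with the volume form is
  \<open>sgn w \<sqdot> d (step (x / w)) \<and> d (step (y / w))\<close>. Division by zero makes \<open>kern\<close> vanish for
  \<open>w = 0\<close>, the value of its continuous extension outside the origin.\<close>

definition kern :: "real \<Rightarrow> real \<Rightarrow> real \<Rightarrow> real" where
  "kern x y w = sgn w * bump (x / w) * bump (y / w) / w^3"

definition kern_x :: "real \<Rightarrow> real \<Rightarrow> real \<Rightarrow> real" where
  "kern_x x y w = sgn w * bump' (x / w) * bump (y / w) / w^4"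

definition kern_y :: "real \<Rightarrow> real \<Rightarrow> real \<Rightarrow> real" where
  "kern_y x y w = sgn w * bump (x / w) * bump' (y / w) / w^4"

text \<open>Obtained from Euler's relation for degree -3 instead of the quotient rule. For w = 0
  division by zero again gives the right value off the origin, where \<open>kern\<close> vanishes on
  a neighbourhood.\<close>

definition kern_w :: "real \<Rightarrow> real \<Rightarrow> real \<Rightarrow> real" where
  "kern_w x y w = - (3 * kern x y w + x * kern_x x y w + y * kern_y x y w) / w"

lemma kern_euler: "x * kern_x x y w + y * kern_y x y w + w * kern_w x y w = - 3 * kern x y w"
  by (cases "w = 0") (simp_all add: kern_w_def kern_x_def kern_y_def kern_def)

text \<open>The 1-form \<open>prim x y w \<sqdot> (w dx - x dw) = sgn w \<sqdot> step (y / w) \<sqdot> d (step (x / w))\<close> is, up to sign, a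
  primitive of that 2-form off the \<open>y\<close>-axis.\<close>

definition prim :: "real \<Rightarrow> real \<Rightarrow> real \<Rightarrow> real" where
  "prim x y w = sgn w * step (y / w) * bump (x / w) / w\<^sup>2"

definition prim_x :: "real \<Rightarrow> real \<Rightarrow> real \<Rightarrow> real" where
  "prim_x x y w = sgn w * step (y / w) * bump' (x / w) / w^3"

text \<open>Euler's relation once more, now for degree -2. The y-derivative has no name of its own
  because it is \<open>kern\<close>.\<close>

definition prim_w :: "real \<Rightarrow> real \<Rightarrow> real \<Rightarrow> real" where
  "prim_w x y w = - (2 * prim x y w + x * prim_x x y w + y * kern x y w) / w"

lemma prim_euler: "x * prim_x x y w + y * kern x y w + w * prim_w x y w = - 2 * prim x y w"
  by (cases "w = 0") (simp_all add: prim_w_def prim_x_def prim_def kern_def)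

section \<open>Regularity of the kernel and of its primitive off their singular sets\<close>

lemma bump_ratio_eq_0:
  assumes "\<bar>x\<bar> \<ge> \<bar>w\<bar>" "w \<noteq> 0" shows "bump (x / w) = 0" "bump' (x / w) = 0"
  using assms by (auto intro!: bump_eq_0 bump'_eq_0 simp: field_simps)

lemma kern_eq_0:
  assumes "\<bar>x\<bar> \<ge> \<bar>w\<bar> \<or> \<bar>y\<bar> \<ge> \<bar>w\<bar>"
  shows "kern x y w = 0" "kern_x x y w = 0" "kern_y x y w = 0" "kern_w x y w = 0"
  using assms bump_ratio_eq_0[of w x] bump_ratio_eq_0[of w y]
  by (cases "w = 0"; force simp: kern_def kern_x_def kern_y_def kern_w_def)+

lemma prim_eq_0:
  assumes "\<bar>x\<bar> \<ge> \<bar>w\<bar>"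
  shows "prim x y w = 0" "prim_x x y w = 0" "prim_w x y w = 0"
  using assms bump_ratio_eq_0[of w x]
  by (cases "w = 0"; force simp: prim_def prim_x_def prim_w_def kern_def)+

text \<open>Regularity across the plane w = 0: a function that vanishes outside the cone where the
  first coordinate is smaller than w vanishes near every point with w = 0 and nonzero first
  coordinate.\<close>

lemma tendsto_if_zero_dominated:
  fixes f g h :: "'a \<Rightarrow> real"
  assumes "(f \<longlongrightarrow> x) F" "(g \<longlongrightarrow> 0) F" "x \<noteq> 0" and h: "\<And>a. \<bar>f a\<bar> \<ge> \<bar>g a\<bar> \<Longrightarrow> h a = 0"
  shows "(h \<longlongrightarrow> 0) F"
proof -
  have "((\<lambda>a. \<bar>f a\<bar> - \<bar>g a\<bar>) \<longlongrightarrow> \<bar>x\<bar> - \<bar>0\<bar>) F"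
    by (intro tendsto_intros assms)
  then have "eventually (\<lambda>a. \<bar>f a\<bar> - \<bar>g a\<bar> > 0) F"
    using assms(3) by (intro order_tendstoD) auto
  then have "eventually (\<lambda>a. 0 = h a) F"
    by eventually_elim (use h in force)
  then show ?thesis
    by (rule Lim_transform_eventually[OF tendsto_const])
qed

lemma DERIV_if_zero_dominated:
  fixes f g h :: "real \<Rightarrow> real"
  assumes "(f has_real_derivative f') (at t within S)" "(g has_real_derivative g') (at t within S)"
    "f t \<noteq> 0" "g t = 0" and h: "\<And>a. \<bar>f a\<bar> \<ge> \<bar>g a\<bar> \<Longrightarrow> h a = 0"
  shows "(h has_real_derivative 0) (at t within S)"
proof -
  have "(f \<longlongrightarrow> f t) (at t within S)" "(g \<longlongrightarrow> g t) (at t within S)"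
    using DERIV_continuous[OF assms(1)] DERIV_continuous[OF assms(2)] by (auto simp: continuous_within)
  then have "((\<lambda>a. \<bar>f a\<bar> - \<bar>g a\<bar>) \<longlongrightarrow> \<bar>f t\<bar> - \<bar>0\<bar>) (at t within S)"
    using assms(4) by (intro tendsto_intros) auto
  then have "eventually (\<lambda>a. \<bar>f a\<bar> - \<bar>g a\<bar> > 0) (at t within S)"
    using assms(3) by (intro order_tendstoD) auto
  then have "eventually (\<lambda>a. h a = 0) (at t within S)"
    by eventually_elim (use h in force)
  moreover have "h t = 0"
    using h[of t] assms(4) by simp
  ultimately show ?thesis
    by (subst has_field_derivative_cong_eventually[where g = "\<lambda>_. 0"]) (auto intro: DERIV_const)
qed

lemma tendsto_ratio_parts:
  assumes "(X \<longlongrightarrow> x) F" "(W \<longlongrightarrow> w) F" "w \<noteq> 0"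
  shows "((\<lambda>a. bump (X a / W a)) \<longlongrightarrow> bump (x / w)) F" "((\<lambda>a. bump' (X a / W a)) \<longlongrightarrow> bump' (x / w)) F"
    "((\<lambda>a. step (X a / W a)) \<longlongrightarrow> step (x / w)) F"
  using continuous_on_tendsto_compose[OF continuous_bump[of UNIV] tendsto_divide[OF assms]]
    continuous_on_tendsto_compose[OF continuous_bump'[of UNIV] tendsto_divide[OF assms]]
    continuous_on_tendsto_compose[OF continuous_step[of UNIV] tendsto_divide[OF assms]]
  by simp_all

lemma tendsto_kern:
  assumes lim: "(X \<longlongrightarrow> x) F" "(Y \<longlongrightarrow> y) F" "(W \<longlongrightarrow> w) F" and nz: "x \<noteq> 0 \<or> y \<noteq> 0 \<or> w \<noteq> 0"
  shows "((\<lambda>a. kern (X a) (Y a) (W a)) \<longlongrightarrow> kern x y w) F"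
    "((\<lambda>a. kern_x (X a) (Y a) (W a)) \<longlongrightarrow> kern_x x y w) F"
    "((\<lambda>a. kern_y (X a) (Y a) (W a)) \<longlongrightarrow> kern_y x y w) F"
    "((\<lambda>a. kern_w (X a) (Y a) (W a)) \<longlongrightarrow> kern_w x y w) F"
proof -
  consider "w \<noteq> 0" | "w = 0" "x \<noteq> 0" | "w = 0" "y \<noteq> 0" using nz by blast
  then have "((\<lambda>a. kern (X a) (Y a) (W a)) \<longlongrightarrow> kern x y w) F \<and>
    ((\<lambda>a. kern_x (X a) (Y a) (W a)) \<longlongrightarrow> kern_x x y w) F \<and>
    ((\<lambda>a. kern_y (X a) (Y a) (W a)) \<longlongrightarrow> kern_y x y w) F \<and>
    ((\<lambda>a. kern_w (X a) (Y a) (W a)) \<longlongrightarrow> kern_w x y w) F"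
  proof cases
    case 1
    note parts = tendsto_ratio_parts[OF lim(1,3) 1] tendsto_ratio_parts[OF lim(2,3) 1]
    have k: "((\<lambda>a. kern (X a) (Y a) (W a)) \<longlongrightarrow> kern x y w) F"
      "((\<lambda>a. kern_x (X a) (Y a) (W a)) \<longlongrightarrow> kern_x x y w) F"
      "((\<lambda>a. kern_y (X a) (Y a) (W a)) \<longlongrightarrow> kern_y x y w) F"
      unfolding kern_def kern_x_def kern_y_def using 1 by (intro tendsto_intros lim parts; simp)+
    then show ?thesis
      unfolding kern_w_def using 1 by (auto intro!: tendsto_intros lim)
  next
    case 2
    then show ?thesis
      using lim by (auto intro!: tendsto_if_zero_dominated[of X x F W] simp: kern_eq_0)
  next
    case 3
    then show ?thesis
      using lim by (auto intro!: tendsto_if_zero_dominated[of Y y F W] simp: kern_eq_0)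
  qed
  then show "((\<lambda>a. kern (X a) (Y a) (W a)) \<longlongrightarrow> kern x y w) F"
    "((\<lambda>a. kern_x (X a) (Y a) (W a)) \<longlongrightarrow> kern_x x y w) F"
    "((\<lambda>a. kern_y (X a) (Y a) (W a)) \<longlongrightarrow> kern_y x y w) F"
    "((\<lambda>a. kern_w (X a) (Y a) (W a)) \<longlongrightarrow> kern_w x y w) F"
    by blast+
qed

lemma tendsto_prim:
  assumes lim: "(X \<longlongrightarrow> x) F" "(Y \<longlongrightarrow> y) F" "(W \<longlongrightarrow> w) F" and nz: "x \<noteq> 0 \<or> w \<noteq> 0"
  shows "((\<lambda>a. prim (X a) (Y a) (W a)) \<longlongrightarrow> prim x y w) F"
    "((\<lambda>a. prim_x (X a) (Y a) (W a)) \<longlongrightarrow> prim_x x y w) F"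
    "((\<lambda>a. prim_w (X a) (Y a) (W a)) \<longlongrightarrow> prim_w x y w) F"
proof -
  have "((\<lambda>a. prim (X a) (Y a) (W a)) \<longlongrightarrow> prim x y w) F \<and>
    ((\<lambda>a. prim_x (X a) (Y a) (W a)) \<longlongrightarrow> prim_x x y w) F \<and>
    ((\<lambda>a. prim_w (X a) (Y a) (W a)) \<longlongrightarrow> prim_w x y w) F"
  proof (cases "w = 0")
    case False
    note parts = tendsto_ratio_parts[OF lim(1,3) False] tendsto_ratio_parts[OF lim(2,3) False]
    have k: "((\<lambda>a. prim (X a) (Y a) (W a)) \<longlongrightarrow> prim x y w) F"
      "((\<lambda>a. prim_x (X a) (Y a) (W a)) \<longlongrightarrow> prim_x x y w) F"
      unfolding prim_def prim_x_def using False by (intro tendsto_intros lim parts; simp)+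
    then show ?thesis
      unfolding prim_w_def using False by (auto intro!: tendsto_intros lim tendsto_kern)
  next
    case True
    then show ?thesis
      using lim nz by (auto intro!: tendsto_if_zero_dominated[of X x F W] simp: prim_eq_0)
  qed
  then show "((\<lambda>a. prim (X a) (Y a) (W a)) \<longlongrightarrow> prim x y w) F"
    "((\<lambda>a. prim_x (X a) (Y a) (W a)) \<longlongrightarrow> prim_x x y w) F"
    "((\<lambda>a. prim_w (X a) (Y a) (W a)) \<longlongrightarrow> prim_w x y w) F"
    by blast+
qed

lemma continuous_on_kern:
  assumes "continuous_on S X" "continuous_on S Y" "continuous_on S W"
    and "\<And>a. a \<in> S \<Longrightarrow> X a \<noteq> 0 \<or> Y a \<noteq> 0 \<or> W a \<noteq> 0"
  shows "continuous_on S (\<lambda>a. kern (X a) (Y a) (W a))"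
    "continuous_on S (\<lambda>a. kern_x (X a) (Y a) (W a))"
    "continuous_on S (\<lambda>a. kern_y (X a) (Y a) (W a))"
    "continuous_on S (\<lambda>a. kern_w (X a) (Y a) (W a))"
  using assms unfolding continuous_on_def by (auto intro!: tendsto_kern)

lemma continuous_on_prim:
  assumes "continuous_on S X" "continuous_on S Y" "continuous_on S W"
    and "\<And>a. a \<in> S \<Longrightarrow> X a \<noteq> 0 \<or> W a \<noteq> 0"
  shows "continuous_on S (\<lambda>a. prim (X a) (Y a) (W a))"
    "continuous_on S (\<lambda>a. prim_x (X a) (Y a) (W a))"
    "continuous_on S (\<lambda>a. prim_w (X a) (Y a) (W a))"
  using assms unfolding continuous_on_def by (auto intro!: tendsto_prim)

lemma DERIV_sgn_const:
  assumes "(W has_real_derivative W') (at t within S)" "W t \<noteq> 0"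
  shows "((\<lambda>a. sgn (W a)) has_real_derivative 0) (at t within S)"
proof -
  have "((\<lambda>a. W a * W t) \<longlongrightarrow> W t * W t) (at t within S)"
    using DERIV_continuous[OF assms(1)] by (auto simp: continuous_within intro!: tendsto_intros)
  then have "eventually (\<lambda>a. W a * W t > 0) (at t within S)"
    using assms(2) by (intro order_tendstoD(1)[of _ "W t * W t"]) (auto simp: zero_less_mult_iff)
  then have "eventually (\<lambda>a. sgn (W a) = sgn (W t)) (at t within S)"
    by eventually_elim (auto simp: zero_less_mult_iff)
  then show ?thesis
    by (subst has_field_derivative_cong_eventually[where g = "\<lambda>_. sgn (W t)"]) (auto intro: DERIV_const)
qed

lemma DERIV_kern:
  assumes d: "(X has_real_derivative X') (at t within S)" "(Y has_real_derivative Y') (at t within S)"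
    "(W has_real_derivative W') (at t within S)" and nz: "X t \<noteq> 0 \<or> Y t \<noteq> 0 \<or> W t \<noteq> 0"
  shows "((\<lambda>a. kern (X a) (Y a) (W a)) has_real_derivative
    kern_x (X t) (Y t) (W t) * X' + kern_y (X t) (Y t) (W t) * Y' + kern_w (X t) (Y t) (W t) * W') (at t within S)"
proof -
  consider "W t \<noteq> 0" | "W t = 0" "X t \<noteq> 0" | "W t = 0" "Y t \<noteq> 0" using nz by blast
  then show ?thesis
  proof cases
    case 1
    show ?thesis
      unfolding kern_def
      apply (rule derivative_eq_intros d DERIV_sgn_const[OF d(3)] DERIV_chain2[OF DERIV_bump] refl 1)+
      using 1 apply simp
      apply (simp add: kern_x_def kern_y_def kern_w_def kern_def)
      using 1 by (simp add: field_simps eval_nat_numeral)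
  next
    case 2
    then show ?thesis
      using DERIV_if_zero_dominated[OF d(1) d(3), of "\<lambda>a. kern (X a) (Y a) (W a)"] by (simp add: kern_eq_0)
  next
    case 3
    then show ?thesis
      using DERIV_if_zero_dominated[OF d(2) d(3), of "\<lambda>a. kern (X a) (Y a) (W a)"] by (simp add: kern_eq_0)
  qed
qed

lemma DERIV_prim:
  assumes d: "(X has_real_derivative X') (at t within S)" "(Y has_real_derivative Y') (at t within S)"
    "(W has_real_derivative W') (at t within S)" and nz: "X t \<noteq> 0 \<or> W t \<noteq> 0"
  shows "((\<lambda>a. prim (X a) (Y a) (W a)) has_real_derivative
    prim_x (X t) (Y t) (W t) * X' + kern (X t) (Y t) (W t) * Y' + prim_w (X t) (Y t) (W t) * W') (at t within S)"
proof (cases "W t = 0")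
  case False
  show ?thesis
    unfolding prim_def
    apply (rule derivative_eq_intros d DERIV_sgn_const[OF d(3)] DERIV_chain2[OF DERIV_bump] DERIV_chain2[OF DERIV_step] refl False)+
    using False apply simp
    apply (simp add: prim_x_def prim_w_def prim_def kern_def)
    using False by (simp add: field_simps eval_nat_numeral)
next
  case True
  then show ?thesis
    using nz DERIV_if_zero_dominated[OF d(1) d(3), of "\<lambda>a. prim (X a) (Y a) (W a)"]
    by (simp add: prim_eq_0 kern_eq_0)
qed

section \<open>Stokes' theorem for families of loops\<close>

definition det3 :: "real \<Rightarrow> real \<Rightarrow> real \<Rightarrow> real \<Rightarrow> real \<Rightarrow> real \<Rightarrow> real \<Rightarrow> real \<Rightarrow> real \<Rightarrow> real" where
  "det3 x y w x' y' w' x'' y'' w'' = x * (y' * w'' - w' * y'') - y * (x' * w'' - w' * x'') + w * (x' * y'' - y' * x'')"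

definition cont3 :: "(real \<Rightarrow> real \<Rightarrow> real \<Rightarrow> real) \<Rightarrow> bool" where
  "cont3 f \<longleftrightarrow> continuous_on ({0..1} \<times> UNIV) (\<lambda>(s, a, d). f s a d)"

lemma cont3_compose:
  assumes "cont3 f" "continuous_on A S" "continuous_on A a" "continuous_on A d" "\<And>p. p \<in> A \<Longrightarrow> S p \<in> {0..1}"
  shows "continuous_on A (\<lambda>p. f (S p) (a p) (d p))"
  using continuous_on_compose2[of _ "\<lambda>(s, a, d). f s a d" A "\<lambda>p. (S p, a p, d p)"] assms
  by (force simp: cont3_def intro: continuous_intros)

lemma DERIV_prim_form:
  assumes d: "(X has_real_derivative X') (at t within S)" "(Y has_real_derivative Y') (at t within S)"
    "(W has_real_derivative W') (at t within S)" and nz: "X t \<noteq> 0 \<or> W t \<noteq> 0"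
    and d1: "(P has_real_derivative P') (at t within S)" "(Q has_real_derivative Q') (at t within S)"
  shows "((\<lambda>a. prim (X a) (Y a) (W a) * (P a * W a - X a * Q a)) has_real_derivative
     (prim_x (X t) (Y t) (W t) * X' + kern (X t) (Y t) (W t) * Y' + prim_w (X t) (Y t) (W t) * W')
       * (P t * W t - X t * Q t)
     + prim (X t) (Y t) (W t) * (P' * W t + P t * W' - X' * Q t - X t * Q')) (at t within S)"
  by (rule derivative_eq_intros DERIV_prim d d1 nz refl)+ (simp add: algebra_simps)

lemma DERIV_kern_det3:
  assumes d: "(X has_real_derivative X') (at t within S)" "(Y has_real_derivative Y') (at t within S)"
    "(W has_real_derivative W') (at t within S)" and nz: "X t \<noteq> 0 \<or> Y t \<noteq> 0 \<or> W t \<noteq> 0"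
    and d1: "(X1 has_real_derivative X1') (at t within S)" "(Y1 has_real_derivative Y1') (at t within S)"
    "(W1 has_real_derivative W1') (at t within S)"
    and d2: "(X2 has_real_derivative X2') (at t within S)" "(Y2 has_real_derivative Y2') (at t within S)"
    "(W2 has_real_derivative W2') (at t within S)"
  shows "((\<lambda>a. kern (X a) (Y a) (W a) * det3 (X a) (Y a) (W a) (X1 a) (Y1 a) (W1 a) (X2 a) (Y2 a) (W2 a))
    has_real_derivative
     (kern_x (X t) (Y t) (W t) * X' + kern_y (X t) (Y t) (W t) * Y' + kern_w (X t) (Y t) (W t) * W')
       * det3 (X t) (Y t) (W t) (X1 t) (Y1 t) (W1 t) (X2 t) (Y2 t) (W2 t)
     + kern (X t) (Y t) (W t) * (det3 X' Y' W' (X1 t) (Y1 t) (W1 t) (X2 t) (Y2 t) (W2 t)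
        + det3 (X t) (Y t) (W t) X1' Y1' W1' (X2 t) (Y2 t) (W2 t)
        + det3 (X t) (Y t) (W t) (X1 t) (Y1 t) (W1 t) X2' Y2' W2')) (at t within S)"
proof -
  have D: "((\<lambda>a. det3 (X a) (Y a) (W a) (X1 a) (Y1 a) (W1 a) (X2 a) (Y2 a) (W2 a)) has_real_derivative
      det3 X' Y' W' (X1 t) (Y1 t) (W1 t) (X2 t) (Y2 t) (W2 t)
        + det3 (X t) (Y t) (W t) X1' Y1' W1' (X2 t) (Y2 t) (W2 t)
        + det3 (X t) (Y t) (W t) (X1 t) (Y1 t) (W1 t) X2' Y2' W2') (at t within S)"
    unfolding det3_def by (rule derivative_eq_intros d d1 d2 refl)+ (simp add: algebra_simps)
  show ?thesis
    by (rule DERIV_cong[OF DERIV_mult[OF DERIV_kern[OF d nz] D]]) (simp add: algebra_simps)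
qed

text \<open>Cramer's rule: the three determinants with (x, y, w) in the first row are, up to the
  common factor on the right, the coefficients of (x, y, w) in the basis formed by the s-, a- and
  d-vectors. The linear form g is applied to that expansion.\<close>

lemma det3_cramer:
  "(g1 * xs + g2 * ys + g3 * ws) * det3 x y w xa ya wa xd yd wd
   + (g1 * xa + g2 * ya + g3 * wa) * det3 x y w xd yd wd xs ys ws
   + (g1 * xd + g2 * yd + g3 * wd) * det3 x y w xs ys ws xa ya wa
   = (x * g1 + y * g2 + w * g3) * det3 xs ys ws xa ya wa xd yd wd"
  unfolding det3_def by (simp add: algebra_simps)

lemma det3_cyclic: "det3 xa ya wa xd yd wd xs ys ws = det3 xs ys ws xa ya wa xd yd wd"
  and det3_swap: "det3 x y w xa ya wa xd yd wd = - det3 x y w xd yd wd xa ya wa"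
  unfolding det3_def by (simp_all add: algebra_simps)

lemma integral_deriv_box:
  fixes f f' :: "real \<Rightarrow> real \<Rightarrow> real"
  assumes "a0 \<le> a1" "d0 \<le> d1"
    and cont: "continuous_on (cbox (a0, d0) (a1, d1)) (\<lambda>p. f' (fst p) (snd p))"
  shows "(\<And>a d. a \<in> {a0..a1} \<Longrightarrow> d \<in> {d0..d1} \<Longrightarrow> ((\<lambda>d. f a d) has_real_derivative f' a d) (at d)) \<Longrightarrow>
      integral (cbox (a0, d0) (a1, d1)) (\<lambda>p. f' (fst p) (snd p)) = integral {a0..a1} (\<lambda>a. f a d1 - f a d0)"
    and "(\<And>a d. a \<in> {a0..a1} \<Longrightarrow> d \<in> {d0..d1} \<Longrightarrow> ((\<lambda>a. f a d) has_real_derivative f' a d) (at a)) \<Longrightarrow>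
      integral (cbox (a0, d0) (a1, d1)) (\<lambda>p. f' (fst p) (snd p)) = integral {d0..d1} (\<lambda>d. f a1 d - f a0 d)"
proof -
  have box: "integral (cbox (a0, d0) (a1, d1)) (\<lambda>p. f' (fst p) (snd p))
    = integral {a0..a1} (\<lambda>a. integral {d0..d1} (\<lambda>d. f' a d))"
    using integral_prod_continuous[OF cont] by simp
  have swap: "integral {a0..a1} (\<lambda>a. integral {d0..d1} (\<lambda>d. f' a d))
     = integral {d0..d1} (\<lambda>d. integral {a0..a1} (\<lambda>a. f' a d))"
    using integral_swap_continuous[of a0 d0 a1 d1 f'] cont by (simp add: case_prod_beta')
  { assume D: "\<And>a d. a \<in> {a0..a1} \<Longrightarrow> d \<in> {d0..d1} \<Longrightarrow> ((\<lambda>d. f a d) has_real_derivative f' a d) (at d)"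
    have "integral {d0..d1} (\<lambda>d. f' a d) = f a d1 - f a d0" if "a \<in> {a0..a1}" for a
      using D[OF that, THEN has_field_derivative_at_within]
      by (intro integral_unique fundamental_theorem_of_calculus assms)
        (simp flip: has_real_derivative_iff_has_vector_derivative)
    then show "integral (cbox (a0, d0) (a1, d1)) (\<lambda>p. f' (fst p) (snd p)) = integral {a0..a1} (\<lambda>a. f a d1 - f a d0)"
      unfolding box by (intro integral_cong) auto }
  { assume D: "\<And>a d. a \<in> {a0..a1} \<Longrightarrow> d \<in> {d0..d1} \<Longrightarrow> ((\<lambda>a. f a d) has_real_derivative f' a d) (at a)"
    have "integral {a0..a1} (\<lambda>a. f' a d) = f a1 d - f a0 d" if "d \<in> {d0..d1}" for d
      using D[OF _ that, THEN has_field_derivative_at_within]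
      by (intro integral_unique fundamental_theorem_of_calculus assms)
        (simp flip: has_real_derivative_iff_has_vector_derivative)
    then show "integral (cbox (a0, d0) (a1, d1)) (\<lambda>p. f' (fst p) (snd p)) = integral {d0..d1} (\<lambda>d. f a1 d - f a0 d)"
      unfolding box swap by (intro integral_cong) auto }
qed

text \<open>These are the derivatives that occur in the exterior derivative of a pulled-back 2-form.
  Pure second derivatives do not occur, and the two orders of each mixed derivative share one name,
  which encodes their symmetry. At the ends of the isotopy the s-derivative is one-sided; a is the
  circle parameter.\<close>

locale C2_family =
  fixes f fs fa fd fsa fsd fad :: "real \<Rightarrow> real \<Rightarrow> real \<Rightarrow> real"
  assumes DERIV_s: "s \<in> {0..1} \<Longrightarrow> ((\<lambda>s. f s a d) has_real_derivative fs s a d) (at s within {0..1})"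
    and DERIV_a: "s \<in> {0..1} \<Longrightarrow> ((\<lambda>a. f s a d) has_real_derivative fa s a d) (at a)"
    and DERIV_d: "s \<in> {0..1} \<Longrightarrow> ((\<lambda>d. f s a d) has_real_derivative fd s a d) (at d)"
    and DERIV_sa: "s \<in> {0..1} \<Longrightarrow> ((\<lambda>a. fs s a d) has_real_derivative fsa s a d) (at a)"
    and DERIV_as: "s \<in> {0..1} \<Longrightarrow> ((\<lambda>s. fa s a d) has_real_derivative fsa s a d) (at s within {0..1})"
    and DERIV_sd: "s \<in> {0..1} \<Longrightarrow> ((\<lambda>d. fs s a d) has_real_derivative fsd s a d) (at d)"
    and DERIV_ds: "s \<in> {0..1} \<Longrightarrow> ((\<lambda>s. fd s a d) has_real_derivative fsd s a d) (at s within {0..1})"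
    and DERIV_ad: "s \<in> {0..1} \<Longrightarrow> ((\<lambda>d. fa s a d) has_real_derivative fad s a d) (at d)"
    and DERIV_da: "s \<in> {0..1} \<Longrightarrow> ((\<lambda>a. fd s a d) has_real_derivative fad s a d) (at a)"
    and cont: "cont3 f" "cont3 fs" "cont3 fa" "cont3 fd" "cont3 fsa" "cont3 fsd" "cont3 fad"
    and periodic: "s \<in> {0..1} \<Longrightarrow> f s (a + 1) d = f s a d" "s \<in> {0..1} \<Longrightarrow> fs s (a + 1) d = fs s a d"
      "s \<in> {0..1} \<Longrightarrow> fd s (a + 1) d = fd s a d"

text \<open>For each s, a closed band with coordinates (a, d) is mapped to the punctured space. The
  condition on the edges is the hypothesis of \<open>kern_eq_0\<close>, so the form vanishes
  there.\<close>

locale loop_family =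
  X: C2_family X Xs Xa Xd Xsa Xsd Xad + Y: C2_family Y Ys Ya Yd Ysa Ysd Yad +
  W: C2_family W Ws Wa Wd Wsa Wsd Wad
  for X Xs Xa Xd Xsa Xsd Xad Y Ys Ya Yd Ysa Ysd Yad W Ws Wa Wd Wsa Wsd Wad +
  fixes d0 d1 :: real
  assumes d0_le_d1: "d0 \<le> d1"
    and nonzero: "s \<in> {0..1} \<Longrightarrow> d \<in> {d0..d1} \<Longrightarrow> X s a d \<noteq> 0 \<or> Y s a d \<noteq> 0 \<or> W s a d \<noteq> 0"
    and boundary: "s \<in> {0..1} \<Longrightarrow> d = d0 \<or> d = d1 \<Longrightarrow> \<bar>X s a d\<bar> \<ge> \<bar>W s a d\<bar> \<or> \<bar>Y s a d\<bar> \<ge> \<bar>W s a d\<bar>"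
begin

text \<open>The coefficient of the pulled-back 2-form: contracting the volume form with the radial
  field puts the position into the first row of a determinant.\<close>

definition density :: "real \<Rightarrow> real \<Rightarrow> real \<Rightarrow> real" where
  "density s a d = kern (X s a d) (Y s a d) (W s a d) *
     det3 (X s a d) (Y s a d) (W s a d) (Xa s a d) (Ya s a d) (Wa s a d) (Xd s a d) (Yd s a d) (Wd s a d)"

text \<open>With P = (X, Y, W), the three flux functions are the s-, a- and d-derivatives of
  \<open>kern\<close> times the determinants of (P, P_a, P_d), (P, P_d, P_s) and (P, P_s, P_a),
  expanded by the product rule. Their sum is the coefficient of the exterior derivative of the
  pullback.\<close>

definition flux_s :: "real \<Rightarrow> real \<Rightarrow> real \<Rightarrow> real" where
  "flux_s s a d =
     (kern_x (X s a d) (Y s a d) (W s a d) * Xs s a d + kern_y (X s a d) (Y s a d) (W s a d) * Ys s a d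
       + kern_w (X s a d) (Y s a d) (W s a d) * Ws s a d)
     * det3 (X s a d) (Y s a d) (W s a d) (Xa s a d) (Ya s a d) (Wa s a d) (Xd s a d) (Yd s a d) (Wd s a d)
     + kern (X s a d) (Y s a d) (W s a d) *
       (det3 (Xs s a d) (Ys s a d) (Ws s a d) (Xa s a d) (Ya s a d) (Wa s a d) (Xd s a d) (Yd s a d) (Wd s a d)
       + det3 (X s a d) (Y s a d) (W s a d) (Xsa s a d) (Ysa s a d) (Wsa s a d) (Xd s a d) (Yd s a d) (Wd s a d)
       + det3 (X s a d) (Y s a d) (W s a d) (Xa s a d) (Ya s a d) (Wa s a d) (Xsd s a d) (Ysd s a d) (Wsd s a d))"

definition flux_a :: "real \<Rightarrow> real \<Rightarrow> real \<Rightarrow> real" where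
  "flux_a s a d =
     (kern_x (X s a d) (Y s a d) (W s a d) * Xa s a d + kern_y (X s a d) (Y s a d) (W s a d) * Ya s a d
       + kern_w (X s a d) (Y s a d) (W s a d) * Wa s a d)
     * det3 (X s a d) (Y s a d) (W s a d) (Xd s a d) (Yd s a d) (Wd s a d) (Xs s a d) (Ys s a d) (Ws s a d)
     + kern (X s a d) (Y s a d) (W s a d) *
       (det3 (Xa s a d) (Ya s a d) (Wa s a d) (Xd s a d) (Yd s a d) (Wd s a d) (Xs s a d) (Ys s a d) (Ws s a d)
       + det3 (X s a d) (Y s a d) (W s a d) (Xad s a d) (Yad s a d) (Wad s a d) (Xs s a d) (Ys s a d) (Ws s a d)
       + det3 (X s a d) (Y s a d) (W s a d) (Xd s a d) (Yd s a d) (Wd s a d) (Xsa s a d) (Ysa s a d) (Wsa s a d))"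

definition flux_d :: "real \<Rightarrow> real \<Rightarrow> real \<Rightarrow> real" where
  "flux_d s a d =
     (kern_x (X s a d) (Y s a d) (W s a d) * Xd s a d + kern_y (X s a d) (Y s a d) (W s a d) * Yd s a d
       + kern_w (X s a d) (Y s a d) (W s a d) * Wd s a d)
     * det3 (X s a d) (Y s a d) (W s a d) (Xs s a d) (Ys s a d) (Ws s a d) (Xa s a d) (Ya s a d) (Wa s a d)
     + kern (X s a d) (Y s a d) (W s a d) *
       (det3 (Xd s a d) (Yd s a d) (Wd s a d) (Xs s a d) (Ys s a d) (Ws s a d) (Xa s a d) (Ya s a d) (Wa s a d)
       + det3 (X s a d) (Y s a d) (W s a d) (Xsd s a d) (Ysd s a d) (Wsd s a d) (Xa s a d) (Ya s a d) (Wa s a d)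
       + det3 (X s a d) (Y s a d) (W s a d) (Xs s a d) (Ys s a d) (Ws s a d) (Xad s a d) (Yad s a d) (Wad s a d))"

text \<open>The kernel is homogeneous of degree \<open>-3\<close>, so the radial field \<open>kern \<sqdot> (x, y, w)\<close> is
  divergence free.\<close>

lemma flux_sum: "flux_s s a d = - (flux_a s a d + flux_d s a d)"
proof -
  note c = det3_cramer[of "kern_x (X s a d) (Y s a d) (W s a d)" "Xs s a d" "kern_y (X s a d) (Y s a d) (W s a d)"
      "Ys s a d" "kern_w (X s a d) (Y s a d) (W s a d)" "Ws s a d" "X s a d" "Y s a d" "W s a d"
      "Xa s a d" "Ya s a d" "Wa s a d" "Xd s a d" "Yd s a d" "Wd s a d",
      unfolded kern_euler]
  note sw = det3_swap[of "X s a d" "Y s a d" "W s a d" "Xsa s a d" "Ysa s a d" "Wsa s a d"]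
    det3_swap[of "X s a d" "Y s a d" "W s a d" "Xsd s a d" "Ysd s a d" "Wsd s a d"]
    det3_swap[of "X s a d" "Y s a d" "W s a d" "Xad s a d" "Yad s a d" "Wad s a d"]
  note cy = det3_cyclic[of "Xa s a d" "Ya s a d" "Wa s a d" "Xd s a d" "Yd s a d" "Wd s a d" "Xs s a d" "Ys s a d" "Ws s a d"]
    det3_cyclic[of "Xd s a d" "Yd s a d" "Wd s a d" "Xs s a d" "Ys s a d" "Ws s a d" "Xa s a d" "Ya s a d" "Wa s a d"]
  show ?thesis
    unfolding flux_s_def flux_a_def flux_d_def sw cy
    using c by (simp add: algebra_simps)
qed

lemma continuous_on_flux:
  assumes "continuous_on A S" "continuous_on A a" "continuous_on A d"
    "\<And>p. p \<in> A \<Longrightarrow> S p \<in> {0..1}" "\<And>p. p \<in> A \<Longrightarrow> d p \<in> {d0..d1}"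
  shows "continuous_on A (\<lambda>p. density (S p) (a p) (d p))"
    "continuous_on A (\<lambda>p. flux_s (S p) (a p) (d p))"
    "continuous_on A (\<lambda>p. flux_a (S p) (a p) (d p))"
    "continuous_on A (\<lambda>p. flux_d (S p) (a p) (d p))"
  unfolding density_def flux_s_def flux_a_def flux_d_def det3_def
  by (intro continuous_intros continuous_on_kern X.cont[THEN cont3_compose] Y.cont[THEN cont3_compose]
      W.cont[THEN cont3_compose] nonzero assms; assumption)+

definition total :: "real \<Rightarrow> real" where
  "total s = integral (cbox (0, d0) (1, d1)) (\<lambda>p. density s (fst p) (snd p))"

text \<open>The s-derivative of the density is minus a divergence in (a, d). The a-part integrates
  to 0 because the loops close up, the d-part because \<open>kern\<close> vanishes on both
  edges.\<close>

lemma total_const: "total 1 = total 0"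
proof -
  have "(total has_real_derivative 0) (at s within {0..1})" if s: "s \<in> {0..1}" for s
  proof -
    have bx: "snd p \<in> {d0..d1}" if "p \<in> cbox (0, d0) (1, d1)" for p :: "real \<times> real"
      using that by (cases p) auto
    have "((\<lambda>s. integral (cbox (0, d0) (1, d1)) (\<lambda>p. density s (fst p) (snd p))) has_real_derivative
        integral (cbox (0, d0) (1, d1)) (\<lambda>p. flux_s s (fst p) (snd p))) (at s within {0..1})"
    proof (rule leibniz_rule_field_derivative)
      show "((\<lambda>s. density s (fst p) (snd p)) has_real_derivative flux_s s (fst p) (snd p)) (at s within {0..1})"
        if "s \<in> {0..1}" "p \<in> cbox (0, d0) (1, d1)" for s p
        unfolding density_def flux_s_def using that bx[OF that(2)]
        by (intro DERIV_kern_det3 X.DERIV_s Y.DERIV_s W.DERIV_s X.DERIV_as Y.DERIV_as W.DERIV_as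
            X.DERIV_ds Y.DERIV_ds W.DERIV_ds nonzero)
      show "(\<lambda>p. density s (fst p) (snd p)) integrable_on cbox (0, d0) (1, d1)" if "s \<in> {0..1}" for s
        by (intro integrable_continuous continuous_on_flux continuous_intros) (use that bx in auto)
      show "continuous_on ({0..1} \<times> cbox (0, d0) (1, d1)) (\<lambda>(s, p). flux_s s (fst p) (snd p))"
        unfolding case_prod_beta' by (intro continuous_on_flux continuous_intros) (auto simp: bx)
    qed (use s in auto)
    moreover have "integral (cbox (0, d0) (1, d1)) (\<lambda>p. flux_s s (fst p) (snd p)) = 0"
    proof -
      have ca: "continuous_on (cbox (0, d0) (1, d1)) (\<lambda>p. flux_a s (fst p) (snd p))"
        and cd: "continuous_on (cbox (0, d0) (1, d1)) (\<lambda>p. flux_d s (fst p) (snd p))"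
        by (intro continuous_on_flux continuous_intros; use s bx in auto)+
      define Q where "Q a d = kern (X s a d) (Y s a d) (W s a d) *
        det3 (X s a d) (Y s a d) (W s a d) (Xd s a d) (Yd s a d) (Wd s a d) (Xs s a d) (Ys s a d) (Ws s a d)" for a d
      define R where "R a d = kern (X s a d) (Y s a d) (W s a d) *
        det3 (X s a d) (Y s a d) (W s a d) (Xs s a d) (Ys s a d) (Ws s a d) (Xa s a d) (Ya s a d) (Wa s a d)" for a d
      have "integral (cbox (0, d0) (1, d1)) (\<lambda>p. flux_a s (fst p) (snd p)) = integral {d0..d1} (\<lambda>d. Q 1 d - Q 0 d)"
      proof (rule integral_deriv_box(2)[OF _ d0_le_d1 ca])
        show "((\<lambda>a. Q a d) has_real_derivative flux_a s a d) (at a)" if "d \<in> {d0..d1}" for a d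
          unfolding Q_def flux_a_def using that s
          by (intro DERIV_kern_det3 X.DERIV_a Y.DERIV_a W.DERIV_a X.DERIV_da Y.DERIV_da W.DERIV_da
              X.DERIV_sa Y.DERIV_sa W.DERIV_sa nonzero)
      qed auto
      moreover have "Q 1 d - Q 0 d = 0" for d
        using X.periodic[OF s, of 0 d] Y.periodic[OF s, of 0 d] W.periodic[OF s, of 0 d] by (simp add: Q_def)
      moreover have "integral (cbox (0, d0) (1, d1)) (\<lambda>p. flux_d s (fst p) (snd p)) = integral {0..1} (\<lambda>a. R a d1 - R a d0)"
      proof (rule integral_deriv_box(1)[OF _ d0_le_d1 cd])
        show "((\<lambda>d. R a d) has_real_derivative flux_d s a d) (at d)" if "d \<in> {d0..d1}" for a d
          unfolding R_def flux_d_def using that s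
          by (intro DERIV_kern_det3 X.DERIV_d Y.DERIV_d W.DERIV_d X.DERIV_sd Y.DERIV_sd W.DERIV_sd
              X.DERIV_ad Y.DERIV_ad W.DERIV_ad nonzero)
      qed auto
      moreover have "R a d = 0" if "d = d0 \<or> d = d1" for a d
        using boundary[OF s that] by (simp add: R_def kern_eq_0)
      ultimately show ?thesis
        unfolding flux_sum integral_neg integral_add[OF integrable_continuous[OF ca] integrable_continuous[OF cd]]
        by simp
    qed
    ultimately show ?thesis
      by (simp add: total_def[abs_def])
  qed
  then obtain c where "\<And>s. s \<in> {0..1} \<Longrightarrow> total s = c"
    using has_field_derivative_zero_constant[of "{0..1}" total] by auto
  then show ?thesis
    by simp
qed

definition edge :: "real \<Rightarrow> real \<Rightarrow> real" where
  "edge s d = integral {0..1} (\<lambda>a. prim (X s a d) (Y s a d) (W s a d) * (Xa s a d * W s a d - X s a d * Wa s a d))"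

text \<open>Stokes for the primitive: as the band avoids the y-axis, the pulled-back form is exact,
  the a-derivative disappears by periodicity, and only the two edges remain.\<close>

lemma total_eq_edge:
  assumes s: "s \<in> {0..1}" and nz: "\<And>a d. d \<in> {d0..d1} \<Longrightarrow> X s a d \<noteq> 0 \<or> W s a d \<noteq> 0"
  shows "total s = edge s d1 - edge s d0"
proof -
  have bx: "snd p \<in> {d0..d1}" if "p \<in> cbox (0, d0) (1, d1)" for p :: "real \<times> real"
    using that by (cases p) auto
  define M where "M a d = prim (X s a d) (Y s a d) (W s a d) * (Xa s a d * W s a d - X s a d * Wa s a d)" for a d
  define N where "N a d = prim (X s a d) (Y s a d) (W s a d) * (Xd s a d * W s a d - X s a d * Wd s a d)" for a d
  define Md where "Md a d = (prim_x (X s a d) (Y s a d) (W s a d) * Xd s a d + kern (X s a d) (Y s a d) (W s a d) * Yd s a d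
     + prim_w (X s a d) (Y s a d) (W s a d) * Wd s a d) * (Xa s a d * W s a d - X s a d * Wa s a d)
     + prim (X s a d) (Y s a d) (W s a d) * (Xad s a d * W s a d + Xa s a d * Wd s a d - Xd s a d * Wa s a d - X s a d * Wad s a d)" for a d
  define Na where "Na a d = (prim_x (X s a d) (Y s a d) (W s a d) * Xa s a d + kern (X s a d) (Y s a d) (W s a d) * Ya s a d
     + prim_w (X s a d) (Y s a d) (W s a d) * Wa s a d) * (Xd s a d * W s a d - X s a d * Wd s a d)
     + prim (X s a d) (Y s a d) (W s a d) * (Xad s a d * W s a d + Xd s a d * Wa s a d - Xa s a d * Wd s a d - X s a d * Wad s a d)" for a d
  have cM: "continuous_on (cbox (0, d0) (1, d1)) (\<lambda>p. Md (fst p) (snd p))"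
    and cN: "continuous_on (cbox (0, d0) (1, d1)) (\<lambda>p. Na (fst p) (snd p))"
    unfolding Md_def Na_def
    by (intro continuous_intros continuous_on_prim continuous_on_kern X.cont[THEN cont3_compose] Y.cont[THEN cont3_compose]
      W.cont[THEN cont3_compose]; use s bx nz in blast)+
  have dM: "((\<lambda>d. M a d) has_real_derivative Md a d) (at d)" if "d \<in> {d0..d1}" for a d
    unfolding M_def Md_def using s nz[OF that]
    by (intro DERIV_prim_form X.DERIV_d Y.DERIV_d W.DERIV_d X.DERIV_ad W.DERIV_ad)
  have dN: "((\<lambda>a. N a d) has_real_derivative Na a d) (at a)" if "d \<in> {d0..d1}" for a d
    unfolding N_def Na_def using s nz[OF that]
    by (intro DERIV_prim_form X.DERIV_a Y.DERIV_a W.DERIV_a X.DERIV_da W.DERIV_da)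
  have per: "N 1 d - N 0 d = 0" for d
    using X.periodic[OF s, of 0 d] Y.periodic[OF s, of 0 d] W.periodic[OF s, of 0 d] by (simp add: N_def)
  \<comment> \<open>Euler's relation, multiplied by the (X, W) minor, trades the terms with
    \<open>prim\<close>, \<open>prim_x\<close> and \<open>prim_w\<close> for the missing
    \<open>kern\<close> term of the determinant.\<close>
  have dens: "density s a d = Md a d - Na a d" for a d
    using arg_cong[OF prim_euler[of "X s a d" "Y s a d" "W s a d"], of "\<lambda>u. u * (Xa s a d * Wd s a d - Xd s a d * Wa s a d)"]
    unfolding density_def Md_def Na_def det3_def by (simp add: algebra_simps)
  have "total s = integral (cbox (0, d0) (1, d1)) (\<lambda>p. Md (fst p) (snd p)) - integral (cbox (0, d0) (1, d1)) (\<lambda>p. Na (fst p) (snd p))"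
    unfolding total_def dens using cM cN by (intro integral_diff integrable_continuous)
  also have "integral (cbox (0, d0) (1, d1)) (\<lambda>p. Md (fst p) (snd p)) = integral {0..1} (\<lambda>a. M a d1 - M a d0)"
    using dM by (intro integral_deriv_box(1)[OF _ d0_le_d1 cM]) auto
  also have "integral (cbox (0, d0) (1, d1)) (\<lambda>p. Na (fst p) (snd p)) = integral {d0..d1} (\<lambda>d. N 1 d - N 0 d)"
    using dN by (intro integral_deriv_box(2)[OF _ d0_le_d1 cN]) auto
  also have "integral {d0..d1} (\<lambda>d. N 1 d - N 0 d) = 0"
    unfolding per by simp
  also have "integral {0..1} (\<lambda>a. M a d1 - M a d0) = edge s d1 - edge s d0"
  proof -
    have "continuous_on {0..1} (\<lambda>a. M a d)" if "d \<in> {d0..d1}" for d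
      unfolding M_def
      by (intro continuous_intros continuous_on_prim X.cont[THEN cont3_compose] Y.cont[THEN cont3_compose]
        W.cont[THEN cont3_compose]; use s nz that in blast)+
    then show ?thesis
      unfolding edge_def M_def[symmetric] using d0_le_d1 by (intro integral_diff integrable_continuous_interval) auto
  qed
  finally show ?thesis by simp
qed

end

section \<open>Localisation of the boundary integral\<close>

lemma integral_periodic_shift:
  fixes f :: "real \<Rightarrow> real"
  assumes cont: "continuous_on UNIV f" and per: "\<And>a. f (a + 1) = f a"
  shows "integral {t..t + 1} f = integral {0..1} f"
proof -
  \<comment> \<open>The margins put both windows, from 0 and from t, into the interior, where the
    sliding integral has derivative f (u + 1) - f u = 0.\<close>
  define c where "c = min 0 t - 1"
  define D where "D = max 0 t + 3"
  define F where "F u = integral {c..u} f" for u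
  define S where "S = {c<..<D - 1}"
  have F: "(F has_real_derivative f u) (at u)" if "c < u" "u < D" for u
  proof -
    have "(F has_real_derivative f u) (at u within {c..D})"
      unfolding F_def
      by (rule integral_has_real_derivative[OF continuous_on_subset[OF cont]]) (use that in auto)
    moreover have "at u within {c..D} = at u"
      using that by (intro at_within_interior) simp
    ultimately show ?thesis by simp
  qed
  have "((\<lambda>u. F (u + 1) - F u) has_real_derivative 0) (at u within S)" if "u \<in> S" for u
  proof -
    have u: "c < u" "u < D - 1"
      using that by (auto simp: S_def)
    have "((\<lambda>u. F (u + 1)) has_real_derivative f (u + 1)) (at u)"
      using F[of "u + 1"] u DERIV_shift[of F "f (u + 1)" u 1] by simp
    from DERIV_diff[OF this F[of u]] u have "((\<lambda>u. F (u + 1) - F u) has_real_derivative 0) (at u)"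
      by (simp add: per)
    then show ?thesis
      by (rule has_field_derivative_at_within)
  qed
  then obtain k where k: "\<And>u. u \<in> S \<Longrightarrow> F (u + 1) - F u = k"
    using has_field_derivative_zero_constant[of S "\<lambda>u. F (u + 1) - F u"] by (auto simp: S_def)
  have "F (u + 1) - F u = integral {u..u + 1} f" if "u \<in> S" for u
  proof -
    have "f integrable_on {c..u + 1}"
      by (intro integrable_continuous_interval continuous_on_subset[OF cont]) simp
    from Henstock_Kurzweil_Integration.integral_combine[OF _ _ this, of u] that show ?thesis
      by (simp add: F_def S_def)
  qed
  moreover have "0 \<in> S" "t \<in> S" by (auto simp: S_def c_def D_def)
  ultimately show ?thesis
    by (metis k add_0)
qed

lemma step_eq_sgn: "\<bar>u\<bar> \<ge> 1 \<Longrightarrow> step u = sgn u / 2"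
  using step_eq_half[of u] step_eq_minus_half[of u] by (cases "u > 0") auto

text \<open>Away from C the integrand vanishes because \<open>X\<close> dominates \<open>W\<close>.
  Near c the ratio \<open>Y / W\<close> is so large that its \<open>step\<close> is frozen at a
  constant, and the integrand becomes exact: a multiple of the derivative of
  \<open>step (X / W)\<close>. Since \<open>X\<close> dominates again at c - r and c + r, only the
  signs there matter.\<close>

lemma integral_prim_eq_sum:
  fixes X Y W Xa Wa e y w :: "real \<Rightarrow> real"
  assumes X: "\<And>a. (X has_real_derivative Xa a) (at a)" and W: "\<And>a. (W has_real_derivative Wa a) (at a)"
    and C: "finite C" "\<And>c. c \<in> C \<Longrightarrow> t \<le> c - r \<and> c + r \<le> t + 1" and "r > 0"
    and sep: "\<And>c c'. c \<in> C \<Longrightarrow> c' \<in> C \<Longrightarrow> c \<noteq> c' \<Longrightarrow> \<bar>c - c'\<bar> > 2 * r"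
    and near: "\<And>c a. c \<in> C \<Longrightarrow> a \<in> {c - r..c + r} \<Longrightarrow> sgn (W a) = w c \<and> sgn (Y a) = y c \<and> \<bar>Y a\<bar> \<ge> \<bar>W a\<bar>"
    and nz: "\<And>c. c \<in> C \<Longrightarrow> w c \<noteq> 0"
    and ends: "\<And>c. c \<in> C \<Longrightarrow> sgn (X (c + r)) = e c \<and> sgn (X (c - r)) = - e c"
      "\<And>c. c \<in> C \<Longrightarrow> \<bar>X (c + r)\<bar> \<ge> \<bar>W (c + r)\<bar> \<and> \<bar>X (c - r)\<bar> \<ge> \<bar>W (c - r)\<bar>"
    and away: "\<And>a. a \<in> {t..t + 1} \<Longrightarrow> (\<And>c. c \<in> C \<Longrightarrow> a \<notin> {c - r..c + r}) \<Longrightarrow> \<bar>X a\<bar> \<ge> \<bar>W a\<bar>"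
  shows "integral {t..t + 1} (\<lambda>a. prim (X a) (Y a) (W a) * (Xa a * W a - X a * Wa a)) = (\<Sum>c\<in>C. e c * y c * w c / 2)"
proof -
  define m where "m a = prim (X a) (Y a) (W a) * (Xa a * W a - X a * Wa a)" for a
  have I: "((\<lambda>a. if a \<in> {c - r..c + r} then m a else 0) has_integral e c * y c * w c / 2) {t..t + 1}" if c: "c \<in> C" for c
  proof -
    have wc: "w c * w c = 1"
    proof -
      have "w c = sgn (W c)" "W c \<noteq> 0" using near[OF c, of c] nz[OF c] \<open>r > 0\<close> by auto
      then show ?thesis by (simp add: sgn_real_def)
    qed
    have Wn: "W a \<noteq> 0" if "a \<in> {c - r..c + r}" for a
      using near[OF c that] nz[OF c] by auto
    have st: "step (X a / W a) = sgn (X a) * w c / 2" if "a = c - r \<or> a = c + r" for a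
    proof -
      have a: "a \<in> {c - r..c + r}" using that \<open>r > 0\<close> by auto
      have "1 \<le> \<bar>X a / W a\<bar>" using ends(2)[OF c] that Wn[OF a] by (auto simp: field_simps)
      moreover have "sgn (X a / W a) = sgn (X a) * w c"
        using near[OF c a] wc nz[OF c] by (simp add: sgn_divide field_simps)
      ultimately show ?thesis
        by (simp add: step_eq_sgn)
    qed
    have "(m has_integral y c / 2 * step (X (c + r) / W (c + r)) - y c / 2 * step (X (c - r) / W (c - r))) {c - r..c + r}"
    proof (rule fundamental_theorem_of_calculus)
      fix a assume a: "a \<in> {c - r..c + r}"
      have "1 \<le> \<bar>Y a / W a\<bar>" using near[OF c a] Wn[OF a] by (auto simp: field_simps)
      then have *: "sgn (W a) * step (Y a / W a) = y c / 2"
        using near[OF c a] wc nz[OF c] by (simp add: step_eq_sgn sgn_divide)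
      \<comment> \<open>The last fraction is the quotient rule for \<open>X / W\<close>.\<close>
      have m: "m a = y c / 2 * (bump (X a / W a) * ((Xa a * W a - X a * Wa a) / (W a * W a)))"
        unfolding *[symmetric] by (simp add: m_def prim_def power2_eq_square)
      have "((\<lambda>a. y c / 2 * step (X a / W a)) has_real_derivative m a) (at a)"
        unfolding m by (rule derivative_eq_intros DERIV_chain2[OF DERIV_step] X W Wn a refl)+ (simp add: mult_ac)
      then show "((\<lambda>a. y c / 2 * step (X a / W a)) has_vector_derivative m a) (at a within {c - r..c + r})"
        unfolding has_real_derivative_iff_has_vector_derivative[symmetric] by (rule has_field_derivative_at_within)
    qed (use \<open>r > 0\<close> in simp)
    also have "y c / 2 * step (X (c + r) / W (c + r)) - y c / 2 * step (X (c - r) / W (c - r)) = e c * y c * w c / 2"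
      using ends(1)[OF c] st[of "c + r"] st[of "c - r"] by (simp add: field_simps)
    finally show ?thesis
      using C(2)[OF c] by (subst has_integral_restrict) auto
  qed
  have "m a = (\<Sum>c\<in>C. if a \<in> {c - r..c + r} then m a else 0)" if "a \<in> {t..t + 1}" for a
  proof (cases "\<exists>c\<in>C. a \<in> {c - r..c + r}")
    case True
    then obtain c where c: "c \<in> C" "a \<in> {c - r..c + r}" by blast
    have "a \<notin> {c' - r..c' + r}" if "c' \<in> C - {c}" for c'
      using sep[of c c'] that c by auto
    then have "(\<Sum>c\<in>C. if a \<in> {c - r..c + r} then m a else 0) = (\<Sum>c'\<in>{c}. m a)"
      using c C(1) by (intro sum.mono_neutral_cong_right) auto
    then show ?thesis by simp
  next
    case False
    then have "m a = 0"
      using away[OF that] by (auto simp: m_def prim_eq_0)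
    then have "(\<Sum>c\<in>C. if a \<in> {c - r..c + r} then m a else 0) = 0"
      by (intro sum.neutral) auto
    with \<open>m a = 0\<close> show ?thesis by (simp only:)
  qed
  moreover have "((\<lambda>a. \<Sum>c\<in>C. if a \<in> {c - r..c + r} then m a else 0) has_integral (\<Sum>c\<in>C. e c * y c * w c / 2)) {t..t + 1}"
    using C(1) I by (rule has_integral_sum)
  ultimately have "(m has_integral (\<Sum>c\<in>C. e c * y c * w c / 2)) {t..t + 1}"
    by (subst has_integral_cong) auto
  then show ?thesis
    unfolding m_def[abs_def] by (rule integral_unique)
qed

section \<open>Smooth families of curves\<close>

lemma DERIV_transform_set:
  assumes "(f has_real_derivative D) (at x within S)" "x \<in> S" "\<And>y. y \<in> S \<Longrightarrow> g y = f y"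
  shows "(g has_real_derivative D) (at x within S)"
  using has_derivative_transform[OF assms(2,3)] assms(1) by (simp add: has_field_derivative_def)

text \<open>Hiding the derivatives turns closure under differences and products into introduction
  rules.\<close>

definition C2_fam :: "(real \<Rightarrow> real \<Rightarrow> real \<Rightarrow> real) \<Rightarrow> bool" where
  "C2_fam f \<longleftrightarrow> (\<exists>fs fa fd fsa fsd fad. C2_family f fs fa fd fsa fsd fad)"

text \<open>The start t is left free so that the period can be cut at a point away from all
  cusps.\<close>

definition edge_integral :: "(real \<Rightarrow> real) \<Rightarrow> (real \<Rightarrow> real) \<Rightarrow> (real \<Rightarrow> real) \<Rightarrow> real \<Rightarrow> real" where
  "edge_integral X Y W t = integral {t..t + 1} (\<lambda>a. prim (X a) (Y a) (W a) * (deriv X a * W a - X a * deriv W a))"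

lemma edge_integral_invariant:
  assumes fam: "C2_fam X" "C2_fam Y" "C2_fam W" and "d0 \<le> d1"
    and "\<And>s a d. s \<in> {0..1} \<Longrightarrow> d \<in> {d0..d1} \<Longrightarrow> X s a d \<noteq> 0 \<or> Y s a d \<noteq> 0 \<or> W s a d \<noteq> 0"
    and "\<And>s a d. s \<in> {0..1} \<Longrightarrow> d = d0 \<or> d = d1 \<Longrightarrow> \<bar>X s a d\<bar> \<ge> \<bar>W s a d\<bar> \<or> \<bar>Y s a d\<bar> \<ge> \<bar>W s a d\<bar>"
    and nz: "\<And>a d. d \<in> {d0..d1} \<Longrightarrow> X 0 a d \<noteq> 0 \<or> W 0 a d \<noteq> 0"
      "\<And>a d. d \<in> {d0..d1} \<Longrightarrow> X 1 a d \<noteq> 0 \<or> W 1 a d \<noteq> 0"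
  shows "edge_integral (\<lambda>a. X 0 a d1) (\<lambda>a. Y 0 a d1) (\<lambda>a. W 0 a d1) 0
      - edge_integral (\<lambda>a. X 0 a d0) (\<lambda>a. Y 0 a d0) (\<lambda>a. W 0 a d0) 0
    = edge_integral (\<lambda>a. X 1 a d1) (\<lambda>a. Y 1 a d1) (\<lambda>a. W 1 a d1) 0
      - edge_integral (\<lambda>a. X 1 a d0) (\<lambda>a. Y 1 a d0) (\<lambda>a. W 1 a d0) 0"
proof -
  obtain Xs Xa Xd Xsa Xsd Xad where X: "C2_family X Xs Xa Xd Xsa Xsd Xad" using fam(1) C2_fam_def by blast
  obtain Ys Ya Yd Ysa Ysd Yad where Y: "C2_family Y Ys Ya Yd Ysa Ysd Yad" using fam(2) C2_fam_def by blast
  obtain Ws Wa Wd Wsa Wsd Wad where W: "C2_family W Ws Wa Wd Wsa Wsd Wad" using fam(3) C2_fam_def by blast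
  interpret loop_family X Xs Xa Xd Xsa Xsd Xad Y Ys Ya Yd Ysa Ysd Yad W Ws Wa Wd Wsa Wsd Wad d0 d1
    using X Y W assms by (simp add: loop_family_def loop_family_axioms_def)
  have e: "edge_integral (\<lambda>a. X s a d) (\<lambda>a. Y s a d) (\<lambda>a. W s a d) 0 = edge s d" if "s \<in> {0..1}" for s d
    using DERIV_imp_deriv[OF X.DERIV_a[OF that]] DERIV_imp_deriv[OF W.DERIV_a[OF that]]
    by (simp add: edge_integral_def edge_def)
  show ?thesis
    using total_const total_eq_edge[of 0] total_eq_edge[of 1] nz by (simp add: e)
qed

lemma edge_integral_shift:
  assumes fam: "C2_fam X" "C2_fam Y" "C2_fam W" and s: "s \<in> {0..1}"
    and nz: "\<And>a. X s a d \<noteq> 0 \<or> W s a d \<noteq> 0"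
  shows "edge_integral (\<lambda>a. X s a d) (\<lambda>a. Y s a d) (\<lambda>a. W s a d) t
    = edge_integral (\<lambda>a. X s a d) (\<lambda>a. Y s a d) (\<lambda>a. W s a d) 0"
proof -
  obtain Xs Xa Xd Xsa Xsd Xad where X: "C2_family X Xs Xa Xd Xsa Xsd Xad" using fam(1) C2_fam_def by blast
  obtain Ys Ya Yd Ysa Ysd Yad where Y: "C2_family Y Ys Ya Yd Ysa Ysd Yad" using fam(2) C2_fam_def by blast
  obtain Ws Wa Wd Wsa Wsd Wad where W: "C2_family W Ws Wa Wd Wsa Wsd Wad" using fam(3) C2_fam_def by blast
  interpret X: C2_family X Xs Xa Xd Xsa Xsd Xad by fact
  interpret Y: C2_family Y Ys Ya Yd Ysa Ysd Yad by fact
  interpret W: C2_family W Ws Wa Wd Wsa Wsd Wad by fact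
  have dX: "deriv (\<lambda>a. X s a d) = (\<lambda>a. Xa s a d)" and dW: "deriv (\<lambda>a. W s a d) = (\<lambda>a. Wa s a d)"
    using DERIV_imp_deriv[OF X.DERIV_a[OF s]] DERIV_imp_deriv[OF W.DERIV_a[OF s]] by auto
  have pX: "Xa s (a + 1) d = Xa s a d" for a
    by (rule DERIV_unique[OF _ X.DERIV_a[OF s, where a = a and d = d]])
      (use X.DERIV_a[OF s, where a = "a + 1" and d = d] in \<open>simp add: DERIV_shift X.periodic(1)[OF s]\<close>)
  have pW: "Wa s (a + 1) d = Wa s a d" for a
    by (rule DERIV_unique[OF _ W.DERIV_a[OF s, where a = a and d = d]])
      (use W.DERIV_a[OF s, where a = "a + 1" and d = d] in \<open>simp add: DERIV_shift W.periodic(1)[OF s]\<close>)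
  have "continuous_on UNIV (\<lambda>a. prim (X s a d) (Y s a d) (W s a d) * (Xa s a d * W s a d - X s a d * Wa s a d))"
    by (intro continuous_intros continuous_on_prim X.cont[THEN cont3_compose] Y.cont[THEN cont3_compose]
        W.cont[THEN cont3_compose] s nz)
  then show ?thesis
    unfolding edge_integral_def dX dW
    using integral_periodic_shift[of "\<lambda>a. prim (X s a d) (Y s a d) (W s a d) * (Xa s a d * W s a d - X s a d * Wa s a d)" t]
    by (simp add: X.periodic[OF s] Y.periodic[OF s] W.periodic[OF s] pX pW)
qed

section \<open>Closure properties of twice differentiable families\<close>

lemma cont3_intros:
  "cont3 (\<lambda>s a d. k)"
  "cont3 (\<lambda>s a d. k1 * d + k2)"
  "cont3 f \<Longrightarrow> cont3 g \<Longrightarrow> cont3 (\<lambda>s a d. f s a d - g s a d)"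
  "cont3 f \<Longrightarrow> cont3 g \<Longrightarrow> cont3 (\<lambda>s a d. f s a d + g s a d)"
  "cont3 f \<Longrightarrow> cont3 g \<Longrightarrow> cont3 (\<lambda>s a d. f s a d * g s a d)"
  unfolding cont3_def case_prod_beta' by (intro continuous_intros; assumption)+

lemma C2_fam_const: "C2_fam (\<lambda>s a d. k)"
  unfolding C2_fam_def
  by (rule exI[of _ "\<lambda>s a d. 0"])+ (unfold_locales, auto intro: cont3_intros)

lemma C2_fam_affine: "C2_fam (\<lambda>s a d. k1 * d + k2)"
proof -
  have "C2_family (\<lambda>s a d. k1 * d + k2) (\<lambda>s a d. 0) (\<lambda>s a d. 0) (\<lambda>s a d. k1)
     (\<lambda>s a d. 0) (\<lambda>s a d. 0) (\<lambda>s a d. 0)"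
    by unfold_locales (auto intro!: cont3_intros derivative_eq_intros)
  then show ?thesis unfolding C2_fam_def by blast
qed

lemma C2_fam_diff:
  assumes "C2_fam f" "C2_fam g" shows "C2_fam (\<lambda>s a d. f s a d - g s a d)"
proof -
  obtain fs fa fd fsa fsd fad where "C2_family f fs fa fd fsa fsd fad" using assms(1) C2_fam_def by blast
  then interpret f: C2_family f fs fa fd fsa fsd fad .
  obtain gs ga gd gsa gsd gad where "C2_family g gs ga gd gsa gsd gad" using assms(2) C2_fam_def by blast
  then interpret g: C2_family g gs ga gd gsa gsd gad .
  have "C2_family (\<lambda>s a d. f s a d - g s a d) (\<lambda>s a d. fs s a d - gs s a d) (\<lambda>s a d. fa s a d - ga s a d)
    (\<lambda>s a d. fd s a d - gd s a d) (\<lambda>s a d. fsa s a d - gsa s a d) (\<lambda>s a d. fsd s a d - gsd s a d)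
    (\<lambda>s a d. fad s a d - gad s a d)"
    by unfold_locales
      (intro DERIV_diff cont3_intros f.DERIV_s f.DERIV_a f.DERIV_d f.DERIV_sa f.DERIV_as f.DERIV_sd f.DERIV_ds
        f.DERIV_ad f.DERIV_da f.cont g.DERIV_s g.DERIV_a g.DERIV_d g.DERIV_sa g.DERIV_as g.DERIV_sd g.DERIV_ds
        g.DERIV_ad g.DERIV_da g.cont; assumption | simp add: f.periodic g.periodic)+
  then show ?thesis unfolding C2_fam_def by blast
qed

lemma C2_fam_mult:
  assumes "C2_fam f" "C2_fam g" shows "C2_fam (\<lambda>s a d. f s a d * g s a d)"
proof -
  obtain fs fa fd fsa fsd fad where "C2_family f fs fa fd fsa fsd fad" using assms(1) C2_fam_def by blast
  then interpret f: C2_family f fs fa fd fsa fsd fad .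
  obtain gs ga gd gsa gsd gad where "C2_family g gs ga gd gsa gsd gad" using assms(2) C2_fam_def by blast
  then interpret g: C2_family g gs ga gd gsa gsd gad .
  note D = f.DERIV_s f.DERIV_a f.DERIV_d f.DERIV_sa f.DERIV_as f.DERIV_sd f.DERIV_ds
        f.DERIV_ad f.DERIV_da g.DERIV_s g.DERIV_a g.DERIV_d g.DERIV_sa g.DERIV_as g.DERIV_sd g.DERIV_ds
        g.DERIV_ad g.DERIV_da
  have "C2_family (\<lambda>s a d. f s a d * g s a d)
    (\<lambda>s a d. fs s a d * g s a d + f s a d * gs s a d)
    (\<lambda>s a d. fa s a d * g s a d + f s a d * ga s a d)
    (\<lambda>s a d. fd s a d * g s a d + f s a d * gd s a d)
    (\<lambda>s a d. fsa s a d * g s a d + fs s a d * ga s a d + (fa s a d * gs s a d + f s a d * gsa s a d))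
    (\<lambda>s a d. fsd s a d * g s a d + fs s a d * gd s a d + (fd s a d * gs s a d + f s a d * gsd s a d))
    (\<lambda>s a d. fad s a d * g s a d + fa s a d * gd s a d + (fd s a d * ga s a d + f s a d * gad s a d))"
    apply unfold_locales
    subgoal by (rule derivative_eq_intros D refl | assumption)+ simp
    subgoal by (rule derivative_eq_intros D refl | assumption)+ simp
    subgoal by (rule derivative_eq_intros D refl | assumption)+ simp
    subgoal by (rule derivative_eq_intros D refl | assumption)+ simp
    subgoal by (rule derivative_eq_intros D refl | assumption)+ simp
    subgoal by (rule derivative_eq_intros D refl | assumption)+ simp
    subgoal by (rule derivative_eq_intros D refl | assumption)+ simp
    subgoal by (rule derivative_eq_intros D refl | assumption)+ simp
    subgoal by (rule derivative_eq_intros D refl | assumption)+ simp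
    by (intro cont3_intros f.cont g.cont | simp add: f.periodic g.periodic)+
  then show ?thesis unfolding C2_fam_def by blast
qed

section \<open>One-parameter families of closed curves\<close>

definition cont2 :: "(real \<Rightarrow> real \<Rightarrow> real) \<Rightarrow> bool" where
  "cont2 f \<longleftrightarrow> continuous_on ({0..1} \<times> UNIV) (\<lambda>(s, t). f s t)"

lemma cont2_compose:
  assumes "cont2 f" "continuous_on A S" "continuous_on A t" "\<And>p. p \<in> A \<Longrightarrow> S p \<in> {0..1}"
  shows "continuous_on A (\<lambda>p. f (S p) (t p))"
  using continuous_on_compose2[of _ "\<lambda>(s, t). f s t" A "\<lambda>p. (S p, t p)"] assms
  by (force simp: cont2_def intro: continuous_intros)

locale C2_curves =
  fixes f fs ft fts ftt :: "real \<Rightarrow> real \<Rightarrow> real"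
  assumes DERIV_s: "s \<in> {0..1} \<Longrightarrow> ((\<lambda>s. f s t) has_real_derivative fs s t) (at s within {0..1})"
    and DERIV_t: "s \<in> {0..1} \<Longrightarrow> ((\<lambda>t. f s t) has_real_derivative ft s t) (at t)"
    and DERIV_ts: "s \<in> {0..1} \<Longrightarrow> ((\<lambda>s. ft s t) has_real_derivative fts s t) (at s within {0..1})"
    and DERIV_tt: "s \<in> {0..1} \<Longrightarrow> ((\<lambda>t. ft s t) has_real_derivative ftt s t) (at t)"
    and cont: "cont2 f" "cont2 fs" "cont2 ft" "cont2 fts" "cont2 ftt"
    and periodic: "s \<in> {0..1} \<Longrightarrow> f s (t + 1) = f s t"
begin

text \<open>Symmetry of the mixed derivative: the increment of \<open>f s\<close> from c to u is the
  integral of \<open>ft s\<close>. Differentiating it under the integral in s gives the increment of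
  \<open>fs s\<close> as the integral of \<open>fts s\<close>, which is then differentiated in
  u.\<close>

lemma DERIV_st:
  assumes s: "s \<in> {0..1}"
  shows "((\<lambda>t. fs s t) has_real_derivative fts s t) (at t)"
proof -
  \<comment> \<open>Any base point to the left of t would do; t must be interior for a two-sided
    derivative.\<close>
  define c where "c = t - 1"
  have int: "(ft r has_integral f r u - f r c) {c..u}" if "r \<in> {0..1}" "c \<le> u" for r u
    using DERIV_t[OF that(1), THEN has_field_derivative_at_within] that(2)
    by (intro fundamental_theorem_of_calculus) (simp_all flip: has_real_derivative_iff_has_vector_derivative)
  have eq: "fs s u - fs s c = integral {c..u} (fts s)" if u: "c \<le> u" for u
  proof -
    have "((\<lambda>r. integral (cbox c u) (ft r)) has_real_derivative integral (cbox c u) (fts s)) (at s within {0..1})"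
    proof (rule leibniz_rule_field_derivative[OF DERIV_ts])
      show "continuous_on ({0..1} \<times> cbox c u) (\<lambda>(r, t). fts r t)"
        using cont(4) unfolding cont2_def by (rule continuous_on_subset) auto
    qed (use int u s in auto)
    then have "((\<lambda>r. f r u - f r c) has_real_derivative integral {c..u} (fts s)) (at s within {0..1})"
      unfolding cbox_interval
      by (rule DERIV_transform_set[OF _ s]) (use integral_unique[OF int[OF _ u]] in simp)
    moreover have "((\<lambda>r. f r u - f r c) has_real_derivative fs s u - fs s c) (at s within {0..1})"
      by (intro DERIV_diff DERIV_s s)
    ultimately show ?thesis
      using s vector_derivative_unique_within_closed_interval[of 0 1 s "\<lambda>r. f r u - f r c"]
      by (simp add: has_real_derivative_iff_has_vector_derivative)
  qed
  have "continuous_on {c..t + 1} (fts s)"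
    using cont2_compose[OF cont(4), of _ "\<lambda>_. s" "\<lambda>t. t"] s by (simp add: continuous_on_id)
  then have "((\<lambda>u. integral {c..u} (fts s)) has_real_derivative fts s t) (at t within {c..t + 1})"
    by (rule integral_has_real_derivative) (simp add: c_def)
  moreover have "at t within {c..t + 1} = at t"
    by (intro at_within_interior) (simp add: c_def)
  ultimately have "((\<lambda>u. fs s c + integral {c..u} (fts s)) has_real_derivative fts s t) (at t)"
    by (auto intro!: derivative_eq_intros)
  moreover have "eventually (\<lambda>u. u \<in> {c<..}) (nhds t)"
    by (intro eventually_nhds_in_open) (auto simp: c_def)
  then have "eventually (\<lambda>u. fs s u = fs s c + integral {c..u} (fts s)) (nhds t)"
    by (rule eventually_mono) (simp flip: eq)
  ultimately show ?thesis
    by (subst DERIV_cong_ev[OF refl _ refl])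
qed

lemma periodic_s:
  assumes s: "s \<in> {0..1}" shows "fs s (t + 1) = fs s t"
proof -
  have "((\<lambda>s. f s t) has_real_derivative fs s (t + 1)) (at s within {0..1})"
    by (rule DERIV_transform_set[OF DERIV_s[OF s, of "t + 1"] s]) (simp add: periodic)
  then show ?thesis
    using s DERIV_s[OF s, of t] vector_derivative_unique_within_closed_interval[of 0 1 s "\<lambda>r. f r t"]
    by (simp add: has_real_derivative_iff_has_vector_derivative)
qed

lemma periodic_t:
  assumes s: "s \<in> {0..1}" shows "ft s (t + 1) = ft s t"
  using DERIV_unique[OF DERIV_t[OF s, of t]] DERIV_t[OF s, of "t + 1"] periodic[OF s]
  by (simp add: DERIV_shift)

lemma C2_fam_start: "C2_fam (\<lambda>s a d. f s a)"
proof -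
  have c: "cont3 (\<lambda>s a d. g s a)" if "cont2 g" for g
    unfolding cont3_def case_prod_beta' by (intro cont2_compose[OF that] continuous_intros) auto
  have "C2_family (\<lambda>s a d. f s a) (\<lambda>s a d. fs s a) (\<lambda>s a d. ft s a) (\<lambda>s a d. 0) (\<lambda>s a d. fts s a) (\<lambda>s a d. 0) (\<lambda>s a d. 0)"
    by unfold_locales (simp_all add: DERIV_s DERIV_t DERIV_ts DERIV_tt DERIV_st cont c cont3_intros periodic periodic_s)
  then show ?thesis unfolding C2_fam_def by blast
qed

lemma C2_fam_end: "C2_fam (\<lambda>s a d. f s (a + d))"
proof -
  have c: "cont3 (\<lambda>s a d. g s (a + d))" if "cont2 g" for g
    unfolding cont3_def case_prod_beta' by (intro cont2_compose[OF that] continuous_intros) auto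
  have D: "((\<lambda>a. g (a + d)) has_real_derivative g' (a + d)) (at a)"
      "((\<lambda>d. g (a + d)) has_real_derivative g' (a + d)) (at d)"
    if "\<And>t. (g has_real_derivative g' t) (at t)" for g g' :: "real \<Rightarrow> real" and a d
    using DERIV_shift_compose[OF that, of d a] DERIV_shift_compose[OF that, of a d] by (simp_all add: add.commute)
  have p: "f s (a + 1 + d) = f s (a + d)" "fs s (a + 1 + d) = fs s (a + d)" "ft s (a + 1 + d) = ft s (a + d)"
    if "s \<in> {0..1}" for s a d
    using periodic[OF that, of "a + d"] periodic_s[OF that, of "a + d"] periodic_t[OF that, of "a + d"]
    by (simp_all add: algebra_simps)
  have "C2_family (\<lambda>s a d. f s (a + d)) (\<lambda>s a d. fs s (a + d)) (\<lambda>s a d. ft s (a + d)) (\<lambda>s a d. ft s (a + d))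
     (\<lambda>s a d. fts s (a + d)) (\<lambda>s a d. fts s (a + d)) (\<lambda>s a d. ftt s (a + d))"
    by unfold_locales (simp_all add: DERIV_s DERIV_ts D[OF DERIV_t] D[OF DERIV_tt] D[OF DERIV_st] cont c p)
  then show ?thesis unfolding C2_fam_def by blast
qed

end

definition C2_curve :: "(real \<Rightarrow> real \<Rightarrow> real) \<Rightarrow> bool" where
  "C2_curve f \<longleftrightarrow> (\<exists>fs ft fts ftt. C2_curves f fs ft fts ftt)"

lemma C2_curve_start: "C2_curve f \<Longrightarrow> C2_fam (\<lambda>s a d. f s a)"
  and C2_curve_end: "C2_curve f \<Longrightarrow> C2_fam (\<lambda>s a d. f s (a + d))"
  unfolding C2_curve_def using C2_curves.C2_fam_start C2_curves.C2_fam_end by blast+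

lemma Ck_on_derivs:
  assumes "\<And>k. Ck_on k S f"
  shows "continuous_on S f" "\<And>p. p \<in> S \<Longrightarrow> (f has_derivative frechet_derivative f (at p)) (at p)"
    "\<And>k v. Ck_on k S (\<lambda>p. frechet_derivative f (at p) v)"
  using assms[of 0] assms[of "Suc _"] by (auto simp: frechet_derivative_works[symmetric])

text \<open>The three claims about the t-derivative are what is needed to identify it with the
  velocity and then to apply the first claim to the velocity in turn.\<close>

lemma C2_curve_smooth:
  fixes G :: "real \<times> real \<Rightarrow> real ^ 3"
  assumes S: "{0..1} \<times> UNIV \<subseteq> S" and sm: "\<And>k. Ck_on k S G"
    and per: "\<And>s t. s \<in> {0..1} \<Longrightarrow> G (s, t + 1) $ i = G (s, t) $ i"
  shows "C2_curve (\<lambda>s t. G (s, t) $ i)"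
    and "s \<in> {0..1} \<Longrightarrow> ((\<lambda>t. G (s, t) $ i) has_real_derivative frechet_derivative G (at (s, t)) (0, 1) $ i) (at t)"
    and "s \<in> {0..1} \<Longrightarrow> frechet_derivative G (at (s, t + 1)) (0, 1) $ i = frechet_derivative G (at (s, t)) (0, 1) $ i"
    and "\<And>k. Ck_on k S (\<lambda>p. frechet_derivative G (at p) (0, 1))"
proof -
  have partial_s: "((\<lambda>s. H (s, t) $ i) has_real_derivative frechet_derivative H (at (s, t)) (1, 0) $ i) (at s within {0..1})"
    and partial_t: "((\<lambda>t. H (s, t) $ i) has_real_derivative frechet_derivative H (at (s, t)) (0, 1) $ i) (at t)"
    if "\<And>k. Ck_on k S H" "s \<in> {0..1}" for H :: "real \<times> real \<Rightarrow> real ^ 3" and s t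
  proof -
    have D: "(H has_derivative frechet_derivative H (at (s, t))) (at (s, t))"
      by (rule Ck_on_derivs(2)[OF that(1)]) (use S that in auto)
    have lin: "linear (frechet_derivative H (at (s, t)))"
      using D has_derivative_bounded_linear bounded_linear.linear by blast
    have "((\<lambda>s. (s, t)) has_derivative (\<lambda>h. (h, 0))) (at s within {0..1})"
      by (auto intro!: derivative_eq_intros)
    from has_derivative_compose[OF this D]
    have "((\<lambda>s. H (s, t) $ i) has_derivative (\<lambda>h. frechet_derivative H (at (s, t)) (h, 0) $ i)) (at s within {0..1})"
      by (rule bounded_linear.has_derivative[OF bounded_linear_vec_nth])
    moreover have "(\<lambda>h. frechet_derivative H (at (s, t)) (h, 0) $ i) = (*) (frechet_derivative H (at (s, t)) (1, 0) $ i)"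
    proof
      fix h show "frechet_derivative H (at (s, t)) (h, 0) $ i = frechet_derivative H (at (s, t)) (1, 0) $ i * h"
        using linear_cmul[OF lin, of h "(1, 0)"] by simp
    qed
    ultimately show "((\<lambda>s. H (s, t) $ i) has_real_derivative frechet_derivative H (at (s, t)) (1, 0) $ i) (at s within {0..1})"
      by (simp only: has_field_derivative_def)
    have "((\<lambda>t. (s, t)) has_derivative (\<lambda>h. (0, h))) (at t)"
      by (auto intro!: derivative_eq_intros)
    from has_derivative_compose[OF this D]
    have "((\<lambda>t. H (s, t) $ i) has_derivative (\<lambda>h. frechet_derivative H (at (s, t)) (0, h) $ i)) (at t)"
      by (rule bounded_linear.has_derivative[OF bounded_linear_vec_nth])
    moreover have "(\<lambda>h. frechet_derivative H (at (s, t)) (0, h) $ i) = (*) (frechet_derivative H (at (s, t)) (0, 1) $ i)"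
    proof
      fix h show "frechet_derivative H (at (s, t)) (0, h) $ i = frechet_derivative H (at (s, t)) (0, 1) $ i * h"
        using linear_cmul[OF lin, of h "(0, 1)"] by simp
    qed
    ultimately show "((\<lambda>t. H (s, t) $ i) has_real_derivative frechet_derivative H (at (s, t)) (0, 1) $ i) (at t)"
      by (simp only: has_field_derivative_def)
  qed
  have c: "cont2 (\<lambda>s t. H (s, t) $ i)" if "\<And>k. Ck_on k S H" for H :: "real \<times> real \<Rightarrow> real ^ 3"
    using continuous_on_subset[OF Ck_on_derivs(1)[OF that] S]
    unfolding cont2_def by (auto simp: case_prod_beta' intro!: continuous_intros)
  note sm1 = Ck_on_derivs(3)[OF sm]
  note sm2 = Ck_on_derivs(3)[OF sm1]
  have "C2_curves (\<lambda>s t. G (s, t) $ i) (\<lambda>s t. frechet_derivative G (at (s, t)) (1, 0) $ i)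
     (\<lambda>s t. frechet_derivative G (at (s, t)) (0, 1) $ i)
     (\<lambda>s t. frechet_derivative (\<lambda>p. frechet_derivative G (at p) (0, 1)) (at (s, t)) (1, 0) $ i)
     (\<lambda>s t. frechet_derivative (\<lambda>p. frechet_derivative G (at p) (0, 1)) (at (s, t)) (0, 1) $ i)"
    by unfold_locales (simp_all add: partial_s[OF sm] partial_t[OF sm] partial_s[OF sm1] partial_t[OF sm1]
        c[OF sm] c[OF sm1] c[OF sm2] per)
  then interpret C2_curves "\<lambda>s t. G (s, t) $ i" "\<lambda>s t. frechet_derivative G (at (s, t)) (1, 0) $ i"
     "\<lambda>s t. frechet_derivative G (at (s, t)) (0, 1) $ i"
     "\<lambda>s t. frechet_derivative (\<lambda>p. frechet_derivative G (at p) (0, 1)) (at (s, t)) (1, 0) $ i"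
     "\<lambda>s t. frechet_derivative (\<lambda>p. frechet_derivative G (at p) (0, 1)) (at (s, t)) (0, 1) $ i" .
  show "C2_curve (\<lambda>s t. G (s, t) $ i)"
    unfolding C2_curve_def using C2_curves_axioms by blast
  show "s \<in> {0..1} \<Longrightarrow> ((\<lambda>t. G (s, t) $ i) has_real_derivative frechet_derivative G (at (s, t)) (0, 1) $ i) (at t)"
    by (rule DERIV_t)
  show "s \<in> {0..1} \<Longrightarrow> frechet_derivative G (at (s, t + 1)) (0, 1) $ i = frechet_derivative G (at (s, t)) (0, 1) $ i"
    by (rule periodic_t)
  show "Ck_on k S (\<lambda>p. frechet_derivative G (at p) (0, 1))" for k
    by (rule sm1)
qed

section \<open>Legendrian curves near a cusp\<close>

lemma edge_integral_eq_sum: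
  fixes X Y W Xa Wa e y w :: "real \<Rightarrow> real"
  assumes X: "\<And>a. (X has_real_derivative Xa a) (at a)" and W: "\<And>a. (W has_real_derivative Wa a) (at a)"
    and C: "finite C" "\<And>c. c \<in> C \<Longrightarrow> t \<le> c - r \<and> c + r \<le> t + 1" and "r > 0"
    and sep: "\<And>c c'. c \<in> C \<Longrightarrow> c' \<in> C \<Longrightarrow> c \<noteq> c' \<Longrightarrow> \<bar>c - c'\<bar> > 2 * r"
    and near: "\<And>c a. c \<in> C \<Longrightarrow> a \<in> {c - r..c + r} \<Longrightarrow> sgn (W a) = w c \<and> sgn (Y a) = y c \<and> \<bar>Y a\<bar> \<ge> \<bar>W a\<bar>"
    and nz: "\<And>c. c \<in> C \<Longrightarrow> w c \<noteq> 0"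
    and ends: "\<And>c. c \<in> C \<Longrightarrow> sgn (X (c + r)) = e c \<and> sgn (X (c - r)) = - e c"
      "\<And>c. c \<in> C \<Longrightarrow> \<bar>X (c + r)\<bar> \<ge> \<bar>W (c + r)\<bar> \<and> \<bar>X (c - r)\<bar> \<ge> \<bar>W (c - r)\<bar>"
    and away: "\<And>a. a \<in> {t..t + 1} \<Longrightarrow> (\<And>c. c \<in> C \<Longrightarrow> a \<notin> {c - r..c + r}) \<Longrightarrow> \<bar>X a\<bar> \<ge> \<bar>W a\<bar>"
  shows "edge_integral X Y W t = (\<Sum>c\<in>C. e c * y c * w c / 2)"
proof -
  have "deriv X = Xa" "deriv W = Wa"
    using X W by (auto intro!: DERIV_imp_deriv)
  then show ?thesis
    using integral_prim_eq_sum[OF assms] by (simp add: edge_integral_def)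
qed

locale legendrian_curve =
  fixes x y z x' y' x'' y'' :: "real \<Rightarrow> real"
  assumes DERIV_x: "(x has_real_derivative x' t) (at t)"
    and DERIV_y: "(y has_real_derivative y' t) (at t)"
    and DERIV_z: "(z has_real_derivative y t * x' t) (at t)"
    and DERIV_x': "(x' has_real_derivative x'' t) (at t)"
    and DERIV_y': "(y' has_real_derivative y'' t) (at t)"
    and cont_x'': "continuous_on UNIV x''" and cont_y'': "continuous_on UNIV y''"
    and periodic: "x (t + 1) = x t" "y (t + 1) = y t" "z (t + 1) = z t" "x' (t + 1) = x' t" "y' (t + 1) = y' t"
begin

definition area :: "real \<Rightarrow> real \<Rightarrow> real" where
  "area a b = z b - z a - (y a + y b) / 2 * (x b - x a)"

lemma area_diag [simp]: "area a a = 0"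
  by (simp add: area_def)

text \<open>Up to sign, half the determinant of chord and velocity: the rate at which the chord from
  a sweeps out area in the xy-plane.\<close>

lemma DERIV_area: "((\<lambda>b. area a b) has_real_derivative ((y b - y a) * x' b - (x b - x a) * y' b) / 2) (at b)"
  unfolding area_def
  by (rule DERIV_cong, rule DERIV_diff[OF DERIV_diff[OF DERIV_z DERIV_const]
      DERIV_mult[OF DERIV_cdivide[OF DERIV_add[OF DERIV_const DERIV_y]] DERIV_diff[OF DERIV_x DERIV_const]]])
    (simp add: field_simps)

lemma cont_x': "continuous_on A x'" and cont_y': "continuous_on A y'"
  using DERIV_x' DERIV_y' by (meson DERIV_continuous_on has_field_derivative_at_within)+

text \<open>\<open>d\<^sup>2\<close> because both factors of \<open>(y - (y a + y b) / 2) dx\<close> are small on a short arc.\<close>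

lemma area_bound:
  assumes "d \<ge> 0" and M: "\<And>t. \<bar>x' t\<bar> \<le> M" "\<And>t. \<bar>y' t\<bar> \<le> M"
  shows "\<bar>area a (a + d)\<bar> \<le> d\<^sup>2 * M\<^sup>2"
proof (cases "d = 0")
  case False
  then have d: "d > 0" using assms by simp
  have lip: "\<bar>x v - x u\<bar> \<le> M * \<bar>v - u\<bar>" "\<bar>y v - y u\<bar> \<le> M * \<bar>v - u\<bar>" for u v
    using field_differentiable_bound[of UNIV x x' M v u] field_differentiable_bound[of UNIV y y' M v u] M DERIV_x DERIV_y
    by auto
  obtain \<xi> where xi: "\<xi> > a" "\<xi> < a + d"
    and e: "area a (a + d) - area a a = (a + d - a) * (((y \<xi> - y a) * x' \<xi> - (x \<xi> - x a) * y' \<xi>) / 2)"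
    using MVT2[of a "a + d" "\<lambda>b. area a b" "\<lambda>b. ((y b - y a) * x' b - (x b - x a) * y' b) / 2"] DERIV_area d by auto
  have M0: "M \<ge> 0" using M(1)[of 0] by linarith
  have le: "\<bar>x \<xi> - x a\<bar> \<le> M * d" "\<bar>y \<xi> - y a\<bar> \<le> M * d"
    using lip[of \<xi> a] xi mult_left_mono[of "\<bar>\<xi> - a\<bar>" d M] M0 by auto
  have "\<bar>(y \<xi> - y a) * x' \<xi> - (x \<xi> - x a) * y' \<xi>\<bar> \<le> \<bar>(y \<xi> - y a) * x' \<xi>\<bar> + \<bar>(x \<xi> - x a) * y' \<xi>\<bar>"
    by (rule abs_triangle_ineq4)
  also have "\<dots> \<le> (M * d) * M + (M * d) * M"
    unfolding abs_mult by (intro add_mono mult_mono le M) (use M0 d in auto)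
  finally have "\<bar>((y \<xi> - y a) * x' \<xi> - (x \<xi> - x a) * y' \<xi>) / 2\<bar> \<le> d * M\<^sup>2"
    by (simp add: power2_eq_square mult_ac)
  then have "d * \<bar>((y \<xi> - y a) * x' \<xi> - (x \<xi> - x a) * y' \<xi>) / 2\<bar> \<le> d * (d * M\<^sup>2)"
    using d by (intro mult_left_mono) auto
  moreover have "\<bar>area a (a + d)\<bar> = d * \<bar>((y \<xi> - y a) * x' \<xi> - (x \<xi> - x a) * y' \<xi>) / 2\<bar>"
    using arg_cong[OF e, of abs] d by (simp only: area_diag abs_mult) simp
  ultimately show ?thesis
    by (simp add: power2_eq_square mult.assoc)
qed auto

text \<open>The last inequality fixes the sign of the numerator of the derivative of
  \<open>x' / y'\<close>, so near c the curve is a graph over the y-axis whose slope is strictly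
  monotone. The factor 2 yields a lower bound for increments of y that is uniform in the
  chord.\<close>

definition nice :: "real \<Rightarrow> real \<Rightarrow> bool" where
  "nice c r \<longleftrightarrow> (\<forall>u\<in>{c - r..c + r}. y' u * y' c > 0 \<and> \<bar>y' c\<bar> \<le> 2 * \<bar>y' u\<bar>
     \<and> (x'' u * y' u - x' u * y'' u) * (x'' c * y' c) > 0)"

lemma eventually_nice:
  assumes c: "x' c = 0" "y' c * x'' c \<noteq> 0"
  shows "eventually (nice c) (at_right 0)"
proof -
  have "((\<lambda>u. y' u) \<longlongrightarrow> y' c) (at c)" "((\<lambda>u. x' u) \<longlongrightarrow> x' c) (at c)" "((\<lambda>u. y'' u) \<longlongrightarrow> y'' c) (at c)" "((\<lambda>u. x'' u) \<longlongrightarrow> x'' c) (at c)"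
    using cont_x'[of UNIV] cont_y'[of UNIV] cont_x'' cont_y'' by (simp_all add: continuous_on_def)
  then have l: "((\<lambda>u. y' u * y' c) \<longlongrightarrow> y' c * y' c) (at c)" "((\<lambda>u. 2 * \<bar>y' u\<bar>) \<longlongrightarrow> 2 * \<bar>y' c\<bar>) (at c)"
    "((\<lambda>u. (x'' u * y' u - x' u * y'' u) * (x'' c * y' c)) \<longlongrightarrow> (x'' c * y' c - x' c * y'' c) * (x'' c * y' c)) (at c)"
    by (auto intro!: tendsto_intros)
  have pos: "0 < y' c * y' c" "\<bar>y' c\<bar> < 2 * \<bar>y' c\<bar>" "0 < (x'' c * y' c - x' c * y'' c) * (x'' c * y' c)"
    using c by (auto simp: zero_less_mult_iff not_less_iff_gr_or_eq)
  have "eventually (\<lambda>u. y' u * y' c > 0) (at c)" "eventually (\<lambda>u. 2 * \<bar>y' u\<bar> > \<bar>y' c\<bar>) (at c)"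
    "eventually (\<lambda>u. (x'' u * y' u - x' u * y'' u) * (x'' c * y' c) > 0) (at c)"
    using order_tendstoD(1)[OF l(1) pos(1)] order_tendstoD(1)[OF l(2) pos(2)] order_tendstoD(1)[OF l(3) pos(3)]
    by simp_all
  then have "eventually (\<lambda>u. y' u * y' c > 0 \<and> \<bar>y' c\<bar> \<le> 2 * \<bar>y' u\<bar>
     \<and> (x'' u * y' u - x' u * y'' u) * (x'' c * y' c) > 0) (at c)"
    by eventually_elim auto
  then obtain e where e: "e > 0" "\<And>u. u \<noteq> c \<Longrightarrow> dist u c < e \<Longrightarrow> y' u * y' c > 0 \<and> \<bar>y' c\<bar> \<le> 2 * \<bar>y' u\<bar>
     \<and> (x'' u * y' u - x' u * y'' u) * (x'' c * y' c) > 0"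
    unfolding eventually_at by auto
  \<comment> \<open>The filter at c says nothing about c itself; there \<open>x' c = 0\<close> turns
    the last product into a square.\<close>
  have "y' c * y' c > 0 \<and> \<bar>y' c\<bar> \<le> 2 * \<bar>y' c\<bar> \<and> (x'' c * y' c - x' c * y'' c) * (x'' c * y' c) > 0"
    using c by (auto simp: zero_less_mult_iff not_less_iff_gr_or_eq)
  then have "nice c r" if "0 < r" "r < e" for r
    unfolding nice_def using e(2) that by (metis (no_types, lifting) atLeastAtMost_iff dist_real_def abs_le_iff abs_diff_le_iff order.strict_trans1)
  then show ?thesis
    using e(1) by (auto simp: eventually_at_right_field)
qed

lemma nice_nonzero:
  assumes "nice c r" "u \<in> {c - r..c + r}" shows "y' u \<noteq> 0" "y' c \<noteq> 0"
proof -
  have "y' u * y' c > 0" using assms by (auto simp: nice_def)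
  then show "y' u \<noteq> 0" "y' c \<noteq> 0" by auto
qed

lemma sgn_eq_if_mult_pos: "(u::real) * v > 0 \<Longrightarrow> sgn u = sgn v"
  by (auto simp: zero_less_mult_iff)

lemma nice_ratio:
  assumes n: "nice c r" and u: "u \<in> {c - r..c + r}" "v \<in> {c - r..c + r}" "u < v"
  shows "sgn (x' v / y' v - x' u / y' u) = sgn (x'' c * y' c)"
proof -
  have D: "((\<lambda>t. x' t / y' t) has_real_derivative (x'' t * y' t - x' t * y'' t) / (y' t * y' t)) (at t)"
    if "t \<in> {c - r..c + r}" for t
    by (intro DERIV_divide DERIV_x' DERIV_y' nice_nonzero(1)[OF n that])
  obtain \<xi> where xi: "\<xi> > u" "\<xi> < v"
    "x' v / y' v - x' u / y' u = (v - u) * ((x'' \<xi> * y' \<xi> - x' \<xi> * y'' \<xi>) / (y' \<xi> * y' \<xi>))"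
    using MVT2[OF u(3), of "\<lambda>t. x' t / y' t" "\<lambda>t. (x'' t * y' t - x' t * y'' t) / (y' t * y' t)"] D u by auto
  have xi': "\<xi> \<in> {c - r..c + r}" using xi u by auto
  have "sgn (x'' \<xi> * y' \<xi> - x' \<xi> * y'' \<xi>) = sgn (x'' c * y' c)" "sgn (y' \<xi> * y' \<xi>) = 1"
  proof -
    show "sgn (x'' \<xi> * y' \<xi> - x' \<xi> * y'' \<xi>) = sgn (x'' c * y' c)"
      using n xi' by (intro sgn_eq_if_mult_pos) (simp add: nice_def)
    show "sgn (y' \<xi> * y' \<xi>) = 1"
      using nice_nonzero[OF n xi'] by (simp add: sgn_mult sgn_if)
  qed
  then show ?thesis
    unfolding xi(3) sgn_mult[of "v - u"] sgn_divide using u(3) by simp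
qed

lemma nice_sgn_y':
  assumes "nice c r" "u \<in> {c - r..c + r}"
  shows "sgn (y' u) = sgn (y' c)"
  using assms by (intro sgn_eq_if_mult_pos) (auto simp: nice_def)

text \<open>The slope \<open>x' / y'\<close> is strictly monotone and vanishes at c.\<close>

lemma nice_sgn_x':
  assumes n: "nice c r" and u: "u \<in> {c - r..c + r}" and c: "x' c = 0"
  shows "sgn (x' u) = sgn (x'' c) * sgn (u - c)"
proof (cases "u = c")
  case False
  have cc: "c \<in> {c - r..c + r}" using u by auto
  have nz: "y' u \<noteq> 0" "y' c \<noteq> 0" using nice_nonzero[OF n u] by auto
  have "sgn (x' u / y' u) = sgn (x'' c * y' c) * sgn (u - c)"
    using nice_ratio[OF n u cc] nice_ratio[OF n cc u] c False
    by (cases "u < c") (auto simp: sgn_minus)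
  then have "sgn (x' u) = sgn (y' u) * sgn (y' c) * sgn (x'' c) * sgn (u - c)"
    using nz by (cases "y' u > 0") (auto simp: sgn_divide sgn_mult mult_ac)
  then show ?thesis
    using nice_sgn_y'[OF n u] nz by (simp add: sgn_if split: if_splits)
qed (use c in simp)

lemma nice_sgn_y:
  assumes n: "nice c r" and u: "u \<in> {c - r..c + r}" "v \<in> {c - r..c + r}" "u < v"
  shows "sgn (y v - y u) = sgn (y' c)" "2 * \<bar>y v - y u\<bar> \<ge> (v - u) * \<bar>y' c\<bar>"
proof -
  obtain \<xi> where xi: "\<xi> > u" "\<xi> < v" "y v - y u = (v - u) * y' \<xi>"
    using MVT2[OF u(3), of y y'] DERIV_y by auto
  have xi': "\<xi> \<in> {c - r..c + r}" using xi u by auto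
  show "sgn (y v - y u) = sgn (y' c)"
    unfolding xi(3) using nice_sgn_y'[OF n xi'] u(3) by (simp add: sgn_mult)
  have "\<bar>y' c\<bar> \<le> 2 * \<bar>y' \<xi>\<bar>" using n xi' by (auto simp: nice_def)
  then show "2 * \<bar>y v - y u\<bar> \<ge> (v - u) * \<bar>y' c\<bar>"
    unfolding xi(3) using u(3) mult_left_mono[of "\<bar>y' c\<bar>" "2 * \<bar>y' \<xi>\<bar>" "v - u"] by (simp add: abs_mult mult_ac)
qed

text \<open>Where \<open>y' \<noteq> 0\<close> the curve is a graph over the \<open>y\<close>-axis with slope \<open>x' / y'\<close>, and
  the sign of the area between arc and chord is the convexity of that graph.\<close>

lemma nice_sgn_area:
  assumes n: "nice c r" and u: "u \<in> {c - r..c + r}" "v \<in> {c - r..c + r}" "u < v"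
  shows "sgn (area u v) = sgn (x'' c * y' c)"
proof -
  obtain \<eta> where eta: "\<eta> > u" "\<eta> < v"
    and e: "area u v - area u u = (v - u) * (((y \<eta> - y u) * x' \<eta> - (x \<eta> - x u) * y' \<eta>) / 2)"
    using MVT2[of u v "\<lambda>b. area u b" "\<lambda>b. ((y b - y u) * x' b - (x b - x u) * y' b) / 2"] DERIV_area u by auto
  have eta': "\<eta> \<in> {c - r..c + r}" using eta u by auto
  have nz: "y' \<eta> \<noteq> 0" "y' c \<noteq> 0" using nice_nonzero[OF n eta'] by auto
  \<comment> \<open>Subtracting g times y makes the tangent at \<eta> vertical over the y-axis in
    the sheared sense x - g y = constant, so the chord determinant becomes an increment of x - g y,
    and a second mean value turns it into a difference of two slopes.\<close>
  define g where "g = x' \<eta> / y' \<eta>"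
  have "((\<lambda>t. x t - g * y t) has_real_derivative x' t - g * y' t) (at t)" for t
    by (intro DERIV_diff DERIV_cmult DERIV_x DERIV_y)
  then obtain \<xi> where xi: "\<xi> > u" "\<xi> < \<eta>" "(x \<eta> - g * y \<eta>) - (x u - g * y u) = (\<eta> - u) * (x' \<xi> - g * y' \<xi>)"
    using MVT2[OF eta(1), of "\<lambda>t. x t - g * y t" "\<lambda>t. x' t - g * y' t"] by auto
  have xi': "\<xi> \<in> {c - r..c + r}" using xi eta u by auto
  have nz': "y' \<xi> \<noteq> 0" using nice_nonzero[OF n xi'] by auto
  have "(y \<eta> - y u) * x' \<eta> - (x \<eta> - x u) * y' \<eta> = - y' \<eta> * ((x \<eta> - g * y \<eta>) - (x u - g * y u))"
    using nz by (simp add: g_def field_simps)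
  also have "\<dots> = (\<eta> - u) * (y' \<eta> * y' \<xi>) * (x' \<eta> / y' \<eta> - x' \<xi> / y' \<xi>)"
    unfolding xi(3) using nz' by (simp add: g_def field_simps)
  finally have eq: "area u v = (v - u) * (\<eta> - u) * (y' \<eta> * y' \<xi>) * (x' \<eta> / y' \<eta> - x' \<xi> / y' \<xi>) / 2"
    using e by simp
  have "sgn (y' \<eta> * y' \<xi>) = 1"
    using nice_sgn_y'[OF n xi'] nice_sgn_y'[OF n eta'] nz
    by (auto simp: sgn_mult sgn_if zero_less_mult_iff split: if_splits)
  then show ?thesis
    using nice_ratio[OF n xi' eta' xi(2)] u(3) eta(1) unfolding eq by (simp add: sgn_mult sgn_divide)
qed

end

section \<open>Uniform bounds from periodicity, and reversal of chords\<close>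

lemma periodic_frac:
  fixes f :: "real \<Rightarrow> 'a"
  assumes "\<And>t. f (t + 1) = f t"
  shows "f (frac t) = f t"
proof -
  have n: "f (t + real n) = f t" for t n
  proof (induction n)
    case (Suc n)
    then show ?case using assms[of "t + real n"] by (simp add: algebra_simps)
  qed simp
  show ?thesis
  proof (cases "\<lfloor>t\<rfloor> \<ge> 0")
    case True
    then show ?thesis using n[of "frac t" "nat \<lfloor>t\<rfloor>"] by (simp add: frac_def)
  next
    case False
    then show ?thesis using n[of t "nat (- \<lfloor>t\<rfloor>)"] by (simp add: frac_def)
  qed
qed

lemma cont2_periodic_bounded:
  assumes "cont2 f" and per: "\<And>s t. s \<in> {0..1} \<Longrightarrow> f s (t + 1) = f s t"
  obtains M where "M > 0" "\<And>s t. s \<in> {0..1} \<Longrightarrow> \<bar>f s t\<bar> \<le> M"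
proof -
  have "continuous_on ({0..1} \<times> {0..1}) (\<lambda>(s, t). f s t)"
    using assms(1) unfolding cont2_def by (rule continuous_on_subset) auto
  then have K: "compact ((\<lambda>(s, t). f s t) ` ({0..1} \<times> {0..1}))"
    by (intro compact_continuous_image compact_Times) auto
  obtain M where M: "M > 0" "\<And>s t. s \<in> {0..1} \<Longrightarrow> t \<in> {0..1} \<Longrightarrow> \<bar>f s t\<bar> \<le> M"
  proof -
    from compact_imp_bounded[OF K] obtain M where M: "M > 0" "\<forall>v\<in>(\<lambda>(s, t). f s t) ` ({0..1} \<times> {0..1}). norm v \<le> M"
      unfolding bounded_pos by blast
    show thesis
    proof (rule that[OF M(1)])
      fix s t :: real assume "s \<in> {0..1}" "t \<in> {0..1}"
      then show "\<bar>f s t\<bar> \<le> M" using M(2)[rule_format, of "f s t"] by force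
    qed
  qed
  have "\<bar>f s t\<bar> \<le> M" if "s \<in> {0..1}" for s t
    using M(2)[of s "frac t"] that periodic_frac[of "f s" t] per frac_lt_1[of t] by simp
  with M(1) show thesis
    by (rule that)
qed

context legendrian_curve
begin

lemma velocity_bounded:
  obtains M where "M > 0" "\<And>t. \<bar>x' t\<bar> \<le> M" "\<And>t. \<bar>y' t\<bar> \<le> M"
proof -
  \<comment> \<open>A single curve is treated as a family constant in s.\<close>
  have c: "cont2 (\<lambda>s. g)" if "continuous_on UNIV g" for g
    unfolding cont2_def case_prod_beta'
    by (rule continuous_on_compose2[OF that]) (auto intro: continuous_intros)
  obtain M1 where M1: "M1 > 0" "\<And>t. \<bar>x' t\<bar> \<le> M1"
  proof (rule cont2_periodic_bounded[OF c[OF cont_x'] periodic(4)])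
    fix M assume "M > 0" "\<And>s t. s \<in> {0..1::real} \<Longrightarrow> \<bar>x' t\<bar> \<le> M"
    then show thesis using that[of M] by (metis atLeastAtMost_iff order_refl zero_le_one)
  qed
  obtain M2 where M2: "M2 > 0" "\<And>t. \<bar>y' t\<bar> \<le> M2"
  proof (rule cont2_periodic_bounded[OF c[OF cont_y'] periodic(5)])
    fix M assume "M > 0" "\<And>s t. s \<in> {0..1::real} \<Longrightarrow> \<bar>y' t\<bar> \<le> M"
    then show thesis using that[of M] by (metis atLeastAtMost_iff order_refl zero_le_one)
  qed
  show ?thesis
    by (rule that[of "max M1 M2"]) (use M1 M2 in \<open>auto simp: le_max_iff_disj\<close>)
qed

lemma area_swap: "area b a = - area a b"
  by (simp add: area_def field_simps)

lemma area_periodic: "area a (b + 1) = area a b"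
  by (simp add: area_def periodic)

text \<open>By periodicity the chord from a to a + (1 - d) ends where a chord to a - d ends, so it
  is the short chord from a - d to a run backwards.\<close>

lemma chord_reflect:
  "x (a + (1 - d)) - x a = - (x (a - d + d) - x (a - d))"
  "y (a + (1 - d)) - y a = - (y (a - d + d) - y (a - d))"
  "area a (a + (1 - d)) = - area (a - d) (a - d + d)"
proof -
  have e: "a + (1 - d) = (a - d) + 1" by simp
  show "x (a + (1 - d)) - x a = - (x (a - d + d) - x (a - d))"
    "y (a + (1 - d)) - y a = - (y (a - d + d) - y (a - d))"
    "area a (a + (1 - d)) = - area (a - d) (a - d + d)"
    unfolding e periodic area_periodic by (simp_all add: area_swap[of a])
qed

end

section \<open>Boundary integrals of a single curve, computed at its cusps\<close>

locale cuspidal_curve = legendrian_curve +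
  fixes t0 :: real
  assumes start: "x' t0 \<noteq> 0" and cusp: "x' t = 0 \<Longrightarrow> y' t * x'' t \<noteq> 0"
    and finite_cusps: "finite {t \<in> {t0..<t0 + 1}. x' t = 0}"
begin

definition cusps :: "real set" where
  "cusps = {t \<in> {t0..<t0 + 1}. x' t = 0}"

lemma cusps:
  assumes "c \<in> cusps" shows "t0 < c" "c < t0 + 1" "x' c = 0" "y' c \<noteq> 0" "x'' c \<noteq> 0"
  using assms start cusp[of c] by (auto simp: cusps_def order_less_le)

text \<open>Chords will start within r of a cusp and have length below r, hence the radius 2 r in
  \<open>nice\<close>.\<close>

lemma cusp_radius:
  obtains r where "r > 0" "\<And>c. c \<in> cusps \<Longrightarrow> t0 < c - r \<and> c + r < t0 + 1 \<and> nice c (2 * r)"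
    "\<And>c c'. c \<in> cusps \<Longrightarrow> c' \<in> cusps \<Longrightarrow> c \<noteq> c' \<Longrightarrow> \<bar>c - c'\<bar> > 2 * r"
proof -
  have fin: "finite cusps" using finite_cusps by (simp add: cusps_def)
  have "eventually (\<lambda>r. t0 < c - r \<and> c + r < t0 + 1 \<and> nice c (2 * r)) (at_right 0)" if c: "c \<in> cusps" for c
  proof -
    obtain b where b: "b > 0" "\<And>r. 0 < r \<Longrightarrow> r < b \<Longrightarrow> nice c r"
      using eventually_nice[of c] cusps[OF c] by (auto simp: eventually_at_right_field)
    show ?thesis
      unfolding eventually_at_right_field
      by (rule exI[of _ "min (b / 2) (min (c - t0) (t0 + 1 - c))"]) (use b cusps[OF c] in auto)
  qed
  then have 1: "eventually (\<lambda>r. \<forall>c\<in>cusps. t0 < c - r \<and> c + r < t0 + 1 \<and> nice c (2 * r)) (at_right 0)"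
    by (intro eventually_ball_finite fin ballI)
  have "eventually (\<lambda>r. c \<noteq> c' \<longrightarrow> \<bar>c - c'\<bar> > 2 * r) (at_right 0)" for c c' :: real
    unfolding eventually_at_right_field
    by (rule exI[of _ "if c = c' then 1 else \<bar>c - c'\<bar> / 2"]) auto
  then have 2: "eventually (\<lambda>r. \<forall>c\<in>cusps. \<forall>c'\<in>cusps. c \<noteq> c' \<longrightarrow> \<bar>c - c'\<bar> > 2 * r) (at_right 0)"
    by (intro eventually_ball_finite fin ballI)
  have 3: "eventually (\<lambda>r::real. r > 0) (at_right 0)"
    by (rule eventually_at_right_less)
  have "eventually (\<lambda>r. r > 0 \<and> (\<forall>c\<in>cusps. t0 < c - r \<and> c + r < t0 + 1 \<and> nice c (2 * r))
      \<and> (\<forall>c\<in>cusps. \<forall>c'\<in>cusps. c \<noteq> c' \<longrightarrow> \<bar>c - c'\<bar> > 2 * r)) (at_right 0)"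
    using 1 2 3 by eventually_elim blast
  then obtain r where "r > 0 \<and> (\<forall>c\<in>cusps. t0 < c - r \<and> c + r < t0 + 1 \<and> nice c (2 * r))
      \<and> (\<forall>c\<in>cusps. \<forall>c'\<in>cusps. c \<noteq> c' \<longrightarrow> \<bar>c - c'\<bar> > 2 * r)"
    using eventually_happens'[OF trivial_limit_at_right_real] by blast
  then show ?thesis using that by blast
qed

text \<open>Open intervals are removed, so the remaining set is compact and the endpoints c - r and
  c + r can still be covered by the bound.\<close>

lemma away_from_cusps:
  assumes "r > 0"
  obtains \<mu> where "\<mu> > 0" "\<And>a. a \<in> {t0..t0 + 1} \<Longrightarrow> (\<forall>c\<in>cusps. a \<notin> {c - r<..<c + r}) \<Longrightarrow> \<bar>x' a\<bar> \<ge> \<mu>"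
proof -
  define K where "K = {t0..t0 + 1} - (\<Union>c\<in>cusps. {c - r<..<c + r})"
  have "compact K"
    unfolding K_def by (intro compact_diff compact_Icc open_UN) auto
  moreover have nz: "x' a \<noteq> 0" if "a \<in> K" for a
  proof
    assume 0: "x' a = 0"
    \<comment> \<open>The compact interval contains the right end t0 + 1, which the half-open period
      in \<open>cusps\<close> leaves out.\<close>
    then have "a \<noteq> t0 + 1" using start periodic(4)[of t0] by auto
    then have "a \<in> cusps" using 0 that by (auto simp: K_def cusps_def)
    then show False using that \<open>r > 0\<close> by (auto simp: K_def)
  qed
  moreover have "continuous_on K (\<lambda>a. \<bar>x' a\<bar>)"
    by (intro continuous_intros cont_x')
  ultimately have "\<exists>\<mu>>0. \<forall>a\<in>K. \<bar>x' a\<bar> \<ge> \<mu>"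
  proof (cases "K = {}")
    case False
    then obtain m where "m \<in> K" "\<forall>a\<in>K. \<bar>x' m\<bar> \<le> \<bar>x' a\<bar>"
      using continuous_attains_inf[OF \<open>compact K\<close> False \<open>continuous_on K (\<lambda>a. \<bar>x' a\<bar>)\<close>] by blast
    then show ?thesis using nz[of m] by (intro exI[of _ "\<bar>x' m\<bar>"]) auto
  qed (auto intro: exI[of _ 1])
  then show ?thesis using that by (auto simp: K_def)
qed

text \<open>The constant p stands for the value -1 or 1 of 2 d - 1 at an edge of the band.\<close>

lemma edge_integral_velocity:
  obtains k where "k > 0" "\<And>\<kappa> p. 0 < \<kappa> \<Longrightarrow> \<kappa> < k \<Longrightarrow> \<bar>p\<bar> = 1 \<Longrightarrow>
    edge_integral x' (\<lambda>_. p) (\<lambda>a. \<kappa> * y' a) t0 = p / 2 * (\<Sum>c\<in>cusps. sgn (x'' c * y' c))"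
proof -
  obtain M where M: "M > 0" "\<And>t. \<bar>y' t\<bar> \<le> M" by (rule velocity_bounded, rule that)
  obtain r where r: "r > 0" "\<And>c. c \<in> cusps \<Longrightarrow> t0 < c - r \<and> c + r < t0 + 1 \<and> nice c (2 * r)"
    "\<And>c c'. c \<in> cusps \<Longrightarrow> c' \<in> cusps \<Longrightarrow> c \<noteq> c' \<Longrightarrow> \<bar>c - c'\<bar> > 2 * r"
    by (rule cusp_radius, rule that)
  obtain \<mu> where mu: "\<mu> > 0" "\<And>a. a \<in> {t0..t0 + 1} \<Longrightarrow> (\<forall>c\<in>cusps. a \<notin> {c - r<..<c + r}) \<Longrightarrow> \<bar>x' a\<bar> \<ge> \<mu>"
    by (rule away_from_cusps[OF r(1)], rule that)
  have end_away: "c + r \<notin> {c' - r<..<c' + r}" "c - r \<notin> {c' - r<..<c' + r}" if "c \<in> cusps" "c' \<in> cusps" for c c'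
    using r(1) r(3)[OF that] by (cases "c = c'"; auto)+
  have "edge_integral x' (\<lambda>_. p) (\<lambda>a. \<kappa> * y' a) t0 = p / 2 * (\<Sum>c\<in>cusps. sgn (x'' c * y' c))"
    if k: "0 < \<kappa>" "\<kappa> < min (1 / M) (\<mu> / M)" and p: "\<bar>p\<bar> = 1" for \<kappa> p
  proof -
    \<comment> \<open>The first bound makes the constant of modulus 1 dominate \<kappa>
      \<open>y'\<close>, the second lets \<open>x'\<close> dominate it away from the cusps.\<close>
    have kM: "\<kappa> * M \<le> 1" "\<kappa> * M \<le> \<mu>" using k M(1) by (auto simp: field_simps)
    have W: "\<bar>\<kappa> * y' a\<bar> \<le> \<kappa> * M" for a
      using k(1) M by (simp add: abs_mult)
    have "edge_integral x' (\<lambda>_. p) (\<lambda>a. \<kappa> * y' a) t0 = (\<Sum>c\<in>cusps. sgn (x'' c) * sgn p * sgn (y' c) / 2)"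
    proof (rule edge_integral_eq_sum[OF DERIV_x' DERIV_cmult[OF DERIV_y'], where r = r])
      show "finite cusps" using finite_cusps by (simp add: cusps_def)
      show "r > 0" by fact
      show "t0 \<le> c - r \<and> c + r \<le> t0 + 1" if "c \<in> cusps" for c using r(2)[OF that] by auto
      show "2 * r < \<bar>c - c'\<bar>" if "c \<in> cusps" "c' \<in> cusps" "c \<noteq> c'" for c c' using r(3) that by blast
      show "sgn (y' c) \<noteq> 0" if "c \<in> cusps" for c using cusps[OF that] by (simp add: sgn_zero_iff)
      show "sgn (\<kappa> * y' a) = sgn (y' c) \<and> sgn p = sgn p \<and> \<bar>\<kappa> * y' a\<bar> \<le> \<bar>p\<bar>"
        if c: "c \<in> cusps" and a: "a \<in> {c - r..c + r}" for c a
      proof -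
        have "nice c (2 * r)" "a \<in> {c - 2 * r..c + 2 * r}" using r(1) r(2)[OF c] a by auto
        from nice_sgn_y'[OF this] show ?thesis
          using k(1) p W[of a] kM by (simp add: sgn_mult)
      qed
      show "sgn (x' (c + r)) = sgn (x'' c) \<and> sgn (x' (c - r)) = - sgn (x'' c)" if c: "c \<in> cusps" for c
        using nice_sgn_x'[of c "2 * r" "c + r"] nice_sgn_x'[of c "2 * r" "c - r"] r(1) r(2)[OF c] cusps(3)[OF c] by auto
      show "\<bar>\<kappa> * y' (c + r)\<bar> \<le> \<bar>x' (c + r)\<bar> \<and> \<bar>\<kappa> * y' (c - r)\<bar> \<le> \<bar>x' (c - r)\<bar>" if c: "c \<in> cusps" for c
        using W[of "c + r"] W[of "c - r"] kM mu(2)[of "c + r"] mu(2)[of "c - r"] end_away[OF c] r(1) r(2)[OF c] by force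
      show "\<bar>\<kappa> * y' a\<bar> \<le> \<bar>x' a\<bar>" if "a \<in> {t0..t0 + 1}" "\<And>c. c \<in> cusps \<Longrightarrow> a \<notin> {c - r..c + r}" for a
        using W[of a] kM mu(2)[of a] that by force
    qed
    also have "\<dots> = (\<Sum>c\<in>cusps. p / 2 * sgn (x'' c * y' c))"
      using p by (intro sum.cong refl) (auto simp: sgn_mult abs_if split: if_splits)
    finally show ?thesis by (simp add: sum_distrib_left)
  qed
  moreover have "min (1 / M) (\<mu> / M) > 0" using M mu by simp
  ultimately show ?thesis using that by blast
qed

text \<open>The two edges of the band contribute with opposite signs because reversing a chord flips
  three signs. The period for the long chords starts at t0 + d since the corresponding short chords
  start at a - d.\<close>

lemma edge_integral_chord:
  obtains \<delta> where "\<delta> > 0"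
    "\<And>d. 0 < d \<Longrightarrow> d < \<delta> \<Longrightarrow>
      edge_integral (\<lambda>a. x (a + d) - x a) (\<lambda>a. y (a + d) - y a) (\<lambda>a. area a (a + d)) t0 = real (card cusps) / 2"
    "\<And>d. 0 < d \<Longrightarrow> d < \<delta> \<Longrightarrow>
      edge_integral (\<lambda>a. x (a + (1 - d)) - x a) (\<lambda>a. y (a + (1 - d)) - y a) (\<lambda>a. area a (a + (1 - d))) (t0 + d)
        = - real (card cusps) / 2"
proof -
  obtain M where M: "M > 0" "\<And>t. \<bar>x' t\<bar> \<le> M" "\<And>t. \<bar>y' t\<bar> \<le> M" by (rule velocity_bounded, rule that)
  obtain r where r: "r > 0" "\<And>c. c \<in> cusps \<Longrightarrow> t0 < c - r \<and> c + r < t0 + 1 \<and> nice c (2 * r)"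
    "\<And>c c'. c \<in> cusps \<Longrightarrow> c' \<in> cusps \<Longrightarrow> c \<noteq> c' \<Longrightarrow> \<bar>c - c'\<bar> > 2 * r"
    by (rule cusp_radius, rule that)
  obtain \<mu> where mu: "\<mu> > 0" "\<And>a. a \<in> {t0..t0 + 1} \<Longrightarrow> (\<forall>c\<in>cusps. a \<notin> {c - r<..<c + r}) \<Longrightarrow> \<bar>x' a\<bar> \<ge> \<mu>"
    by (rule away_from_cusps[OF r(1)], rule that)
  have end_away: "c + r \<notin> {c' - r<..<c' + r}" "c - r \<notin> {c' - r<..<c' + r}" if "c \<in> cusps" "c' \<in> cusps" for c c'
    using r(1) r(3)[OF that] by (cases "c = c'"; auto)+
  have fin: "finite cusps" using finite_cusps by (simp add: cusps_def)
  obtain \<nu> where nu: "\<nu> > 0" "\<And>c. c \<in> cusps \<Longrightarrow> \<nu> \<le> \<bar>y' c\<bar>"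
  proof
    show "Min (insert 1 ((\<lambda>c. \<bar>y' c\<bar>) ` cusps)) > 0"
      using fin cusps(4) by (subst Min_gr_iff) auto
    show "Min (insert 1 ((\<lambda>c. \<bar>y' c\<bar>) ` cusps)) \<le> \<bar>y' c\<bar>" if "c \<in> cusps" for c
      using fin that by (intro Min_le) auto
  qed
  \<comment> \<open>Chords of length below 1 starting in one period end before t0 + 2.\<close>
  have "uniformly_continuous_on {t0..t0 + 2} x'"
    by (intro compact_uniformly_continuous cont_x') auto
  then obtain \<delta>1 where d1: "\<delta>1 > 0"
    "\<And>u v. u \<in> {t0..t0 + 2} \<Longrightarrow> v \<in> {t0..t0 + 2} \<Longrightarrow> \<bar>v - u\<bar> < \<delta>1 \<Longrightarrow> \<bar>x' v - x' u\<bar> < \<mu> / 2"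
    using mu(1) unfolding uniformly_continuous_on_def dist_real_def by (metis half_gt_zero)
  \<comment> \<open>Below r a chord stays in the 2 r neighbourhood of its cusp; below
    \<open>\<delta>1\<close> the values of \<open>x'\<close> along it stay within \<mu> / 2. The
    area is at most \<open>d\<^sup>2 * M\<^sup>2\<close>, and the last two entries push this below d
    \<nu> / 2 and d \<mu> / 2, the lower bounds for the increment of y near a cusp and of x
    elsewhere.\<close>
  define \<delta> where "\<delta> = Min {r, \<delta>1, 1, \<nu> / (2 * M\<^sup>2), \<mu> / (2 * M\<^sup>2)}"
  have "\<delta> > 0" using r(1) d1(1) nu(1) mu(1) M(1) by (simp add: \<delta>_def)
  have main: "edge_integral (\<lambda>a. x (a + d) - x a) (\<lambda>a. y (a + d) - y a) (\<lambda>a. area a (a + d)) t0 = real (card cusps) / 2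
    \<and> edge_integral (\<lambda>a. x (a + (1 - d)) - x a) (\<lambda>a. y (a + (1 - d)) - y a) (\<lambda>a. area a (a + (1 - d))) (t0 + d)
        = - real (card cusps) / 2" if d: "0 < d" "d < \<delta>" for d
  proof -
    have db: "d < r" "d < \<delta>1" "d < 1" "2 * (d * M\<^sup>2) \<le> \<nu>" "2 * (d * M\<^sup>2) \<le> \<mu>"
      using d M(1) by (auto simp: \<delta>_def field_simps)
    have W_le: "\<bar>area a (a + d)\<bar> \<le> d * (d * M\<^sup>2)" for a
      using area_bound[of d M a] M d by (simp add: power2_eq_square mult.assoc)
    have X_far: "sgn (x (a + d) - x a) = sgn (x' a)" "\<bar>x (a + d) - x a\<bar> \<ge> \<bar>area a (a + d)\<bar>"
      if a: "a \<in> {t0..t0 + 1}" "\<bar>x' a\<bar> \<ge> \<mu>" for a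
    proof -
      obtain \<xi> where xi: "\<xi> > a" "\<xi> < a + d" "x (a + d) - x a = (a + d - a) * x' \<xi>"
        using MVT2[of a "a + d" x x'] DERIV_x d by auto
      have close: "\<bar>x' \<xi> - x' a\<bar> < \<mu> / 2"
        using d1(2)[of a \<xi>] xi a db by auto
      have "sgn (x' \<xi>) = sgn (x' a)" "\<bar>x' \<xi>\<bar> \<ge> \<mu> / 2"
        using close a(2) mu(1) by (auto simp: sgn_if abs_if split: if_splits)
      then show "sgn (x (a + d) - x a) = sgn (x' a)"
        unfolding xi(3) using d by (simp add: sgn_mult)
      have "d * (d * M\<^sup>2) \<le> d * \<bar>x' \<xi>\<bar>"
        using d db \<open>\<bar>x' \<xi>\<bar> \<ge> \<mu> / 2\<close> by (intro mult_left_mono) auto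
      with W_le[of a] have "\<bar>area a (a + d)\<bar> \<le> d * \<bar>x' \<xi>\<bar>"
        by (rule order_trans)
      then show "\<bar>x (a + d) - x a\<bar> \<ge> \<bar>area a (a + d)\<bar>"
        unfolding xi(3) using d by (simp add: abs_mult)
    qed
    have near: "sgn (area a (a + d)) = sgn (x'' c * y' c) \<and> sgn (y (a + d) - y a) = sgn (y' c)
        \<and> \<bar>area a (a + d)\<bar> \<le> \<bar>y (a + d) - y a\<bar>"
      if c: "c \<in> cusps" and a: "a \<in> {c - r..c + r}" for c a
    proof -
      have n: "nice c (2 * r)" "a \<in> {c - 2 * r..c + 2 * r}" "a + d \<in> {c - 2 * r..c + 2 * r}" "a < a + d"
        using r(1) r(2)[OF c] a d db by auto
      have "d * (2 * (d * M\<^sup>2)) \<le> d * \<bar>y' c\<bar>"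
        using d db nu(2)[OF c] by (intro mult_left_mono) auto
      then show ?thesis
        using nice_sgn_area[OF n] nice_sgn_y[OF n] W_le[of a] by simp
    qed
    have ends: "sgn (x (c + r + d) - x (c + r)) = sgn (x'' c) \<and> sgn (x (c - r + d) - x (c - r)) = - sgn (x'' c)"
      "\<bar>area (c + r) (c + r + d)\<bar> \<le> \<bar>x (c + r + d) - x (c + r)\<bar> \<and> \<bar>area (c - r) (c - r + d)\<bar> \<le> \<bar>x (c - r + d) - x (c - r)\<bar>"
      if c: "c \<in> cusps" for c
    proof -
      have in1: "c + r \<in> {t0..t0 + 1}" "c - r \<in> {t0..t0 + 1}" using r(1) r(2)[OF c] by auto
      have "\<bar>x' (c + r)\<bar> \<ge> \<mu>" "\<bar>x' (c - r)\<bar> \<ge> \<mu>" using mu(2) in1 end_away[OF c] by blast+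
      note far = X_far[OF in1(1) this(1)] X_far[OF in1(2) this(2)]
      have "sgn (x' (c + r)) = sgn (x'' c) \<and> sgn (x' (c - r)) = - sgn (x'' c)"
        using nice_sgn_x'[of c "2 * r" "c + r"] nice_sgn_x'[of c "2 * r" "c - r"] r(1) r(2)[OF c] cusps(3)[OF c] by auto
      then show "sgn (x (c + r + d) - x (c + r)) = sgn (x'' c) \<and> sgn (x (c - r + d) - x (c - r)) = - sgn (x'' c)"
        "\<bar>area (c + r) (c + r + d)\<bar> \<le> \<bar>x (c + r + d) - x (c + r)\<bar> \<and> \<bar>area (c - r) (c - r + d)\<bar> \<le> \<bar>x (c - r + d) - x (c - r)\<bar>"
        using far by auto
    qed
    have away: "\<bar>area a (a + d)\<bar> \<le> \<bar>x (a + d) - x a\<bar>"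
      if "a \<in> {t0..t0 + 1}" "\<And>c. c \<in> cusps \<Longrightarrow> a \<notin> {c - r..c + r}" for a
      using X_far(2)[OF that(1)] mu(2)[OF that(1)] that(2) by force
    have DX: "((\<lambda>a. x (a + u) - x a) has_real_derivative x' (a + u) - x' a) (at a)" for a u
      by (intro DERIV_diff DERIV_shift_compose DERIV_x)
    have DY: "((\<lambda>a. y a + y (a + u)) has_real_derivative y' a + y' (a + u)) (at a)" for a u
      by (intro DERIV_add DERIV_shift_compose DERIV_y)
    have DZ: "((\<lambda>a. z (a + u) - z a) has_real_derivative y (a + u) * x' (a + u) - y a * x' a) (at a)" for a u
      by (intro DERIV_diff DERIV_shift_compose[where f' = "\<lambda>t. y t * x' t"] DERIV_z)
    have DW: "((\<lambda>a. area a (a + u)) has_real_derivative (y (a + u) * x' (a + u) - y a * x' a)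
        - ((y' a + y' (a + u)) / 2 * (x (a + u) - x a) + (x' (a + u) - x' a) * ((y a + y (a + u)) / 2))) (at a)" for a u
      unfolding area_def by (intro DERIV_diff[OF DZ] DERIV_mult[OF DERIV_cdivide[OF DY] DX])
    \<comment> \<open>The sign of the area is the product of the other two signs, so up and down
      cusps count alike.\<close>
    have val: "sgn (x'' c) * sgn (y' c) * sgn (x'' c * y' c) / 2 = 1 / 2" if "c \<in> cusps" for c
      using cusps[OF that] by (auto simp: sgn_if zero_less_mult_iff)
    have nz: "sgn (x'' c * y' c) \<noteq> 0" if "c \<in> cusps" for c
      using cusps[OF that] by (simp add: sgn_zero_iff)
    have "edge_integral (\<lambda>a. x (a + d) - x a) (\<lambda>a. y (a + d) - y a) (\<lambda>a. area a (a + d)) t0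
       = (\<Sum>c\<in>cusps. sgn (x'' c) * sgn (y' c) * sgn (x'' c * y' c) / 2)"
      by (rule edge_integral_eq_sum[OF DX DW fin _ r(1) r(3) near nz ends away])
        (use r(2) in \<open>auto simp: less_imp_le\<close>)
    also have "\<dots> = (\<Sum>c\<in>cusps. 1 / 2)"
      by (intro sum.cong val refl)
    finally have 1: "edge_integral (\<lambda>a. x (a + d) - x a) (\<lambda>a. y (a + d) - y a) (\<lambda>a. area a (a + d)) t0 = real (card cusps) / 2"
      by simp
    \<comment> \<open>In terms of the starting point of the long chord, the cusps appear translated
      by d.\<close>
    have "edge_integral (\<lambda>a. x (a + (1 - d)) - x a) (\<lambda>a. y (a + (1 - d)) - y a) (\<lambda>a. area a (a + (1 - d))) (t0 + d)
       = (\<Sum>c\<in>(\<lambda>c. c + d) ` cusps. (- sgn (x'' (c - d))) * (- sgn (y' (c - d))) * (- sgn (x'' (c - d) * y' (c - d))) / 2)"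
    proof (rule edge_integral_eq_sum[OF DX DW finite_imageI[OF fin] _ r(1)])
      fix c assume "c \<in> (\<lambda>c. c + d) ` cusps"
      then have c: "c - d \<in> cusps" by auto
      show "t0 + d \<le> c - r \<and> c + r \<le> t0 + d + 1"
        using r(2)[OF c] by auto
      show "- sgn (x'' (c - d) * y' (c - d)) \<noteq> 0"
        using nz[OF c] by simp
      show "2 * r < \<bar>c - c'\<bar>" if "c' \<in> (\<lambda>c. c + d) ` cusps" "c \<noteq> c'" for c'
        using r(3)[OF c, of "c' - d"] that by auto
      show "sgn (area a (a + (1 - d))) = - sgn (x'' (c - d) * y' (c - d)) \<and>
          sgn (y (a + (1 - d)) - y a) = - sgn (y' (c - d)) \<and>
          \<bar>area a (a + (1 - d))\<bar> \<le> \<bar>y (a + (1 - d)) - y a\<bar>" if "a \<in> {c - r..c + r}" for a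
        using near[OF c, of "a - d"] that unfolding chord_reflect sgn_minus abs_minus_cancel by auto
      have e: "c + r - d = c - d + r" "c - r - d = c - d - r" by auto
      show "sgn (x (c + r + (1 - d)) - x (c + r)) = - sgn (x'' (c - d)) \<and>
           sgn (x (c - r + (1 - d)) - x (c - r)) = - (- sgn (x'' (c - d)))"
        using ends(1)[OF c] unfolding chord_reflect sgn_minus abs_minus_cancel e by simp
      show "\<bar>area (c + r) (c + r + (1 - d))\<bar> \<le> \<bar>x (c + r + (1 - d)) - x (c + r)\<bar> \<and>
          \<bar>area (c - r) (c - r + (1 - d))\<bar> \<le> \<bar>x (c - r + (1 - d)) - x (c - r)\<bar>"
        using ends(2)[OF c] unfolding chord_reflect sgn_minus abs_minus_cancel e by simp
    next
      fix a assume a: "a \<in> {t0 + d..t0 + d + 1}" "\<And>c. c \<in> (\<lambda>c. c + d) ` cusps \<Longrightarrow> a \<notin> {c - r..c + r}"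
      have "a - d \<notin> {c - r..c + r}" if "c \<in> cusps" for c
        using a(2)[of "c + d"] that by auto
      with a(1) show "\<bar>area a (a + (1 - d))\<bar> \<le> \<bar>x (a + (1 - d)) - x a\<bar>"
        unfolding chord_reflect abs_minus_cancel by (intro away) auto
    qed
    also have "\<dots> = (\<Sum>c\<in>cusps. - (sgn (x'' c) * sgn (y' c) * sgn (x'' c * y' c) / 2))"
      by (subst sum.reindex) (auto simp: inj_on_def)
    also have "\<dots> = (\<Sum>c\<in>cusps. - (1 / 2))"
      using val by (intro sum.cong refl) simp
    finally show ?thesis
      using 1 by simp
  qed
  show ?thesis
    by (rule that[OF \<open>\<delta> > 0\<close>]) (use main in blast)+
qed

end

section \<open>Isotopy invariance of the cusp counts\<close>

context cuspidal_curve
begin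

text \<open>That the sign of \<open>x'' * y'\<close> tells the lower-to-upper passage from the
  opposite one is shown in \<open>up_iff\<close>.\<close>

definition ups :: "real set" where
  "ups = {t \<in> {t0..<t0 + 1}. x' t = 0 \<and> x'' t * y' t > 0}"

definition downs :: "real set" where
  "downs = {t \<in> {t0..<t0 + 1}. x' t = 0 \<and> x'' t * y' t < 0}"

lemma cusps_partition: "cusps = ups \<union> downs" "ups \<inter> downs = {}" "finite ups" "finite downs"
proof -
  have "x'' c * y' c \<noteq> 0" if "c \<in> cusps" for c using cusps[OF that] by simp
  then show *: "cusps = ups \<union> downs"
    unfolding ups_def downs_def cusps_def by (auto simp: not_less_iff_gr_or_eq)
  show "ups \<inter> downs = {}" unfolding ups_def downs_def by auto
  have "finite cusps" using finite_cusps by (simp add: cusps_def)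
  then show "finite ups" "finite downs" unfolding * by auto
qed

lemma card_cusps: "card cusps = card ups + card downs"
  using cusps_partition by (simp add: card_Un_disjoint)

lemma sum_sgn_cusps: "(\<Sum>c\<in>cusps. sgn (x'' c * y' c)) = real (card ups) - real (card downs)"
proof -
  have "(\<Sum>c\<in>cusps. sgn (x'' c * y' c)) = (\<Sum>c\<in>ups. sgn (x'' c * y' c)) + (\<Sum>c\<in>downs. sgn (x'' c * y' c))"
    unfolding cusps_partition(1) using cusps_partition by (intro sum.union_disjoint) auto
  also have "(\<Sum>c\<in>ups. sgn (x'' c * y' c)) = (\<Sum>c\<in>ups. 1)"
    by (intro sum.cong refl) (simp add: ups_def)
  also have "(\<Sum>c\<in>downs. sgn (x'' c * y' c)) = (\<Sum>c\<in>downs. -1)"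
    by (intro sum.cong refl) (simp add: downs_def)
  finally show ?thesis by simp
qed

end

lemma C2_fam_add:
  assumes "C2_fam f" "C2_fam g" shows "C2_fam (\<lambda>s a d. f s a d + g s a d)"
  using C2_fam_diff[OF assms(1) C2_fam_diff[OF C2_fam_const[of 0] assms(2)]] by simp

text \<open>One of the two functions has to stay large along the whole arc: the mean value theorem
  will supply different intermediate points for x and for y, so a pointwise alternative would not
  suffice.\<close>

lemma uniformly_nonvertical:
  assumes c: "cont2 p" "cont2 q" and per: "\<And>s t. s \<in> {0..1} \<Longrightarrow> p s (t + 1) = p s t" "\<And>s t. s \<in> {0..1} \<Longrightarrow> q s (t + 1) = q s t"
    and nz: "\<And>s t. s \<in> {0..1} \<Longrightarrow> p s t \<noteq> 0 \<or> q s t \<noteq> 0"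
  obtains \<mu> \<delta> where "\<mu> > 0" "\<delta> > 0"
    "\<And>s a. s \<in> {0..1} \<Longrightarrow> (\<forall>e\<in>{0..\<delta>}. \<bar>p s (a + e)\<bar> \<ge> \<mu>) \<or> (\<forall>e\<in>{0..\<delta>}. \<bar>q s (a + e)\<bar> \<ge> \<mu>)"
proof -
  \<comment> \<open>The second coordinate goes up to 2 because it has to hold
    \<open>frac a + e\<close> with e at most 1.\<close>
  let ?K = "{0..1::real} \<times> {0..2::real}"
  have cp: "continuous_on ?K (\<lambda>(s, t). p s t)" and cq: "continuous_on ?K (\<lambda>(s, t). q s t)"
    using c unfolding cont2_def by (auto elim: continuous_on_subset)
  have cpt: "compact ?K" by (intro compact_Times) auto
  define g where "g u = max \<bar>(\<lambda>(s, t). p s t) u\<bar> \<bar>(\<lambda>(s, t). q s t) u\<bar>" for u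
  have cg: "continuous_on ?K g"
    unfolding g_def by (intro continuous_intros cp cq)
  have "?K \<noteq> {}" by auto
  then obtain u where u: "u \<in> ?K" "\<forall>v\<in>?K. g u \<le> g v"
    by (rule bexE[OF continuous_attains_inf[OF cpt _ cg]]) (rule that)
  obtain s0 t0 where st: "u = (s0, t0)" by (cases u)
  have m: "s0 \<in> {0..1}" "max \<bar>p s0 t0\<bar> \<bar>q s0 t0\<bar> \<le> max \<bar>p s t\<bar> \<bar>q s t\<bar>"
    if "s \<in> {0..1}" "t \<in> {0..2}" for s t
    using u(1) u(2)[rule_format, of "(s, t)"] that by (auto simp: st g_def)
  \<comment> \<open>Half the minimum, so that a variation below \<mu> still leaves the value
    \<mu>.\<close>
  define \<mu> where "\<mu> = max \<bar>p s0 t0\<bar> \<bar>q s0 t0\<bar> / 2"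
  have mu: "\<mu> > 0" using nz[OF m(1)[of 0 0], of t0] by (auto simp: \<mu>_def less_max_iff_disj)
  have uc: "\<exists>d>0. \<forall>u\<in>?K. \<forall>v\<in>?K. dist v u < d \<longrightarrow> dist (f v) (f u) < \<mu>"
    if "continuous_on ?K f" for f :: "real \<times> real \<Rightarrow> real"
    using compact_uniformly_continuous[OF that cpt] mu unfolding uniformly_continuous_on_def by simp
  obtain d1 where d1: "d1 > 0" "\<forall>u\<in>?K. \<forall>v\<in>?K. dist v u < d1 \<longrightarrow> dist (case v of (s, t) \<Rightarrow> p s t) (case u of (s, t) \<Rightarrow> p s t) < \<mu>"
    using uc[OF cp] by (elim exE conjE) (rule that)
  obtain d2 where d2: "d2 > 0" "\<forall>u\<in>?K. \<forall>v\<in>?K. dist v u < d2 \<longrightarrow> dist (case v of (s, t) \<Rightarrow> q s t) (case u of (s, t) \<Rightarrow> q s t) < \<mu>"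
    using uc[OF cq] by (elim exE conjE) (rule that)
  define \<delta> where "\<delta> = min 1 (min d1 d2 / 2)"
  have "\<delta> > 0" using d1 d2 by (simp add: \<delta>_def)
  moreover have "(\<forall>e\<in>{0..\<delta>}. \<bar>p s (a + e)\<bar> \<ge> \<mu>) \<or> (\<forall>e\<in>{0..\<delta>}. \<bar>q s (a + e)\<bar> \<ge> \<mu>)" if s: "s \<in> {0..1}" for s a
  proof -
    have fr: "p s (a + e) = p s (frac a + e)" "q s (a + e) = q s (frac a + e)" for e
      using periodic_frac[of "\<lambda>a. p s (a + e)" a] periodic_frac[of "\<lambda>a. q s (a + e)" a]
        per(1)[OF s, of "_ + e"] per(2)[OF s, of "_ + e"] by (simp_all add: algebra_simps)
    have f: "0 \<le> frac a" "frac a < 1" using frac_lt_1 frac_ge_0 by auto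
    have cl: "\<bar>p s (frac a + e) - p s (frac a)\<bar> < \<mu>" "\<bar>q s (frac a + e) - q s (frac a)\<bar> < \<mu>" if e: "e \<in> {0..\<delta>}" for e
    proof -
      have "(s, frac a) \<in> ?K" "(s, frac a + e) \<in> ?K" using s f e by (auto simp: \<delta>_def)
      moreover have "dist (s, frac a + e) (s, frac a) < d1" "dist (s, frac a + e) (s, frac a) < d2"
        using e \<open>\<delta> > 0\<close> d1 d2 by (auto simp: dist_Pair_Pair dist_real_def \<delta>_def)
      ultimately show "\<bar>p s (frac a + e) - p s (frac a)\<bar> < \<mu>" "\<bar>q s (frac a + e) - q s (frac a)\<bar> < \<mu>"
        using d1(2)[rule_format, of "(s, frac a)" "(s, frac a + e)"] d2(2)[rule_format, of "(s, frac a)" "(s, frac a + e)"]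
        unfolding dist_real_def by simp_all
    qed
    have "max \<bar>p s (frac a)\<bar> \<bar>q s (frac a)\<bar> \<ge> 2 * \<mu>"
      using m(2)[OF s, of "frac a"] f by (simp add: \<mu>_def)
    then consider "\<bar>p s (frac a)\<bar> \<ge> 2 * \<mu>" | "\<bar>q s (frac a)\<bar> \<ge> 2 * \<mu>"
      by (auto simp: le_max_iff_disj)
    then show ?thesis
    proof cases
      case 1
      then have "\<bar>p s (a + e)\<bar> \<ge> \<mu>" if "e \<in> {0..\<delta>}" for e using cl(1)[OF that] unfolding fr by linarith
      then show ?thesis by blast
    next
      case 2
      then have "\<bar>q s (a + e)\<bar> \<ge> \<mu>" if "e \<in> {0..\<delta>}" for e using cl(2)[OF that] unfolding fr by linarith
      then show ?thesis by blast
    qed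
  qed
  ultimately show ?thesis using mu that by blast
qed

text \<open>The velocities are required to be families of class \<open>C2_curve\<close> as well,
  because they serve as coordinates of the band for the rotation number.\<close>

locale legendrian_isotopy =
  fixes x y z x' y' x'' y'' :: "real \<Rightarrow> real \<Rightarrow> real"
  assumes curve: "s \<in> {0..1} \<Longrightarrow> legendrian_curve (x s) (y s) (z s) (x' s) (y' s) (x'' s) (y'' s)"
    and C2: "C2_curve x" "C2_curve y" "C2_curve z" "C2_curve x'" "C2_curve y'"
    and immersed: "s \<in> {0..1} \<Longrightarrow> x' s t \<noteq> 0 \<or> y' s t \<noteq> 0"
    and embedded: "s \<in> {0..1} \<Longrightarrow> x s a = x s b \<Longrightarrow> y s a = y s b \<Longrightarrow> z s a = z s b \<Longrightarrow> a - b \<in> \<int>"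
begin

lemma cont2_velocity: "cont2 x'" "cont2 y'"
  using C2(4,5) C2_curves.cont(1) unfolding C2_curve_def by blast+

lemma velocity_uniformly_bounded:
  obtains M where "M > 0" "\<And>s t. s \<in> {0..1} \<Longrightarrow> \<bar>x' s t\<bar> \<le> M" "\<And>s t. s \<in> {0..1} \<Longrightarrow> \<bar>y' s t\<bar> \<le> M"
proof -
  obtain M1 where M1: "M1 > 0" "\<And>s t. s \<in> {0..1} \<Longrightarrow> \<bar>x' s t\<bar> \<le> M1"
    by (rule cont2_periodic_bounded[OF cont2_velocity(1) legendrian_curve.periodic(4)[OF curve]], assumption, rule that)
  obtain M2 where M2: "M2 > 0" "\<And>s t. s \<in> {0..1} \<Longrightarrow> \<bar>y' s t\<bar> \<le> M2"
    by (rule cont2_periodic_bounded[OF cont2_velocity(2) legendrian_curve.periodic(5)[OF curve]], assumption, rule that)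
  show ?thesis
    by (rule that[of "max M1 M2"]) (use M1 M2 in \<open>auto simp: le_max_iff_disj\<close>)
qed

text \<open>The defining equation of \<open>legendrian_curve.area\<close> is available only for s in
  [0, 1]; this copy can be rewritten for every s when it is treated as a family.\<close>

definition chord_area where
  "chord_area s a b = z s b - z s a - (y s a + y s b) / 2 * (x s b - x s a)"

lemma area_eq: "s \<in> {0..1} \<Longrightarrow> legendrian_curve.area (x s) (y s) (z s) a b = chord_area s a b"
  using legendrian_curve.area_def[OF curve] by (simp add: chord_area_def)

text \<open>The area is at most \<open>d\<^sup>2 * M\<^sup>2\<close>, while one of the increments of
  x and y is at least d \<mu>, with \<mu> and M uniform along the isotopy.\<close>

lemma short_chord:
  obtains \<delta> where "\<delta> > 0" "\<And>s a d. s \<in> {0..1} \<Longrightarrow> 0 < d \<Longrightarrow> d < \<delta> \<Longrightarrow>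
    \<bar>x s (a + d) - x s a\<bar> \<ge> \<bar>chord_area s a (a + d)\<bar> \<or> \<bar>y s (a + d) - y s a\<bar> \<ge> \<bar>chord_area s a (a + d)\<bar>"
proof -
  obtain M where M: "M > 0" "\<And>s t. s \<in> {0..1} \<Longrightarrow> \<bar>x' s t\<bar> \<le> M" "\<And>s t. s \<in> {0..1} \<Longrightarrow> \<bar>y' s t\<bar> \<le> M"
    by (rule velocity_uniformly_bounded, rule that)
  obtain \<mu> \<delta> where d: "\<mu> > 0" "\<delta> > 0"
    "\<And>s a. s \<in> {0..1} \<Longrightarrow> (\<forall>e\<in>{0..\<delta>}. \<bar>x' s (a + e)\<bar> \<ge> \<mu>) \<or> (\<forall>e\<in>{0..\<delta>}. \<bar>y' s (a + e)\<bar> \<ge> \<mu>)"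
    by (rule uniformly_nonvertical[OF cont2_velocity legendrian_curve.periodic(4)[OF curve]
          legendrian_curve.periodic(5)[OF curve] immersed], assumption+, rule that)
  have "\<bar>x s (a + d) - x s a\<bar> \<ge> \<bar>chord_area s a (a + d)\<bar> \<or> \<bar>y s (a + d) - y s a\<bar> \<ge> \<bar>chord_area s a (a + d)\<bar>"
    if s: "s \<in> {0..1}" and dd: "0 < d" "d < min \<delta> (\<mu> / M\<^sup>2)" for s a d
  proof -
    interpret legendrian_curve "x s" "y s" "z s" "x' s" "y' s" "x'' s" "y'' s" by (rule curve[OF s])
    have "d * M\<^sup>2 \<le> \<mu>" using that M(1) by (simp add: field_simps)
    then have "d * (d * M\<^sup>2) \<le> d * \<mu>" using that by (intro mult_left_mono) auto
    moreover have "\<bar>chord_area s a (a + d)\<bar> \<le> d * (d * M\<^sup>2)"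
      using area_bound[of d M a] M that by (simp add: area_eq power2_eq_square mult.assoc)
    ultimately have W: "\<bar>chord_area s a (a + d)\<bar> \<le> d * \<mu>" by linarith
    obtain \<xi> where xi: "\<xi> > a" "\<xi> < a + d" "x s (a + d) - x s a = (a + d - a) * x' s \<xi>"
      using MVT2[of a "a + d" "x s" "x' s"] DERIV_x dd by auto
    obtain \<eta> where eta: "\<eta> > a" "\<eta> < a + d" "y s (a + d) - y s a = (a + d - a) * y' s \<eta>"
      using MVT2[of a "a + d" "y s" "y' s"] DERIV_y dd by auto
    have "\<bar>x' s \<xi>\<bar> \<ge> \<mu> \<or> \<bar>y' s \<eta>\<bar> \<ge> \<mu>"
    proof -
      have "a + (\<xi> - a) = \<xi>" "a + (\<eta> - a) = \<eta>" "\<xi> - a \<in> {0..\<delta>}" "\<eta> - a \<in> {0..\<delta>}"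
        using xi eta dd by auto
      then show ?thesis using d(3)[OF s, of a] by metis
    qed
    then have "d * \<mu> \<le> d * \<bar>x' s \<xi>\<bar> \<or> d * \<mu> \<le> d * \<bar>y' s \<eta>\<bar>"
      using dd(1) by (auto intro: mult_left_mono)
    moreover have "\<bar>x s (a + d) - x s a\<bar> = d * \<bar>x' s \<xi>\<bar>" "\<bar>y s (a + d) - y s a\<bar> = d * \<bar>y' s \<eta>\<bar>"
      unfolding xi(3) eta(3) using dd(1) by (simp_all add: abs_mult)
    ultimately show ?thesis
      using W by linarith
  qed
  moreover have "min \<delta> (\<mu> / M\<^sup>2) > 0" using d M by simp
  ultimately show ?thesis using that by blast
qed

definition front_embedded :: "real \<Rightarrow> bool" where
  "front_embedded s \<longleftrightarrow> (\<forall>a b. x s a = x s b \<longrightarrow> z s a = z s b \<longrightarrow> a - b \<in> \<int>)"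

lemma rotation_invariant:
  assumes c0: "cuspidal_curve (x 0) (y 0) (z 0) (x' 0) (y' 0) (x'' 0) (y'' 0) t0"
    and c1: "cuspidal_curve (x 1) (y 1) (z 1) (x' 1) (y' 1) (x'' 1) (y'' 1) t1"
  shows "(\<Sum>c\<in>cuspidal_curve.cusps (x' 0) t0. sgn (x'' 0 c * y' 0 c)) = (\<Sum>c\<in>cuspidal_curve.cusps (x' 1) t1. sgn (x'' 1 c * y' 1 c))"
    (is "?S0 = ?S1")
proof -
  obtain M where M: "M > 0" "\<And>s t. s \<in> {0..1} \<Longrightarrow> \<bar>x' s t\<bar> \<le> M" "\<And>s t. s \<in> {0..1} \<Longrightarrow> \<bar>y' s t\<bar> \<le> M"
    by (rule velocity_uniformly_bounded, rule that)
  obtain k0 where k0: "k0 > 0" "\<And>\<kappa> p. 0 < \<kappa> \<Longrightarrow> \<kappa> < k0 \<Longrightarrow> \<bar>p\<bar> = 1 \<Longrightarrow>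
      edge_integral (x' 0) (\<lambda>_. p) (\<lambda>a. \<kappa> * y' 0 a) t0 = p / 2 * ?S0"
    by (rule cuspidal_curve.edge_integral_velocity[OF c0], rule that)
  obtain k1 where k1: "k1 > 0" "\<And>\<kappa> p. 0 < \<kappa> \<Longrightarrow> \<kappa> < k1 \<Longrightarrow> \<bar>p\<bar> = 1 \<Longrightarrow>
      edge_integral (x' 1) (\<lambda>_. p) (\<lambda>a. \<kappa> * y' 1 a) t1 = p / 2 * ?S1"
    by (rule cuspidal_curve.edge_integral_velocity[OF c1], rule that)
  \<comment> \<open>One \<kappa> has to serve the whole isotopy (1 / M) and both end curves; halving
    makes the inequalities strict.\<close>
  define \<kappa> where "\<kappa> = min (1 / M) (min k0 k1) / 2"
  have k: "\<kappa> > 0" "\<kappa> < k0" "\<kappa> < k1" "\<kappa> \<le> 1 / M"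
  proof -
    have "0 < min (1 / M) (min k0 k1)" using M(1) k0(1) k1(1) by simp
    moreover have "m / 2 < m \<and> 0 < m / 2" if "0 < m" for m :: real using that by simp
    ultimately have "0 < \<kappa>" "\<kappa> < min (1 / M) (min k0 k1)"
      unfolding \<kappa>_def by blast+
    then show "\<kappa> > 0" "\<kappa> < k0" "\<kappa> < k1" "\<kappa> \<le> 1 / M" by auto
  qed
  \<comment> \<open>The sum with -1 has the shape expected by \<open>C2_fam_affine\<close>.\<close>
  define X Y W where "X = (\<lambda>(s::real) (a::real) (d::real). x' s a)" and "Y = (\<lambda>(s::real) (a::real) (d::real). 2 * d + (-1))"
    and "W = (\<lambda>(s::real) (a::real) (d::real). \<kappa> * y' s a)"
  have fam: "C2_fam X" "C2_fam Y" "C2_fam W"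
    unfolding X_def Y_def W_def
    by (intro C2_curve_start C2_fam_affine C2_fam_mult C2_fam_const C2)+
  \<comment> \<open>The velocities in the xy-plane never vanish, so this band avoids the y-axis
    throughout, and fronts may have crossings.\<close>
  have nz: "X s a d \<noteq> 0 \<or> W s a d \<noteq> 0" if "s \<in> {0..1}" for s a d
    using immersed[OF that, of a] k(1) by (auto simp: X_def W_def)
  have bd: "\<bar>X s a d\<bar> \<ge> \<bar>W s a d\<bar> \<or> \<bar>Y s a d\<bar> \<ge> \<bar>W s a d\<bar>" if "s \<in> {0..1}" "d = 0 \<or> d = 1" for s a d
  proof -
    have "\<kappa> * \<bar>y' s a\<bar> \<le> 1 / M * M"
      by (intro mult_mono M that k) (use k M in auto)
    then show ?thesis using that(2) k(1) M(1) by (auto simp: Y_def W_def abs_mult)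
  qed
  have inv: "edge_integral (\<lambda>a. X 0 a 1) (\<lambda>a. Y 0 a 1) (\<lambda>a. W 0 a 1) 0
      - edge_integral (\<lambda>a. X 0 a 0) (\<lambda>a. Y 0 a 0) (\<lambda>a. W 0 a 0) 0
    = edge_integral (\<lambda>a. X 1 a 1) (\<lambda>a. Y 1 a 1) (\<lambda>a. W 1 a 1) 0
      - edge_integral (\<lambda>a. X 1 a 0) (\<lambda>a. Y 1 a 0) (\<lambda>a. W 1 a 0) 0"
    by (rule edge_integral_invariant[OF fam]) (use nz bd in auto)
  have sh: "edge_integral (\<lambda>a. X s a d) (\<lambda>a. Y s a d) (\<lambda>a. W s a d) 0
      = edge_integral (\<lambda>a. X s a d) (\<lambda>a. Y s a d) (\<lambda>a. W s a d) t" if "s \<in> {0..1}" for s d t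
    by (rule edge_integral_shift[OF fam that nz[OF that], symmetric])
  have "edge_integral (\<lambda>a. X 0 a 1) (\<lambda>a. Y 0 a 1) (\<lambda>a. W 0 a 1) t0 = ?S0 / 2"
    "edge_integral (\<lambda>a. X 0 a 0) (\<lambda>a. Y 0 a 0) (\<lambda>a. W 0 a 0) t0 = - ?S0 / 2"
    "edge_integral (\<lambda>a. X 1 a 1) (\<lambda>a. Y 1 a 1) (\<lambda>a. W 1 a 1) t1 = ?S1 / 2"
    "edge_integral (\<lambda>a. X 1 a 0) (\<lambda>a. Y 1 a 0) (\<lambda>a. W 1 a 0) t1 = - ?S1 / 2"
    unfolding X_def Y_def W_def using k0(2)[OF k(1,2), of 1] k0(2)[OF k(1,2), of "-1"]
      k1(2)[OF k(1,3), of 1] k1(2)[OF k(1,3), of "-1"] by simp_all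
  then show ?thesis
    using inv sh[of 0 _ t0] sh[of 1 _ t1] by simp
qed

lemma thurston_bennequin_invariant:
  assumes c0: "cuspidal_curve (x 0) (y 0) (z 0) (x' 0) (y' 0) (x'' 0) (y'' 0) t0" "front_embedded 0"
    and c1: "cuspidal_curve (x 1) (y 1) (z 1) (x' 1) (y' 1) (x'' 1) (y'' 1) t1" "front_embedded 1"
  shows "card (cuspidal_curve.cusps (x' 0) t0) = card (cuspidal_curve.cusps (x' 1) t1)" (is "?S0 = ?S1")
proof -
  define X Y W where "X = (\<lambda>s a d. x s (a + d) - x s a)" and "Y = (\<lambda>s a d. y s (a + d) - y s a)"
    and "W = (\<lambda>s a d. chord_area s a (a + d))"
  obtain \<delta>0 where \<delta>0: "\<delta>0 > 0"
    "\<And>d. 0 < d \<Longrightarrow> d < \<delta>0 \<Longrightarrow> edge_integral (\<lambda>a. X 0 a d) (\<lambda>a. Y 0 a d) (\<lambda>a. W 0 a d) t0 = real ?S0 / 2"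
    "\<And>d. 0 < d \<Longrightarrow> d < \<delta>0 \<Longrightarrow> edge_integral (\<lambda>a. X 0 a (1 - d)) (\<lambda>a. Y 0 a (1 - d)) (\<lambda>a. W 0 a (1 - d)) (t0 + d) = - real ?S0 / 2"
    by (rule cuspidal_curve.edge_integral_chord[OF c0(1)], rule that) (simp_all add: X_def Y_def W_def area_eq)
  obtain \<delta>1 where \<delta>1: "\<delta>1 > 0"
    "\<And>d. 0 < d \<Longrightarrow> d < \<delta>1 \<Longrightarrow> edge_integral (\<lambda>a. X 1 a d) (\<lambda>a. Y 1 a d) (\<lambda>a. W 1 a d) t1 = real ?S1 / 2"
    "\<And>d. 0 < d \<Longrightarrow> d < \<delta>1 \<Longrightarrow> edge_integral (\<lambda>a. X 1 a (1 - d)) (\<lambda>a. Y 1 a (1 - d)) (\<lambda>a. W 1 a (1 - d)) (t1 + d) = - real ?S1 / 2"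
    by (rule cuspidal_curve.edge_integral_chord[OF c1(1)], rule that) (simp_all add: X_def Y_def W_def area_eq)
  obtain \<delta>2 where \<delta>2: "\<delta>2 > 0" "\<And>s a d. s \<in> {0..1} \<Longrightarrow> 0 < d \<Longrightarrow> d < \<delta>2 \<Longrightarrow> \<bar>X s a d\<bar> \<ge> \<bar>W s a d\<bar> \<or> \<bar>Y s a d\<bar> \<ge> \<bar>W s a d\<bar>"
    by (rule short_chord, rule that) (simp_all add: X_def Y_def W_def)
  \<comment> \<open>The entry 1/2 guarantees d < 1 - d; halving again gives strict
    inequalities.\<close>
  define d where "d = min (1 / 2) (min \<delta>0 (min \<delta>1 \<delta>2)) / 2"
  have d: "0 < d" "d < 1 / 2" "d < \<delta>0" "d < \<delta>1" "d < \<delta>2"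
    using \<delta>0(1) \<delta>1(1) \<delta>2(1) by (auto simp: d_def min_def)
  have W_eq: "W = (\<lambda>s a d. (z s (a + d) - z s a) - (1 / 2 * (y s a + y s (a + d))) * (x s (a + d) - x s a))"
    by (simp add: W_def chord_area_def fun_eq_iff)
  have fam: "C2_fam X" "C2_fam Y" "C2_fam W"
    unfolding X_def Y_def W_eq
    by (intro C2_fam_diff C2_fam_mult C2_fam_add C2_fam_const C2_curve_start C2_curve_end C2)+
  have not_int: "a + e - a \<notin> \<int>" if "0 < e" "e < 1" for a e :: real
  proof
    assume "a + e - a \<in> \<int>"
    then obtain n :: int where "e = of_int n" by (auto elim: Ints_cases)
    then show False using that by simp
  qed
  \<comment> \<open>If \<open>X\<close> vanishes then \<open>W\<close> is the increment of z, so the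
    vanishing of all three would be a double point of the knot.\<close>
  have nz: "X s a e \<noteq> 0 \<or> Y s a e \<noteq> 0 \<or> W s a e \<noteq> 0" if "s \<in> {0..1}" "0 < e" "e < 1" for s a e
    using embedded[OF that(1), of "a + e" a] not_int[OF that(2,3), of a] by (auto simp: X_def Y_def W_def chord_area_def)
  have nz': "X s a e \<noteq> 0 \<or> W s a e \<noteq> 0" if "front_embedded s" "0 < e" "e < 1" for s a e
    using that(1)[unfolded front_embedded_def, rule_format, of "a + e" a] not_int[OF that(2,3), of a]
    by (auto simp: X_def W_def chord_area_def)
  have bd: "\<bar>X s a e\<bar> \<ge> \<bar>W s a e\<bar> \<or> \<bar>Y s a e\<bar> \<ge> \<bar>W s a e\<bar>" if s: "s \<in> {0..1}" and e: "e = d \<or> e = 1 - d" for s a e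
    using e
  proof
    assume "e = 1 - d"
    then show ?thesis
      using \<delta>2(2)[OF s d(1,5), of "a - d"] legendrian_curve.chord_reflect[OF curve[OF s], of a d]
      by (simp add: X_def Y_def W_def area_eq[OF s] abs_minus_commute)
  qed (use \<delta>2(2)[OF s d(1,5)] in simp)
  have inv: "edge_integral (\<lambda>a. X 0 a (1 - d)) (\<lambda>a. Y 0 a (1 - d)) (\<lambda>a. W 0 a (1 - d)) 0
      - edge_integral (\<lambda>a. X 0 a d) (\<lambda>a. Y 0 a d) (\<lambda>a. W 0 a d) 0
    = edge_integral (\<lambda>a. X 1 a (1 - d)) (\<lambda>a. Y 1 a (1 - d)) (\<lambda>a. W 1 a (1 - d)) 0
      - edge_integral (\<lambda>a. X 1 a d) (\<lambda>a. Y 1 a d) (\<lambda>a. W 1 a d) 0"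
    by (rule edge_integral_invariant[OF fam]) (use nz nz' bd d c0(2) c1(2) in auto)
  have sh: "edge_integral (\<lambda>a. X s a e) (\<lambda>a. Y s a e) (\<lambda>a. W s a e) 0
      = edge_integral (\<lambda>a. X s a e) (\<lambda>a. Y s a e) (\<lambda>a. W s a e) t"
    if "s \<in> {0..1}" "front_embedded s" "0 < e" "e < 1" for s e t
    by (rule edge_integral_shift[OF fam that(1) nz'[OF that(2-4)], symmetric])
  \<comment> \<open>Long edge minus short edge, for each of the two end knots.\<close>
  have "- real ?S0 / 2 - real ?S0 / 2 = - real ?S1 / 2 - real ?S1 / 2"
    using inv sh[OF _ c0(2), of d t0] sh[OF _ c0(2), of "1 - d" "t0 + d"] sh[OF _ c1(2), of d t1] sh[OF _ c1(2), of "1 - d" "t1 + d"]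
      \<delta>0(2,3)[OF d(1,3)] \<delta>1(2,3)[OF d(1,4)] d by simp
  then show ?thesis by simp
qed

theorem cusp_counts_invariant:
  assumes c0: "cuspidal_curve (x 0) (y 0) (z 0) (x' 0) (y' 0) (x'' 0) (y'' 0) t0" "front_embedded 0"
    and c1: "cuspidal_curve (x 1) (y 1) (z 1) (x' 1) (y' 1) (x'' 1) (y'' 1) t1" "front_embedded 1"
  shows "card (cuspidal_curve.ups (x' 0) (y' 0) (x'' 0) t0) = card (cuspidal_curve.ups (x' 1) (y' 1) (x'' 1) t1)"
    "card (cuspidal_curve.downs (x' 0) (y' 0) (x'' 0) t0) = card (cuspidal_curve.downs (x' 1) (y' 1) (x'' 1) t1)"
  using thurston_bennequin_invariant[OF assms] rotation_invariant[OF c0(1) c1(1)]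
  unfolding cuspidal_curve.card_cusps[OF c0(1)] cuspidal_curve.card_cusps[OF c1(1)]
    cuspidal_curve.sum_sgn_cusps[OF c0(1)] cuspidal_curve.sum_sgn_cusps[OF c1(1)]
  by linarith+

end

section \<open>Knots and their fronts\<close>

context legendrian_curve
begin

text \<open>The definitions of up and down cusps quantify over pairs with equal x on the two
  branches. Such pairs must exist arbitrarily close to the cusp, or both definitions would hold
  vacuously.\<close>

lemma nice_fold:
  assumes n: "nice c r" and c: "x' c = 0" "x'' c \<noteq> 0" and "0 < \<rho>" "\<rho> \<le> r"
  obtains a b where "c - \<rho> < a" "a < c" "c < b" "b < c + \<rho>" "x a = x b"
proof -
  \<comment> \<open>With this sign, \<open>X\<close> has a strict minimum at c.\<close>
  define e where "e = sgn (x'' c)"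
  define X where "X t = e * x t" for t
  have ee: "e * e = 1" using c(2) by (simp add: e_def sgn_if)
  have D: "(X has_real_derivative e * x' t) (at t)" for t
    unfolding X_def by (intro DERIV_cmult DERIV_x)
  have sg: "sgn (e * x' t) = sgn (t - c)" if "t \<in> {c - r..c + r}" for t
    using nice_sgn_x'[OF n that c(1)] ee by (simp add: sgn_mult e_def mult.assoc[symmetric])
  define h where "h = \<rho> / 2"
  have h: "0 < h" "h < \<rho>" "h < r" using assms by (auto simp: h_def)
  have left: "X c < X (c - h)"
  proof (rule DERIV_neg_imp_decreasing_open[of "c - h" c X])
    show "\<exists>y. (X has_real_derivative y) (at t) \<and> y < 0" if "c - h < t" "t < c" for t
    proof -
      have "t \<in> {c - r..c + r}" using that h by auto
      from sg[OF this] have "sgn (e * x' t) < 0" using that by (simp only:) simp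
      then show ?thesis using D[of t] by (intro exI[of _ "e * x' t"]) (simp only: sgn_less simp_thms)
    qed
    show "continuous_on {c - h..c} X"
      using D by (meson DERIV_continuous_on has_field_derivative_at_within)
  qed (use h in auto)
  have right: "X c < X (c + h)"
  proof (rule DERIV_pos_imp_increasing_open[of c "c + h" X])
    show "\<exists>y. (X has_real_derivative y) (at t) \<and> 0 < y" if "c < t" "t < c + h" for t
    proof -
      have "t \<in> {c - r..c + r}" using that h by auto
      from sg[OF this] have "sgn (e * x' t) > 0" using that by (simp only:) simp
      then show ?thesis using D[of t] by (intro exI[of _ "e * x' t"]) (simp only: sgn_greater simp_thms)
    qed
    show "continuous_on {c..c + h} X"
      using D by (meson DERIV_continuous_on has_field_derivative_at_within)
  qed (use h in auto)
  \<comment> \<open>A level reached on both branches, above the value at the cusp.\<close>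
  define v where "v = min (X (c - h)) (X (c + h))"
  have v: "X c < v" "v \<le> X (c - h)" "v \<le> X (c + h)" using left right by (auto simp: v_def)
  have cX: "\<forall>t. A \<le> t \<and> t \<le> B \<longrightarrow> isCont X t" for A B using D DERIV_isCont by blast
  obtain a where a: "c - h \<le> a" "a \<le> c" "X a = v"
    using IVT2[of X c v "c - h"] v h cX by auto
  obtain b where b: "c \<le> b" "b \<le> c + h" "X b = v"
    using IVT[of X c v "c + h"] v h cX by auto
  have "a \<noteq> c" "b \<noteq> c" using a b v by auto
  moreover have "x a = x b"
    using a(3) b(3) ee by (auto simp: X_def)
  ultimately show ?thesis
    using a b h by (intro that[of a b]) auto
qed

text \<open>On a chord with equal x the correction term of \<open>area\<close> vanishes, so the area
  is the difference of the z-values.\<close>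

lemma branch_order:
  assumes n: "nice c r"
    and ab: "a \<in> {c - r<..<c}" "b \<in> {c<..<c + r}" "x a = x b"
  shows "sgn (z b - z a) = sgn (x'' c * y' c)"
  using nice_sgn_area[OF n, of a b] ab by (simp add: area_def)

lemma up_iff:
  assumes c: "x' c = 0" "y' c * x'' c \<noteq> 0"
  shows "(\<exists>\<epsilon>>0. \<forall>a\<in>{c - \<epsilon><..<c}. \<forall>b\<in>{c<..<c + \<epsilon>}. x a = x b \<longrightarrow> z a < z b) \<longleftrightarrow> x'' c * y' c > 0" (is ?up)
    and "(\<exists>\<epsilon>>0. \<forall>a\<in>{c - \<epsilon><..<c}. \<forall>b\<in>{c<..<c + \<epsilon>}. x a = x b \<longrightarrow> z a > z b) \<longleftrightarrow> x'' c * y' c < 0" (is ?down)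
proof -
  have "\<exists>r>0. nice c r"
    using eventually_happens'[OF trivial_limit_at_right_real eventually_conj[OF eventually_nice[OF c] eventually_at_right_less[of 0]]]
    by blast
  then obtain r where r: "r > 0" "nice c r" by blast
  have fold: "\<exists>a\<in>{c - \<epsilon><..<c}. \<exists>b\<in>{c<..<c + \<epsilon>}. x a = x b \<and> sgn (z b - z a) = sgn (x'' c * y' c)" if e: "\<epsilon> > 0" for \<epsilon>
  proof -
    obtain a b where ab: "c - min \<epsilon> r < a" "a < c" "c < b" "b < c + min \<epsilon> r" "x a = x b"
      by (rule nice_fold[OF r(2) c(1), of "min \<epsilon> r"]) (use c(2) r(1) e in auto)
    have "sgn (z b - z a) = sgn (x'' c * y' c)"
      by (rule branch_order[OF r(2)]) (use ab in auto)
    then show ?thesis using ab by (intro bexI[of _ a] bexI[of _ b]) auto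
  qed
  have pos: "sgn u > 0 \<longleftrightarrow> u > 0" "sgn u < 0 \<longleftrightarrow> u < 0" for u :: real
    by auto
  show ?up
  proof
    assume "\<exists>\<epsilon>>0. \<forall>a\<in>{c - \<epsilon><..<c}. \<forall>b\<in>{c<..<c + \<epsilon>}. x a = x b \<longrightarrow> z a < z b"
    then obtain \<epsilon> where "\<epsilon> > 0" and e: "\<And>a b. a \<in> {c - \<epsilon><..<c} \<Longrightarrow> b \<in> {c<..<c + \<epsilon>} \<Longrightarrow> x a = x b \<Longrightarrow> z a < z b"
      by blast
    from fold[OF this(1)] obtain a b where "x a = x b" "sgn (z b - z a) = sgn (x'' c * y' c)" "z a < z b"
      using e by blast
    then show "x'' c * y' c > 0" by (metis pos(1) diff_gt_0_iff_gt)
  next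
    assume p: "x'' c * y' c > 0"
    have "z a < z b" if "a \<in> {c - r<..<c}" "b \<in> {c<..<c + r}" "x a = x b" for a b
      using branch_order[OF r(2) that] p by (metis pos(1) diff_gt_0_iff_gt)
    with r(1) show "\<exists>\<epsilon>>0. \<forall>a\<in>{c - \<epsilon><..<c}. \<forall>b\<in>{c<..<c + \<epsilon>}. x a = x b \<longrightarrow> z a < z b"
      by blast
  qed
  show ?down
  proof
    assume "\<exists>\<epsilon>>0. \<forall>a\<in>{c - \<epsilon><..<c}. \<forall>b\<in>{c<..<c + \<epsilon>}. x a = x b \<longrightarrow> z a > z b"
    then obtain \<epsilon> where "\<epsilon> > 0" and e: "\<And>a b. a \<in> {c - \<epsilon><..<c} \<Longrightarrow> b \<in> {c<..<c + \<epsilon>} \<Longrightarrow> x a = x b \<Longrightarrow> z a > z b"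
      by blast
    from fold[OF this(1)] obtain a b where "x a = x b" "sgn (z b - z a) = sgn (x'' c * y' c)" "z a > z b"
      using e by blast
    then show "x'' c * y' c < 0" by (metis pos(2) diff_less_0_iff_less)
  next
    assume p: "x'' c * y' c < 0"
    have "z a > z b" if "a \<in> {c - r<..<c}" "b \<in> {c<..<c + r}" "x a = x b" for a b
      using branch_order[OF r(2) that] p by (metis pos(2) diff_less_0_iff_less)
    with r(1) show "\<exists>\<epsilon>>0. \<forall>a\<in>{c - \<epsilon><..<c}. \<forall>b\<in>{c<..<c + \<epsilon>}. x a = x b \<longrightarrow> z a > z b"
      by blast
  qed
qed

end

section \<open>Coordinate functions of a parametrised knot\<close>

definition velocity :: "(real \<Rightarrow> 'a::real_normed_vector) \<Rightarrow> real \<Rightarrow> 'a" where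
  "velocity \<gamma> t = vector_derivative \<gamma> (at t)"

abbreviation acceleration :: "(real \<Rightarrow> 'a::real_normed_vector) \<Rightarrow> real \<Rightarrow> 'a" where
  "acceleration \<gamma> \<equiv> velocity (velocity \<gamma>)"

lemma smooth_velocity:
  fixes \<gamma> :: "real \<Rightarrow> 'a::real_normed_vector"
  assumes "\<And>k. Ck_on k UNIV \<gamma>"
  shows "(\<gamma> has_vector_derivative velocity \<gamma> t) (at t)" "Ck_on k UNIV (velocity \<gamma>)"
proof -
  have d: "\<gamma> differentiable at t" for t
    using assms[of "Suc 0"] by simp
  show D: "(\<gamma> has_vector_derivative velocity \<gamma> t) (at t)" for t
    unfolding velocity_def using d vector_derivative_works by blast
  have "frechet_derivative \<gamma> (at t) 1 = velocity \<gamma> t" for t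
    using frechet_derivative_at[OF D[of t, unfolded has_vector_derivative_def]] by (metis scaleR_one)
  then have "velocity \<gamma> = (\<lambda>t. frechet_derivative \<gamma> (at t) 1)" by auto
  then show "Ck_on k UNIV (velocity \<gamma>)"
    using Ck_on_derivs(3)[OF assms] by simp
qed

lemma has_vector_derivative_vec_nth:
  "(\<gamma> has_vector_derivative v) (at t) \<Longrightarrow> ((\<lambda>t. \<gamma> t $ i) has_real_derivative v $ i) (at t)"
  for \<gamma> :: "real \<Rightarrow> real ^ 'n"
  unfolding has_real_derivative_iff_has_vector_derivative
  by (rule bounded_linear.has_vector_derivative[OF bounded_linear_vec_nth])

lemma velocity_eqI: "(\<gamma> has_vector_derivative v) (at t) \<Longrightarrow> velocity \<gamma> t = v"
  unfolding velocity_def by (rule vector_derivative_at)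

lemma knot_smooth: "legendrian_knot \<gamma> \<Longrightarrow> Ck_on k UNIV \<gamma>"
  by (simp add: legendrian_knot_def smooth_on_open_def)

lemma knot_periodic:
  assumes "legendrian_knot \<gamma>"
  shows "\<gamma> (t + 1) = \<gamma> t" "velocity \<gamma> (t + 1) = velocity \<gamma> t"
proof -
  show p: "\<gamma> (t + 1) = \<gamma> t" for t
    using assms by (simp add: legendrian_knot_def)
  have "((\<lambda>u. u + 1) has_vector_derivative 1) (at t)"
    by (auto intro!: derivative_eq_intros simp flip: has_real_derivative_iff_has_vector_derivative)
  from vector_diff_chain_at[OF this smooth_velocity(1)[OF knot_smooth[OF assms]]]
  have "(\<gamma> has_vector_derivative velocity \<gamma> (t + 1)) (at t)"
    by (simp add: o_def p)
  then show "velocity \<gamma> (t + 1) = velocity \<gamma> t"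
    by (rule velocity_eqI[symmetric])
qed

text \<open>In the contact plane the z-component of the velocity is determined by the x-component,
  so an immersed Legendrian curve is immersed already in the xy-plane.\<close>

lemma knot_contact:
  assumes "legendrian_knot \<gamma>"
  shows "velocity \<gamma> t $ 3 = \<gamma> t $ 2 * velocity \<gamma> t $ 1" "velocity \<gamma> t $ 1 \<noteq> 0 \<or> velocity \<gamma> t $ 2 \<noteq> 0"
proof -
  show c: "velocity \<gamma> t $ 3 = \<gamma> t $ 2 * velocity \<gamma> t $ 1"
    using assms by (simp add: legendrian_knot_def velocity_def xi_std_def)
  have "velocity \<gamma> t \<noteq> 0"
    using assms by (simp add: legendrian_knot_def velocity_def)
  then show "velocity \<gamma> t $ 1 \<noteq> 0 \<or> velocity \<gamma> t $ 2 \<noteq> 0"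
    using c by (auto simp: vec_eq_iff forall_3)
qed

text \<open>The locale predicate is a parameter so that one list of coordinates serves both
  \<open>legendrian_curve\<close> and \<open>cuspidal_curve\<close>.\<close>

abbreviation knot_curve where
  "knot_curve L \<gamma> \<equiv> L (\<lambda>t. \<gamma> t $ 1) (\<lambda>t. \<gamma> t $ 2) (\<lambda>t. \<gamma> t $ 3) (\<lambda>t. velocity \<gamma> t $ 1) (\<lambda>t. velocity \<gamma> t $ 2)
     (\<lambda>t. acceleration \<gamma> t $ 1) (\<lambda>t. acceleration \<gamma> t $ 2)"

lemma legendrian_curve_knot:
  fixes \<gamma> :: "real \<Rightarrow> real ^ 3"
  assumes k: "legendrian_knot \<gamma>"
  shows "knot_curve legendrian_curve \<gamma>"
proof -
  note sm = knot_smooth[OF k]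
  note v = smooth_velocity[OF sm] and a = smooth_velocity[OF smooth_velocity(2)[OF sm]]
  have c: "continuous_on UNIV (\<lambda>t. acceleration \<gamma> t $ i)" for i
    using Ck_on_derivs(1)[OF a(2)] by (intro continuous_intros)
  show ?thesis
    by unfold_locales
      (use has_vector_derivative_vec_nth[OF v(1)] has_vector_derivative_vec_nth[OF a(1)] knot_contact(1)[OF k]
        knot_periodic[OF k] c in \<open>simp_all flip: knot_contact(1)[OF k]\<close>)
qed

text \<open>Carries the finiteness of the cusps from the period starting at 0 to any other
  period.\<close>

lemma inj_on_frac: "inj_on frac {t..<t + 1::real}"
proof (rule inj_onI)
  fix u v :: real assume uv: "u \<in> {t..<t + 1}" "v \<in> {t..<t + 1}" "frac u = frac v"
  then have "u - v = of_int (\<lfloor>u\<rfloor> - \<lfloor>v\<rfloor>)" by (simp add: frac_def)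
  moreover from this uv have "\<bar>\<lfloor>u\<rfloor> - \<lfloor>v\<rfloor>\<bar> < 1" by auto
  ultimately show "u = v" by auto
qed

definition flat_front :: "(real \<Rightarrow> real ^ 3) \<Rightarrow> bool" where
  "flat_front \<gamma> \<longleftrightarrow> (\<forall>a b. \<gamma> a $ 1 = \<gamma> b $ 1 \<longrightarrow> \<gamma> a $ 3 = \<gamma> b $ 3 \<longrightarrow> a - b \<in> \<int>)"

definition up_params :: "(real \<Rightarrow> real ^ 3) \<Rightarrow> real \<Rightarrow> real set" where
  "up_params \<gamma> t0 = {t \<in> {t0..<t0 + 1}. velocity \<gamma> t $ 1 = 0 \<and> acceleration \<gamma> t $ 1 * velocity \<gamma> t $ 2 > 0}"

definition down_params :: "(real \<Rightarrow> real ^ 3) \<Rightarrow> real \<Rightarrow> real set" where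
  "down_params \<gamma> t0 = {t \<in> {t0..<t0 + 1}. velocity \<gamma> t $ 1 = 0 \<and> acceleration \<gamma> t $ 1 * velocity \<gamma> t $ 2 < 0}"

lemma legendrian_U_params:
  assumes U: "legendrian_U m n \<gamma>"
  obtains t0 where "knot_curve cuspidal_curve \<gamma> t0" "flat_front \<gamma>"
    "card (up_params \<gamma> t0) = m" "card (down_params \<gamma> t0) = n"
proof -
  have k: "legendrian_knot \<gamma>" and f: "front_without_crossings \<gamma>"
    using U by (auto simp: legendrian_U_def)
  interpret legendrian_curve "\<lambda>t. \<gamma> t $ 1" "\<lambda>t. \<gamma> t $ 2" "\<lambda>t. \<gamma> t $ 3" "\<lambda>t. velocity \<gamma> t $ 1"
    "\<lambda>t. velocity \<gamma> t $ 2" "\<lambda>t. acceleration \<gamma> t $ 1" "\<lambda>t. acceleration \<gamma> t $ 2" by (rule legendrian_curve_knot[OF k])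
  note sm = knot_smooth[OF k]
  note a = smooth_velocity[OF smooth_velocity(2)[OF smooth_velocity(2)[OF sm]]]
  have DERIV_x'': "((\<lambda>t. acceleration \<gamma> t $ 1) has_real_derivative velocity (acceleration \<gamma>) t $ 1) (at t)" for t
    by (rule has_vector_derivative_vec_nth[OF a(1)])
  have dx: "deriv (\<lambda>u. \<gamma> u $ 1) = (\<lambda>t. velocity \<gamma> t $ 1)" "deriv (\<lambda>t. velocity \<gamma> t $ 1) = (\<lambda>t. acceleration \<gamma> t $ 1)"
    "deriv (\<lambda>t. acceleration \<gamma> t $ 1) = (\<lambda>t. velocity (acceleration \<gamma>) t $ 1)"
    using DERIV_imp_deriv[OF DERIV_x] DERIV_imp_deriv[OF DERIV_x'] DERIV_imp_deriv[OF DERIV_x''] by auto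
  have dz1: "deriv (\<lambda>u. \<gamma> u $ 3) = (\<lambda>t. \<gamma> t $ 2 * velocity \<gamma> t $ 1)"
    using DERIV_imp_deriv[OF DERIV_z] by auto
  have dz2: "deriv (\<lambda>t. \<gamma> t $ 2 * velocity \<gamma> t $ 1)
      = (\<lambda>t. velocity \<gamma> t $ 2 * velocity \<gamma> t $ 1 + acceleration \<gamma> t $ 1 * \<gamma> t $ 2)"
    using DERIV_imp_deriv[OF DERIV_mult[OF DERIV_y DERIV_x']] by auto
  have dz3: "deriv (\<lambda>t. velocity \<gamma> t $ 2 * velocity \<gamma> t $ 1 + acceleration \<gamma> t $ 1 * \<gamma> t $ 2)
      = (\<lambda>t. acceleration \<gamma> t $ 2 * velocity \<gamma> t $ 1 + acceleration \<gamma> t $ 1 * velocity \<gamma> t $ 2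
          + (velocity (acceleration \<gamma>) t $ 1 * \<gamma> t $ 2 + velocity \<gamma> t $ 2 * acceleration \<gamma> t $ 1))"
    using DERIV_imp_deriv[OF DERIV_add[OF DERIV_mult[OF DERIV_y' DERIV_x'] DERIV_mult[OF DERIV_x'' DERIV_y]]] by auto
  have deriv_pow: "(deriv ^^ 2) f = deriv (deriv f)" "(deriv ^^ 3) f = deriv (deriv (deriv f))" for f :: "real \<Rightarrow> real"
    by (simp_all add: numeral_2_eq_2 numeral_3_eq_3)
  \<comment> \<open>Where x' = 0, the determinant of second and third derivatives of (x, z) is 2
    x''^2 y', because z' = y x'.\<close>
  have cusp_eq: "cusp (front \<gamma>) t \<longleftrightarrow> velocity \<gamma> t $ 1 = 0 \<and> velocity \<gamma> t $ 2 * acceleration \<gamma> t $ 1 \<noteq> 0" for t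
    unfolding cusp_def front_def Let_def fst_conv snd_conv deriv_pow dx dz1 dz2 dz3
    by (auto simp: algebra_simps)
  have cusp_iff: "cusp (front \<gamma>) t \<longleftrightarrow> velocity \<gamma> t $ 1 = 0" for t
  proof
    assume "velocity \<gamma> t $ 1 = 0"
    then show "cusp (front \<gamma>) t"
      using f unfolding front_without_crossings_def front_def fst_conv dx by blast
  qed (simp add: cusp_eq)
  have up: "up_cusp (front \<gamma>) t \<longleftrightarrow> velocity \<gamma> t $ 1 = 0 \<and> acceleration \<gamma> t $ 1 * velocity \<gamma> t $ 2 > 0"
    and down: "down_cusp (front \<gamma>) t \<longleftrightarrow> velocity \<gamma> t $ 1 = 0 \<and> acceleration \<gamma> t $ 1 * velocity \<gamma> t $ 2 < 0" for t
    unfolding up_cusp_def down_cusp_def cusp_iff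
    using up_iff[of t] cusp_iff[of t] cusp_eq[of t] by (auto simp: front_def)
  obtain t0 where t0: "\<not> cusp (front \<gamma>) t0" "card {t \<in> {t0..<t0 + 1}. up_cusp (front \<gamma>) t} = m"
    "card {t \<in> {t0..<t0 + 1}. down_cusp (front \<gamma>) t} = n"
    using U by (auto simp: legendrian_U_def Let_def)
  have "finite {t \<in> {t0..<t0 + 1}. velocity \<gamma> t $ 1 = 0}"
  proof (rule inj_on_finite[of frac])
    show "inj_on frac {t \<in> {t0..<t0 + 1}. velocity \<gamma> t $ 1 = 0}"
      using inj_on_frac by (rule inj_on_subset) auto
    show "frac ` {t \<in> {t0..<t0 + 1}. velocity \<gamma> t $ 1 = 0} \<subseteq> {t \<in> {0..<1}. cusp (front \<gamma>) t}"
      using periodic_frac[of "velocity \<gamma>"] knot_periodic(2)[OF k] frac_lt_1 frac_ge_0 by (auto simp: cusp_iff)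
    show "finite {t \<in> {0..<1}. cusp (front \<gamma>) t}"
      using f by (simp add: front_without_crossings_def)
  qed
  then have "knot_curve cuspidal_curve \<gamma> t0"
    using t0(1) cusp_iff cusp_eq by unfold_locales auto
  moreover have "flat_front \<gamma>"
    using f by (auto simp: front_without_crossings_def front_def flat_front_def)
  ultimately show ?thesis
    using t0(2,3) that unfolding up down up_params_def[symmetric] down_params_def[symmetric] by blast
qed

section \<open>Change of parameter\<close>

lemma reparam_bij:
  assumes p: "oriented_reparam \<phi>"
  obtains \<phi>' where "\<And>t. (\<phi> has_vector_derivative \<phi>' t) (at t)" "\<And>t. \<phi>' t > 0" "\<And>t. (\<phi>' has_vector_derivative velocity \<phi>' t) (at t)"
    "strict_mono \<phi>" "\<And>t0. \<exists>t1. \<phi> t1 = t0" "\<And>a b. \<phi> a - \<phi> b \<in> \<int> \<Longrightarrow> a - b \<in> \<int>"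
    "\<And>t. \<phi> (t + 1) = \<phi> t + 1"
proof -
  have sm: "Ck_on k UNIV \<phi>" and p1: "\<phi> (t + 1) = \<phi> t + 1" and pos: "deriv \<phi> t > 0" for k t
    using p by (auto simp: oriented_reparam_def smooth_on_open_def)
  note v = smooth_velocity[OF sm] and a = smooth_velocity[OF smooth_velocity(2)[OF sm]]
  have "velocity \<phi> t = deriv \<phi> t" for t
    using v(1)[of t] DERIV_imp_deriv by (metis has_real_derivative_iff_has_vector_derivative)
  then have vp: "velocity \<phi> t > 0" for t using pos by simp
  have mono: "strict_mono \<phi>"
  proof (rule strict_monoI)
    fix s t :: real assume "s < t"
    then show "\<phi> s < \<phi> t"
    proof (rule DERIV_pos_imp_increasing)
      show "\<exists>y. (\<phi> has_real_derivative y) (at u) \<and> 0 < y" for u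
        using v(1)[of u] vp[of u] unfolding has_real_derivative_iff_has_vector_derivative by blast
    qed
  qed
  have n: "\<phi> (t + real n) = \<phi> t + real n" for t n
  proof (induction n)
    case (Suc n)
    then show ?case using p1[of "t + real n"] by (simp add: algebra_simps)
  qed simp
  have i: "\<phi> (t + of_int i) = \<phi> t + of_int i" for t i
  proof (cases "i \<ge> 0")
    case True
    then show ?thesis using n[of t "nat i"] by simp
  next
    case False
    then show ?thesis using n[of "t + of_int i" "nat (- i)"] by simp
  qed
  have surj: "\<exists>t1. \<phi> t1 = t0" for t0
  proof -
    \<comment> \<open>On integers \<phi> is translation by \<phi> 0, so t0 lies between the values
      at N and N + 1.\<close>
    define N where "N = \<lfloor>t0 - \<phi> 0\<rfloor>"
    have "of_int N \<le> t0 - \<phi> 0" "t0 - \<phi> 0 \<le> of_int N + 1"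
      unfolding N_def by linarith+
    then have "\<phi> (of_int N) \<le> t0" "t0 \<le> \<phi> (of_int N + 1)"
      using i[of 0 N] p1[of "of_int N"] by simp_all
    moreover have "isCont \<phi> t" for t
      using v(1)[of t] by (simp add: has_vector_derivative_continuous)
    ultimately show ?thesis
      using IVT[of \<phi> "of_int N" t0 "of_int N + 1"] by auto
  qed
  have "a - b \<in> \<int>" if "\<phi> a - \<phi> b \<in> \<int>" for a b
  proof -
    from that obtain m where "\<phi> a - \<phi> b = of_int m" by (rule Ints_cases)
    then have "\<phi> a = \<phi> (b + of_int m)" by (simp add: i)
    then have "a = b + of_int m" using strict_mono_eq[OF mono] by blast
    then show ?thesis by simp
  qed
  then show ?thesis
    using that[of "velocity \<phi>"] v(1) vp a(1) mono surj p1 by blast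
qed

lemma cuspidal_reparam:
  assumes c: "knot_curve cuspidal_curve \<delta> t0" and f: "flat_front \<delta>" and p: "oriented_reparam \<phi>"
    and k: "legendrian_knot \<delta>" "legendrian_knot (\<delta> \<circ> \<phi>)"
  obtains t1 where "knot_curve cuspidal_curve (\<delta> \<circ> \<phi>) t1" "flat_front (\<delta> \<circ> \<phi>)"
    "card (up_params (\<delta> \<circ> \<phi>) t1) = card (up_params \<delta> t0)" "card (down_params (\<delta> \<circ> \<phi>) t1) = card (down_params \<delta> t0)"
proof -
  obtain \<phi>' where phi: "\<And>t. (\<phi> has_vector_derivative \<phi>' t) (at t)" "\<And>t. \<phi>' t > 0" "\<And>t. (\<phi>' has_vector_derivative velocity \<phi>' t) (at t)"
    and mono: "strict_mono \<phi>" and surj: "\<And>t0. \<exists>t1. \<phi> t1 = t0" and int: "\<And>a b. \<phi> a - \<phi> b \<in> \<int> \<Longrightarrow> a - b \<in> \<int>"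
    and p1: "\<And>t. \<phi> (t + 1) = \<phi> t + 1"
    by (rule reparam_bij[OF p], rule that)
  interpret D: cuspidal_curve "\<lambda>t. \<delta> t $ 1" "\<lambda>t. \<delta> t $ 2" "\<lambda>t. \<delta> t $ 3" "\<lambda>t. velocity \<delta> t $ 1" "\<lambda>t. velocity \<delta> t $ 2"
     "\<lambda>t. acceleration \<delta> t $ 1" "\<lambda>t. acceleration \<delta> t $ 2" t0 by (rule c)
  interpret P: legendrian_curve "\<lambda>t. (\<delta> \<circ> \<phi>) t $ 1" "\<lambda>t. (\<delta> \<circ> \<phi>) t $ 2" "\<lambda>t. (\<delta> \<circ> \<phi>) t $ 3" "\<lambda>t. velocity (\<delta> \<circ> \<phi>) t $ 1"
     "\<lambda>t. velocity (\<delta> \<circ> \<phi>) t $ 2" "\<lambda>t. acceleration (\<delta> \<circ> \<phi>) t $ 1" "\<lambda>t. acceleration (\<delta> \<circ> \<phi>) t $ 2"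
    by (rule legendrian_curve_knot[OF k(2)])
  note sm = knot_smooth[OF k(1)]
  note v = smooth_velocity[OF sm] and a = smooth_velocity[OF smooth_velocity(2)[OF sm]]
  have vel: "velocity (\<delta> \<circ> \<phi>) = (\<lambda>t. \<phi>' t *\<^sub>R velocity \<delta> (\<phi> t))"
    by (intro ext velocity_eqI vector_diff_chain_at phi v)
  have acc: "acceleration (\<delta> \<circ> \<phi>) t = \<phi>' t *\<^sub>R (\<phi>' t *\<^sub>R acceleration \<delta> (\<phi> t)) + velocity \<phi>' t *\<^sub>R velocity \<delta> (\<phi> t)" for t
    unfolding vel
    by (intro velocity_eqI has_vector_derivative_scaleR vector_diff_chain_at[of \<phi> _ _ "velocity \<delta>", unfolded o_def] phi a)
      (simp add: phi has_real_derivative_iff_has_vector_derivative)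
  have zero: "velocity (\<delta> \<circ> \<phi>) t $ 1 = 0 \<longleftrightarrow> velocity \<delta> (\<phi> t) $ 1 = 0" for t
    using phi(2)[of t] by (simp add: vel)
  \<comment> \<open>At a cusp the term with the derivative of \<open>\<phi>'\<close> drops out of
    the x-acceleration. What remains is scaled by the positive factor \<open>\<phi>' t ^ 3\<close>,
    so the type of the cusp is kept.\<close>
  have prod: "acceleration (\<delta> \<circ> \<phi>) t $ 1 * velocity (\<delta> \<circ> \<phi>) t $ 2
      = \<phi>' t ^ 3 * (acceleration \<delta> (\<phi> t) $ 1 * velocity \<delta> (\<phi> t) $ 2)" if "velocity \<delta> (\<phi> t) $ 1 = 0" for t
    using that unfolding acc by (simp add: vel power3_eq_cube)
  have sign: "acceleration (\<delta> \<circ> \<phi>) t $ 1 * velocity (\<delta> \<circ> \<phi>) t $ 2 > 0 \<longleftrightarrow> acceleration \<delta> (\<phi> t) $ 1 * velocity \<delta> (\<phi> t) $ 2 > 0"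
    "acceleration (\<delta> \<circ> \<phi>) t $ 1 * velocity (\<delta> \<circ> \<phi>) t $ 2 < 0 \<longleftrightarrow> acceleration \<delta> (\<phi> t) $ 1 * velocity \<delta> (\<phi> t) $ 2 < 0"
    if "velocity \<delta> (\<phi> t) $ 1 = 0" for t
  proof -
    have "\<phi>' t ^ 3 > 0" using phi(2) by simp
    from mult_less_cancel_left_pos[OF this, of 0] mult_less_cancel_left_pos[OF this, of _ 0]
    show "acceleration (\<delta> \<circ> \<phi>) t $ 1 * velocity (\<delta> \<circ> \<phi>) t $ 2 > 0 \<longleftrightarrow> acceleration \<delta> (\<phi> t) $ 1 * velocity \<delta> (\<phi> t) $ 2 > 0"
      "acceleration (\<delta> \<circ> \<phi>) t $ 1 * velocity (\<delta> \<circ> \<phi>) t $ 2 < 0 \<longleftrightarrow> acceleration \<delta> (\<phi> t) $ 1 * velocity \<delta> (\<phi> t) $ 2 < 0"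
      unfolding prod[OF that] by (simp_all only: mult_zero_right)
  qed
  obtain t1 where t1: "\<phi> t1 = t0" using surj by blast
  have img: "\<phi> ` {t \<in> {t1..<t1 + 1}. Q (\<phi> t)} = {t \<in> {t0..<t0 + 1}. Q t}" for Q
  proof (intro equalityI subsetI)
    fix u assume "u \<in> {t \<in> {t0..<t0 + 1}. Q t}"
    then have u: "t0 \<le> u" "u < t0 + 1" "Q u" by auto
    obtain t where t: "\<phi> t = u" using surj by blast
    have "t1 \<le> t" "t < t1 + 1"
      using u t t1 p1[of t1] strict_mono_less_eq[OF mono, of t1 t] strict_mono_less[OF mono, of t "t1 + 1"] by auto
    then show "u \<in> \<phi> ` {t \<in> {t1..<t1 + 1}. Q (\<phi> t)}" using t u by auto
  next
    fix u assume "u \<in> \<phi> ` {t \<in> {t1..<t1 + 1}. Q (\<phi> t)}"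
    then obtain t where "u = \<phi> t" "t1 \<le> t" "t < t1 + 1" "Q u" by auto
    then show "u \<in> {t \<in> {t0..<t0 + 1}. Q t}"
      using t1 p1[of t1] strict_mono_less_eq[OF mono, of t1 t] strict_mono_less[OF mono, of t "t1 + 1"] by auto
  qed
  have inj: "inj_on \<phi> A" for A
    by (rule strict_mono_imp_inj_on[OF mono])
  have card: "card {t \<in> {t1..<t1 + 1}. Q (\<phi> t)} = card {t \<in> {t0..<t0 + 1}. Q t}" for Q
    using card_image[OF inj, of "{t \<in> {t1..<t1 + 1}. Q (\<phi> t)}"] unfolding img by (rule sym)
  have "finite (\<phi> ` {t \<in> {t1..<t1 + 1}. velocity \<delta> (\<phi> t) $ 1 = 0})"
    using D.finite_cusps img[of "\<lambda>t. velocity \<delta> t $ 1 = 0"] by simp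
  then have fin: "finite {t \<in> {t1..<t1 + 1}. velocity (\<delta> \<circ> \<phi>) t $ 1 = 0}"
    unfolding zero by (rule finite_imageD) (rule inj)
  have "knot_curve cuspidal_curve (\<delta> \<circ> \<phi>) t1"
  proof unfold_locales
    show "velocity (\<delta> \<circ> \<phi>) t1 $ 1 \<noteq> 0" unfolding zero t1 by (rule D.start)
    show "velocity (\<delta> \<circ> \<phi>) t $ 2 * acceleration (\<delta> \<circ> \<phi>) t $ 1 \<noteq> 0" if "velocity (\<delta> \<circ> \<phi>) t $ 1 = 0" for t
    proof -
      have "velocity \<delta> (\<phi> t) $ 1 = 0" using that by (simp add: zero)
      from prod[OF this] D.cusp[OF this] phi(2)[of t] show ?thesis by (auto simp: mult.commute)
    qed
  qed (rule fin)
  moreover have "flat_front (\<delta> \<circ> \<phi>)"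
    using f int by (auto simp: flat_front_def)
  moreover have "up_params (\<delta> \<circ> \<phi>) t1 = {t \<in> {t1..<t1 + 1}. (velocity \<delta> (\<phi> t) $ 1 = 0 \<and> acceleration \<delta> (\<phi> t) $ 1 * velocity \<delta> (\<phi> t) $ 2 > 0)}"
    unfolding up_params_def zero by (intro Collect_cong conj_cong refl sign)
  moreover have "down_params (\<delta> \<circ> \<phi>) t1 = {t \<in> {t1..<t1 + 1}. (velocity \<delta> (\<phi> t) $ 1 = 0 \<and> acceleration \<delta> (\<phi> t) $ 1 * velocity \<delta> (\<phi> t) $ 2 < 0)}"
    unfolding down_params_def zero by (intro Collect_cong conj_cong refl sign)
  ultimately show ?thesis
    using that card[of "\<lambda>t. velocity \<delta> t $ 1 = 0 \<and> acceleration \<delta> t $ 1 * velocity \<delta> t $ 2 > 0"]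
      card[of "\<lambda>t. velocity \<delta> t $ 1 = 0 \<and> acceleration \<delta> t $ 1 * velocity \<delta> t $ 2 < 0"]
    unfolding up_params_def[of \<delta>] down_params_def[of \<delta>] by auto
qed

text \<open>Outside [0, 1] nothing is known about the curves of an isotopy, so their velocity can be
  identified with a partial derivative of the smooth extension only for s in [0, 1].\<close>

lemma C2_curve_cong:
  assumes "C2_curve f" and eq: "\<And>s t. s \<in> {0..1} \<Longrightarrow> g s t = f s t"
  shows "C2_curve g"
proof -
  obtain fs ft fts ftt where "C2_curves f fs ft fts ftt" using assms(1) C2_curve_def by blast
  then interpret C2_curves f fs ft fts ftt .
  have "C2_curves g fs ft fts ftt"
  proof unfold_locales
    show "((\<lambda>s. g s t) has_real_derivative fs s t) (at s within {0..1})" if "s \<in> {0..1}" for s t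
      by (rule DERIV_transform_set[OF DERIV_s[OF that] that eq])
    show "((\<lambda>t. g s t) has_real_derivative ft s t) (at t)" if "s \<in> {0..1}" for s t
      using DERIV_t[OF that] by (simp add: eq[OF that])
    show "cont2 g"
      using cont(1) unfolding cont2_def by (rule continuous_on_eq) (auto simp: eq)
  qed (use DERIV_ts DERIV_tt cont periodic eq in simp_all)
  then show ?thesis unfolding C2_curve_def by blast
qed

lemma isotopy_curves:
  fixes \<Gamma> :: "real \<Rightarrow> real \<Rightarrow> real ^ 3"
  assumes S: "{0..1} \<times> UNIV \<subseteq> S" and sm: "smooth_on_open S (\<lambda>(s, t). \<Gamma> s t)"
    and knot: "\<And>s. s \<in> {0..1} \<Longrightarrow> legendrian_knot (\<Gamma> s)"
  shows "legendrian_isotopy (\<lambda>s t. \<Gamma> s t $ 1) (\<lambda>s t. \<Gamma> s t $ 2) (\<lambda>s t. \<Gamma> s t $ 3)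
    (\<lambda>s t. velocity (\<Gamma> s) t $ 1) (\<lambda>s t. velocity (\<Gamma> s) t $ 2)
    (\<lambda>s t. acceleration (\<Gamma> s) t $ 1) (\<lambda>s t. acceleration (\<Gamma> s) t $ 2)"
proof -
  define G where "G = (\<lambda>(s, t). \<Gamma> s t)"
  have smG: "Ck_on k S G" for k using sm by (simp add: G_def smooth_on_open_def)
  have G: "G (s, t) = \<Gamma> s t" for s t by (simp add: G_def)
  have per: "G (s, t + 1) $ i = G (s, t) $ i" if "s \<in> {0..1}" for s t i
    by (simp add: G knot_periodic(1)[OF knot[OF that]])
  have C: "C2_curve (\<lambda>s t. G (s, t) $ i)" for i
    by (rule C2_curve_smooth(1)[OF S smG]) (simp add: per)
  have C2: "((\<lambda>t. G (s, t) $ i) has_real_derivative frechet_derivative G (at (s, t)) (0, 1) $ i) (at t)"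
    and C3: "frechet_derivative G (at (s, t + 1)) (0, 1) $ i = frechet_derivative G (at (s, t)) (0, 1) $ i"
    if "s \<in> {0..1}" for s t i
    by (rule C2_curve_smooth(2,3)[OF S smG _ that], simp add: per)+
  have C4: "Ck_on k S (\<lambda>p. frechet_derivative G (at p) (0, 1))" for k
    \<comment> \<open>The conclusion does not mention the coordinate, so any index may be
      chosen.\<close>
    by (rule C2_curve_smooth(4)[OF S smG, where i = 1]) (simp add: per)
  have c: "C2_curve (\<lambda>s t. \<Gamma> s t $ i)" for i
    using C[of i] by (simp add: G)
  have vel: "velocity (\<Gamma> s) t $ i = frechet_derivative G (at (s, t)) (0, 1) $ i" if "s \<in> {0..1}" for s t i
    using C2[OF that, of i t] has_vector_derivative_vec_nth[OF smooth_velocity(1)[OF knot_smooth[OF knot[OF that]]], of i t]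
    unfolding G by (metis DERIV_unique)
  have c': "C2_curve (\<lambda>s t. velocity (\<Gamma> s) t $ i)" for i
    by (rule C2_curve_cong[OF C2_curve_smooth(1)[OF S C4]]) (auto simp: vel C3)
  show ?thesis
  proof (rule legendrian_isotopy.intro)
    show "legendrian_curve (\<lambda>t. \<Gamma> s t $ 1) (\<lambda>t. \<Gamma> s t $ 2) (\<lambda>t. \<Gamma> s t $ 3) (\<lambda>t. velocity (\<Gamma> s) t $ 1)
        (\<lambda>t. velocity (\<Gamma> s) t $ 2) (\<lambda>t. acceleration (\<Gamma> s) t $ 1) (\<lambda>t. acceleration (\<Gamma> s) t $ 2)" if "s \<in> {0..1}" for s
      by (rule legendrian_curve_knot[OF knot[OF that]])
    show "velocity (\<Gamma> s) t $ 1 \<noteq> 0 \<or> velocity (\<Gamma> s) t $ 2 \<noteq> 0" if "s \<in> {0..1}" for s t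
      by (rule knot_contact(2)[OF knot[OF that]])
    show "a - b \<in> \<int>" if "s \<in> {0..1}" "\<Gamma> s a $ 1 = \<Gamma> s b $ 1" "\<Gamma> s a $ 2 = \<Gamma> s b $ 2" "\<Gamma> s a $ 3 = \<Gamma> s b $ 3" for s a b
    proof -
      have "\<Gamma> s a = \<Gamma> s b" using that by (simp add: vec_eq_iff forall_3)
      then show ?thesis using knot[OF that(1)] by (simp add: legendrian_knot_def)
    qed
  qed (rule c c')+
qed

theorem theorem4p6:
  fixes m n k l :: nat and \<gamma> \<delta> :: "real \<Rightarrow> real ^ 3"
  assumes "m > 0" "odd m" "n > 0" "odd n" "k > 0" "odd k" "l > 0" "odd l"
    and "(m, n) \<noteq> (k, l)"
    and "legendrian_U m n \<gamma>" and "legendrian_U k l \<delta>"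
  shows "\<not> legendrian_isotopic \<gamma> \<delta>"
proof
  assume "legendrian_isotopic \<gamma> \<delta>"
  then obtain \<Gamma> :: "real \<Rightarrow> real \<Rightarrow> real ^ 3" where \<Gamma>: "(\<exists>W. {0..1} \<times> UNIV \<subseteq> W \<and> smooth_on_open W (\<lambda>(s, t). \<Gamma> s t)) \<and>
      (\<forall>s\<in>{0..1}. legendrian_knot (\<Gamma> s)) \<and> \<Gamma> 0 = \<gamma> \<and> (\<exists>\<phi>. oriented_reparam \<phi> \<and> \<Gamma> 1 = \<delta> \<circ> \<phi>)"
    unfolding legendrian_isotopic_def by (elim exE) (rule that)
  then have knot: "\<And>s. s \<in> {0..1} \<Longrightarrow> legendrian_knot (\<Gamma> s)" by simp
  obtain S where S: "{0..1} \<times> UNIV \<subseteq> S" "smooth_on_open S (\<lambda>(s, t). \<Gamma> s t)"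
    using conjunct1[OF \<Gamma>] by (elim exE conjE) (rule that)
  obtain \<phi> where ends: "\<Gamma> 0 = \<gamma>" "oriented_reparam \<phi>" "\<Gamma> 1 = \<delta> \<circ> \<phi>"
    using \<Gamma> by (elim exE conjE) (rule that)
  have \<delta>: "legendrian_knot \<delta>" "legendrian_knot (\<delta> \<circ> \<phi>)"
    using \<open>legendrian_U k l \<delta>\<close> knot[of 1] ends by (simp_all add: legendrian_U_def)
  obtain s0 where s0: "knot_curve cuspidal_curve \<gamma> s0" "flat_front \<gamma>"
    "card (up_params \<gamma> s0) = m" "card (down_params \<gamma> s0) = n"
    by (rule legendrian_U_params[OF \<open>legendrian_U m n \<gamma>\<close>])
  obtain t0 where t0: "knot_curve cuspidal_curve \<delta> t0" "flat_front \<delta>"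
    "card (up_params \<delta> t0) = k" "card (down_params \<delta> t0) = l"
    by (rule legendrian_U_params[OF \<open>legendrian_U k l \<delta>\<close>])
  \<comment> \<open>The isotopy ends at a reparametrisation of \<delta>, to which the counts of
    \<delta> are transferred.\<close>
  obtain s1 where s1: "knot_curve cuspidal_curve (\<delta> \<circ> \<phi>) s1" "flat_front (\<delta> \<circ> \<phi>)"
    "card (up_params (\<delta> \<circ> \<phi>) s1) = k" "card (down_params (\<delta> \<circ> \<phi>) s1) = l"
    by (rule cuspidal_reparam[OF t0(1,2) ends(2) \<delta>]) (simp add: t0)
  interpret legendrian_isotopy "\<lambda>s t. \<Gamma> s t $ 1" "\<lambda>s t. \<Gamma> s t $ 2" "\<lambda>s t. \<Gamma> s t $ 3"
    "\<lambda>s t. velocity (\<Gamma> s) t $ 1" "\<lambda>s t. velocity (\<Gamma> s) t $ 2"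
    "\<lambda>s t. acceleration (\<Gamma> s) t $ 1" "\<lambda>s t. acceleration (\<Gamma> s) t $ 2"
    by (rule isotopy_curves[OF S knot])
  have c: "knot_curve cuspidal_curve (\<Gamma> 0) s0" "knot_curve cuspidal_curve (\<Gamma> 1) s1"
    and f: "front_embedded 0" "front_embedded 1"
    using s0 s1 unfolding front_embedded_def ends flat_front_def by auto
  have "card (up_params (\<Gamma> 0) s0) = card (up_params (\<Gamma> 1) s1)" "card (down_params (\<Gamma> 0) s0) = card (down_params (\<Gamma> 1) s1)"
    using cusp_counts_invariant[OF c(1) f(1) c(2) f(2)]
    unfolding cuspidal_curve.ups_def[OF c(1)] cuspidal_curve.ups_def[OF c(2)]
      cuspidal_curve.downs_def[OF c(1)] cuspidal_curve.downs_def[OF c(2)] up_params_def down_params_def by auto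
  then have "(m, n) = (k, l)"
    using s0 s1 by (simp add: ends)
  with \<open>(m, n) \<noteq> (k, l)\<close> show False ..
qed

end
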